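(* Let $(M,\omega)$ be a geometrically bounded symplectic manifold which is rational, meaning that $\omega(H_2(M))\subset\mathbb{R}$ is discrete. Let $S$ be the positive generator of the group $\omega(H_2(M))$, or $S=\infty$ if this group is zero. Let $L\subset M$ be a closed Lagrangian and let $L_n\to L$ be a $C^\infty$-converging sequence of Lagrangians. Assume that $\hbar(L_n)$ converges to a number $H<S$. Then $\hbar(L)\le H$.
   Context: Lagrangians are closed and embedded; the space of closed Lagrangians of $M$ is endowed with the $C^\infty$ topology. $H_2(M)$ has integer coefficients and $\omega(H_2(M))$ is the group of values of $[\omega]$ on it. A symplectic manifold is geometrically bounded if it admits an almost complex structure $J$ and a complete Riemannian metric such that $J$ is uniformly tamed by $\omega$, $|\omega(X,Y)|\le C|X||Y|$ for some constant $C$, the sectional curvature is bounded above and the injectivity radius is bounded below by a positive constant. Let $\mathcal{J}_\omega$ be the space of $\omega$-tame almost complex structures. For $J\in\mathcal{J}_\omega$ let $\hbar_D(L,J)$ be the infimum of $\int_D u^*\omega$ over non-constant $J$-holomorphic disks $u\colon(B^2,\partial B^2)\to(M,L)$ ($D$ denoting the domain disk), and $\hbar_D(L)=\sup_{J\in\mathcal{J}_\omega}\hbar_D(L,J)$. Define $\hbar_S(M,J)$ and $\hbar_S(M)=\sup_J\hbar_S(M,J)$ in the same way with non-constant $J$-holomorphic spheres in $M$ (infimum of the empty set is $\infty$). Put $\hbar(L)=\min\{\hbar_D(L),\hbar_S(M)\}$. *)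

theory Defs
  imports "HOL-Analysis.Analysis" "HOL-Homology.Homology"
begin

section \<open>Smooth maps between Euclidean spaces\<close>

text \<open>Only meant for open sets.\<close>

primrec Ck_on :: "nat \<Rightarrow> ('b::euclidean_space \<Rightarrow> 'c::euclidean_space) \<Rightarrow> 'b set \<Rightarrow> bool" where
  "Ck_on 0 = (\<lambda>f V. continuous_on V f)"
| "Ck_on (Suc k) = (\<lambda>f V. (\<forall>x\<in>V. f differentiable at x) \<and>
     (\<forall>v. Ck_on k (\<lambda>x. frechet_derivative f (at x) v) V))"

definition smooth_on :: "('b::euclidean_space \<Rightarrow> 'c::euclidean_space) \<Rightarrow> 'b set \<Rightarrow> bool" where
  "smooth_on f V \<longleftrightarrow> (\<forall>k. Ck_on k f V)"

primrec iter_deriv :: "'b list \<Rightarrow> ('b::euclidean_space \<Rightarrow> 'c::euclidean_space) \<Rightarrow> 'b \<Rightarrow> 'c" where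
  "iter_deriv [] f = f"
| "iter_deriv (v # vs) f = (\<lambda>x. frechet_derivative (iter_deriv vs f) (at x) v)"


section \<open>Smooth manifolds\<close>

text \<open>A chart is a pair of an open domain and a coordinate map; the values of the coordinate map
  outside the domain are irrelevant. A smooth structure is a maximal atlas. Manifolds are Hausdorff
  and second countable, and are not required to be connected.\<close>

type_synonym ('a, 'e) chart = "'a set \<times> ('a \<Rightarrow> 'e)"

abbreviation param :: "('a, 'e) chart \<Rightarrow> 'e \<Rightarrow> 'a" where
  "param c \<equiv> inv_into (fst c) (snd c)"

definition chart_of :: "'a topology \<Rightarrow> ('a, 'e::euclidean_space) chart \<Rightarrow> bool" where
  "chart_of X c \<longleftrightarrow> openin X (fst c) \<and> open (snd c ` fst c) \<and>
     homeomorphic_map (subtopology X (fst c)) (top_of_set (snd c ` fst c)) (snd c)"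

definition compatible :: "('a, 'e::euclidean_space) chart \<Rightarrow> ('a, 'e) chart \<Rightarrow> bool" where
  "compatible c d \<longleftrightarrow>
     smooth_on (snd d \<circ> param c) (snd c ` (fst c \<inter> fst d)) \<and>
     smooth_on (snd c \<circ> param d) (snd d ` (fst c \<inter> fst d))"

definition smooth_manifold :: "'a topology \<Rightarrow> ('a, 'e::euclidean_space) chart set \<Rightarrow> bool" where
  "smooth_manifold X A \<longleftrightarrow> Hausdorff_space X \<and> second_countable X \<and>
     (\<Union>c\<in>A. fst c) = topspace X \<and>
     (\<forall>c\<in>A. chart_of X c) \<and> (\<forall>c\<in>A. \<forall>d\<in>A. compatible c d) \<and>
     (\<forall>c. chart_of X c \<and> (\<forall>d\<in>A. compatible c d) \<longrightarrow> c \<in> A)"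

text \<open>Smoothness of a map defined on a possibly non-open subset \<open>K\<close> of a Euclidean space
  (a closed disk, a closed triangle): it extends smoothly to a neighbourhood of each point.\<close>

definition smooth_map_on ::
  "('a, 'e::euclidean_space) chart set \<Rightarrow> 'b::euclidean_space set \<Rightarrow> ('b \<Rightarrow> 'a) \<Rightarrow> bool" where
  "smooth_map_on A K u \<longleftrightarrow>
     (\<forall>z\<in>K. \<exists>V u'. \<exists>c\<in>A. open V \<and> z \<in> V \<and> u' ` V \<subseteq> fst c \<and> smooth_on (snd c \<circ> u') V \<and>
        (\<forall>w\<in>V \<inter> K. u' w = u w))"


section \<open>Tensor fields\<close>

text \<open>Tensor fields are given by their components: \<open>\<omega> c p u v\<close> is the value at the point
  \<open>p \<in> fst c\<close> on the two tangent vectors whose coordinates in the chart \<open>c\<close> are \<open>u\<close> and \<open>v\<close>. The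
  components in different charts are related by the derivative of the change of coordinates.\<close>

type_synonym ('a, 'e) tensor02 = "('a, 'e) chart \<Rightarrow> 'a \<Rightarrow> 'e \<Rightarrow> 'e \<Rightarrow> real"
type_synonym ('a, 'e) tensor11 = "('a, 'e) chart \<Rightarrow> 'a \<Rightarrow> 'e \<Rightarrow> 'e"

definition change_coords ::
  "('a, 'e::euclidean_space) chart \<Rightarrow> ('a, 'e) chart \<Rightarrow> 'a \<Rightarrow> 'e \<Rightarrow> 'e" where
  "change_coords c d p = frechet_derivative (snd d \<circ> param c) (at (snd c p))"

definition coord_deriv ::
  "('a, 'e::euclidean_space) chart \<Rightarrow> ('a \<Rightarrow> 'b::euclidean_space) \<Rightarrow> 'a \<Rightarrow> 'e \<Rightarrow> 'b" where
  "coord_deriv c F p = frechet_derivative (F \<circ> param c) (at (snd c p))"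

definition smooth_tensor02 ::
  "('a, 'e::euclidean_space) chart set \<Rightarrow> ('a, 'e) tensor02 \<Rightarrow> bool" where
  "smooth_tensor02 A g \<longleftrightarrow>
     (\<forall>c\<in>A. \<forall>p\<in>fst c. bilinear (g c p)) \<and>
     (\<forall>c\<in>A. \<forall>u v. smooth_on (\<lambda>x. g c (param c x) u v) (snd c ` fst c)) \<and>
     (\<forall>c\<in>A. \<forall>d\<in>A. \<forall>p\<in>fst c \<inter> fst d. \<forall>u v.
        g c p u v = g d p (change_coords c d p u) (change_coords c d p v))"

definition smooth_tensor11 ::
  "('a, 'e::euclidean_space) chart set \<Rightarrow> ('a, 'e) tensor11 \<Rightarrow> bool" where
  "smooth_tensor11 A J \<longleftrightarrow>
     (\<forall>c\<in>A. \<forall>p\<in>fst c. linear (J c p)) \<and>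
     (\<forall>c\<in>A. \<forall>u. smooth_on (\<lambda>x. J c (param c x) u) (snd c ` fst c)) \<and>
     (\<forall>c\<in>A. \<forall>d\<in>A. \<forall>p\<in>fst c \<inter> fst d. \<forall>u.
        change_coords c d p (J c p u) = J d p (change_coords c d p u))"

definition symplectic_form ::
  "('a, 'e::euclidean_space) chart set \<Rightarrow> ('a, 'e) tensor02 \<Rightarrow> bool" where
  "symplectic_form A \<omega> \<longleftrightarrow> smooth_tensor02 A \<omega> \<and>
     (\<forall>c\<in>A. \<forall>p\<in>fst c.
        (\<forall>u. \<omega> c p u u = 0) \<and>
        (\<forall>u. (\<forall>v. \<omega> c p u v = 0) \<longrightarrow> u = 0) \<and>
        (\<forall>u v w. coord_deriv c (\<lambda>q. \<omega> c q v w) p u + coord_deriv c (\<lambda>q. \<omega> c q w u) p v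
           + coord_deriv c (\<lambda>q. \<omega> c q u v) p w = 0))"

definition symplectic_manifold ::
  "'a topology \<Rightarrow> ('a, 'e::euclidean_space) chart set \<Rightarrow> ('a, 'e) tensor02 \<Rightarrow> bool" where
  "symplectic_manifold X A \<omega> \<longleftrightarrow> smooth_manifold X A \<and> symplectic_form A \<omega>"

definition almost_complex_structure ::
  "('a, 'e::euclidean_space) chart set \<Rightarrow> ('a, 'e) tensor11 \<Rightarrow> bool" where
  "almost_complex_structure A J \<longleftrightarrow> smooth_tensor11 A J \<and>
     (\<forall>c\<in>A. \<forall>p\<in>fst c. \<forall>u. J c p (J c p u) = - u)"

definition tame_structures ::
  "('a, 'e::euclidean_space) chart set \<Rightarrow> ('a, 'e) tensor02 \<Rightarrow> ('a, 'e) tensor11 set" where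
  "tame_structures A \<omega> = {J. almost_complex_structure A J \<and>
     (\<forall>c\<in>A. \<forall>p\<in>fst c. \<forall>u. u \<noteq> 0 \<longrightarrow> \<omega> c p u (J c p u) > 0)}"


section \<open>Riemannian geometry\<close>

definition riemannian_metric ::
  "('a, 'e::euclidean_space) chart set \<Rightarrow> ('a, 'e) tensor02 \<Rightarrow> bool" where
  "riemannian_metric A g \<longleftrightarrow> smooth_tensor02 A g \<and>
     (\<forall>c\<in>A. \<forall>p\<in>fst c. (\<forall>u v. g c p u v = g c p v u) \<and> (\<forall>u. u \<noteq> 0 \<longrightarrow> g c p u u > 0))"

text \<open>The Christoffel symbols \<open>\<Gamma>\<close> of the Levi-Civita connection as a bilinear map, from the
  Koszul formula.\<close>

definition christoffel ::
  "('a, 'e::euclidean_space) tensor02 \<Rightarrow> ('a, 'e) chart \<Rightarrow> 'a \<Rightarrow> 'e \<Rightarrow> 'e \<Rightarrow> 'e" where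
  "christoffel g c p u v = (THE w. \<forall>z. g c p w z =
     (coord_deriv c (\<lambda>q. g c q v z) p u + coord_deriv c (\<lambda>q. g c q u z) p v
       - coord_deriv c (\<lambda>q. g c q u v) p z) / 2)"

definition curvature ::
  "('a, 'e::euclidean_space) tensor02 \<Rightarrow> ('a, 'e) chart \<Rightarrow> 'a \<Rightarrow> 'e \<Rightarrow> 'e \<Rightarrow> 'e \<Rightarrow> 'e" where
  "curvature g c p u v w =
     coord_deriv c (\<lambda>q. christoffel g c q v w) p u - coord_deriv c (\<lambda>q. christoffel g c q u w) p v
     + christoffel g c p u (christoffel g c p v w) - christoffel g c p v (christoffel g c p u w)"

definition sectional_curvature ::
  "('a, 'e::euclidean_space) tensor02 \<Rightarrow> ('a, 'e) chart \<Rightarrow> 'a \<Rightarrow> 'e \<Rightarrow> 'e \<Rightarrow> real" where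
  "sectional_curvature g c p u v =
     g c p (curvature g c p u v v) u / (g c p u u * g c p v v - (g c p u v)\<^sup>2)"

definition sectional_curvature_bounded_above ::
  "('a, 'e::euclidean_space) chart set \<Rightarrow> ('a, 'e) tensor02 \<Rightarrow> bool" where
  "sectional_curvature_bounded_above A g \<longleftrightarrow>
     (\<exists>\<kappa>. \<forall>c\<in>A. \<forall>p\<in>fst c. \<forall>u v. u \<noteq> v \<and> independent {u, v} \<longrightarrow> sectional_curvature g c p u v \<le> \<kappa>)"

text \<open>Geodesics are parametrized by the whole real line. Since coordinate maps are arbitrary outside
  their domains, continuity of the curve has to be required separately.\<close>

definition geodesic ::
  "'a topology \<Rightarrow> ('a, 'e::euclidean_space) chart set \<Rightarrow> ('a, 'e) tensor02 \<Rightarrow> (real \<Rightarrow> 'a) \<Rightarrow> bool" where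
  "geodesic X A g \<gamma> \<longleftrightarrow> continuous_map euclideanreal X \<gamma> \<and>
     (\<forall>t. \<forall>c\<in>A. \<gamma> t \<in> fst c \<longrightarrow>
        (\<exists>\<gamma>'. (\<forall>\<^sub>F s in nhds t. (snd c \<circ> \<gamma> has_vector_derivative \<gamma>' s) (at s)) \<and>
              (\<gamma>' has_vector_derivative - christoffel g c (\<gamma> t) (\<gamma>' t) (\<gamma>' t)) (at t)))"

definition geodesic_from ::
  "'a topology \<Rightarrow> ('a, 'e::euclidean_space) chart set \<Rightarrow> ('a, 'e) tensor02 \<Rightarrow>
     ('a, 'e) chart \<Rightarrow> 'a \<Rightarrow> 'e \<Rightarrow> (real \<Rightarrow> 'a) \<Rightarrow> bool" where
  "geodesic_from X A g c p v \<gamma> \<longleftrightarrow> geodesic X A g \<gamma> \<and> \<gamma> 0 = p \<and>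
     (snd c \<circ> \<gamma> has_vector_derivative v) (at 0)"

definition complete_metric ::
  "'a topology \<Rightarrow> ('a, 'e::euclidean_space) chart set \<Rightarrow> ('a, 'e) tensor02 \<Rightarrow> bool" where
  "complete_metric X A g \<longleftrightarrow> (\<forall>c\<in>A. \<forall>p\<in>fst c. \<forall>v. \<exists>\<gamma>. geodesic_from X A g c p v \<gamma>)"

text \<open>The exponential map, with tangent vectors at \<open>p\<close> expressed in the chart \<open>c\<close>. It is only used
  for complete metrics.\<close>

definition exp_map ::
  "'a topology \<Rightarrow> ('a, 'e::euclidean_space) chart set \<Rightarrow> ('a, 'e) tensor02 \<Rightarrow>
     ('a, 'e) chart \<Rightarrow> 'a \<Rightarrow> 'e \<Rightarrow> 'a" where
  "exp_map X A g c p v = (THE q. \<exists>\<gamma>. geodesic_from X A g c p v \<gamma> \<and> \<gamma> 1 = q)"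

text \<open>The exponential map is a diffeomorphism from the \<open>r\<close>-ball \<open>B\<close> in the tangent space onto an open
  set iff its inverse (normal coordinates) is a chart of the maximal atlas.\<close>

definition injectivity_radius ::
  "'a topology \<Rightarrow> ('a, 'e::euclidean_space) chart set \<Rightarrow> ('a, 'e) tensor02 \<Rightarrow> 'a \<Rightarrow> ereal" where
  "injectivity_radius X A g p = Sup {ereal r | r. r > 0 \<and>
     (\<forall>c\<in>A. p \<in> fst c \<longrightarrow>
        (let B = {v. sqrt (g c p v v) < r}; E = exp_map X A g c p
         in inj_on E B \<and> (E ` B, inv_into B E) \<in> A))}"

definition geometrically_bounded ::
  "'a topology \<Rightarrow> ('a, 'e::euclidean_space) chart set \<Rightarrow> ('a, 'e) tensor02 \<Rightarrow> bool" where
  "geometrically_bounded X A \<omega> \<longleftrightarrow>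
     (\<exists>J g. almost_complex_structure A J \<and> riemannian_metric A g \<and> complete_metric X A g \<and>
        (\<exists>\<alpha>>0. \<forall>c\<in>A. \<forall>p\<in>fst c. \<forall>u. \<omega> c p u (J c p u) \<ge> \<alpha> * g c p u u) \<and>
        (\<exists>C. \<forall>c\<in>A. \<forall>p\<in>fst c. \<forall>u v. \<bar>\<omega> c p u v\<bar> \<le> C * sqrt (g c p u u) * sqrt (g c p v v)) \<and>
        sectional_curvature_bounded_above A g \<and>
        (\<exists>r>0. \<forall>p\<in>topspace X. ereal r \<le> injectivity_radius X A g p))"


section \<open>Symplectic area and periods\<close>

text \<open>Derivative at \<open>z\<close>, in the chart \<open>c\<close>, of a smooth map on \<open>K \<subseteq> \<complex>\<close>. The sets \<open>K\<close> below are convex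
  with nonempty interior, so that the derivative within \<open>K\<close> is unique.\<close>

definition map_deriv ::
  "('a, 'e::euclidean_space) chart \<Rightarrow> complex set \<Rightarrow> (complex \<Rightarrow> 'a) \<Rightarrow> complex \<Rightarrow> complex \<Rightarrow> 'e" where
  "map_deriv c K u z = frechet_derivative (snd c \<circ> u) (at z within K)"

text \<open>The integral of \<open>u\<^sup>*\<omega> = \<omega>(\<partial>\<^sub>x u, \<partial>\<^sub>y u) dx dy\<close> over \<open>K\<close>; the integrand does not depend on the chart.\<close>

definition area ::
  "('a, 'e::euclidean_space) chart set \<Rightarrow> ('a, 'e) tensor02 \<Rightarrow> complex set \<Rightarrow> (complex \<Rightarrow> 'a) \<Rightarrow> real" where
  "area A \<omega> K u = (LINT z:K|lborel.
     (let c = (SOME c. c \<in> A \<and> u z \<in> fst c)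
      in \<omega> c (u z) (map_deriv c K u z 1) (map_deriv c K u z \<i>)))"

definition triangle :: "complex set" where
  "triangle = {z. 0 \<le> Re z \<and> 0 \<le> Im z \<and> Re z + Im z \<le> 1}"

definition simplex_point :: "complex \<Rightarrow> nat \<Rightarrow> real" where
  "simplex_point z = (\<lambda>i. if i = 0 then 1 - Re z - Im z else if i = 1 then Re z
                          else if i = 2 then Im z else 0)"

definition smooth_2chain :: "('a, 'e::euclidean_space) chart set \<Rightarrow> 'a chain \<Rightarrow> bool" where
  "smooth_2chain A a \<longleftrightarrow> (\<forall>\<sigma>\<in>Poly_Mapping.keys a. smooth_map_on A triangle (\<sigma> \<circ> simplex_point))"

definition chain_integral ::
  "('a, 'e::euclidean_space) chart set \<Rightarrow> ('a, 'e) tensor02 \<Rightarrow> 'a chain \<Rightarrow> real" where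
  "chain_integral A \<omega> a =
     (\<Sum>\<sigma>\<in>Poly_Mapping.keys a. of_int (Poly_Mapping.lookup a \<sigma>) * area A \<omega> triangle (\<sigma> \<circ> simplex_point))"

text \<open>The value of the de Rham class of \<open>\<omega>\<close> on an integral singular homology class: the integral of
  \<open>\<omega>\<close> over any smooth cycle representing the class.\<close>

definition period ::
  "('a, 'e::euclidean_space) chart set \<Rightarrow> ('a, 'e) tensor02 \<Rightarrow> 'a chain set \<Rightarrow> real" where
  "period A \<omega> h = (THE r. \<exists>a\<in>h. smooth_2chain A a \<and> r = chain_integral A \<omega> a)"

definition period_group ::
  "'a topology \<Rightarrow> ('a, 'e::euclidean_space) chart set \<Rightarrow> ('a, 'e) tensor02 \<Rightarrow> real set" where
  "period_group X A \<omega> = period A \<omega> ` carrier (homology_group 2 X)"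

definition rational_symplectic ::
  "'a topology \<Rightarrow> ('a, 'e::euclidean_space) chart set \<Rightarrow> ('a, 'e) tensor02 \<Rightarrow> bool" where
  "rational_symplectic X A \<omega> \<longleftrightarrow> discrete (period_group X A \<omega>)"

definition period_generator ::
  "'a topology \<Rightarrow> ('a, 'e::euclidean_space) chart set \<Rightarrow> ('a, 'e) tensor02 \<Rightarrow> ereal" where
  "period_generator X A \<omega> =
     (if period_group X A \<omega> = {0} then \<infinity>
      else ereal (THE s. s > 0 \<and> period_group X A \<omega> = range (\<lambda>k::int. of_int k * s)))"


section \<open>Holomorphic disks and spheres\<close>

definition holomorphic_map ::
  "('a, 'e::euclidean_space) chart set \<Rightarrow> ('a, 'e) tensor11 \<Rightarrow> complex set \<Rightarrow> (complex \<Rightarrow> 'a) \<Rightarrow> bool" where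
  "holomorphic_map A J K u \<longleftrightarrow> smooth_map_on A K u \<and>
     (\<forall>z\<in>K. \<forall>c\<in>A. u z \<in> fst c \<longrightarrow>
        (\<forall>w. map_deriv c K u z (\<i> * w) = J c (u z) (map_deriv c K u z w)))"

definition holomorphic_disk ::
  "('a, 'e::euclidean_space) chart set \<Rightarrow> ('a, 'e) tensor11 \<Rightarrow> 'a set \<Rightarrow> (complex \<Rightarrow> 'a) \<Rightarrow> bool" where
  "holomorphic_disk A J L u \<longleftrightarrow> holomorphic_map A J (cball 0 1) u \<and> u ` sphere 0 1 \<subseteq> L"

text \<open>A holomorphic sphere is described by its restriction \<open>u\<close> to the affine part \<open>\<complex>\<close> of the Riemann
  sphere; \<open>u'\<close> is its expression in the coordinate \<open>1/z\<close> around infinity.\<close>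

definition holomorphic_sphere ::
  "('a, 'e::euclidean_space) chart set \<Rightarrow> ('a, 'e) tensor11 \<Rightarrow> (complex \<Rightarrow> 'a) \<Rightarrow> bool" where
  "holomorphic_sphere A J u \<longleftrightarrow> holomorphic_map A J UNIV u \<and>
     (\<exists>u'. holomorphic_map A J UNIV u' \<and> (\<forall>z. z \<noteq> 0 \<longrightarrow> u' z = u (1 / z)))"

definition hbar_disk_J ::
  "('a, 'e::euclidean_space) chart set \<Rightarrow> ('a, 'e) tensor02 \<Rightarrow> 'a set \<Rightarrow> ('a, 'e) tensor11 \<Rightarrow> ereal" where
  "hbar_disk_J A \<omega> L J = Inf {ereal (area A \<omega> (cball 0 1) u) | u.
     holomorphic_disk A J L u \<and> \<not> u constant_on cball 0 1}"

definition hbar_disk ::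
  "('a, 'e::euclidean_space) chart set \<Rightarrow> ('a, 'e) tensor02 \<Rightarrow> 'a set \<Rightarrow> ereal" where
  "hbar_disk A \<omega> L = (SUP J\<in>tame_structures A \<omega>. hbar_disk_J A \<omega> L J)"

definition hbar_sphere_J ::
  "('a, 'e::euclidean_space) chart set \<Rightarrow> ('a, 'e) tensor02 \<Rightarrow> ('a, 'e) tensor11 \<Rightarrow> ereal" where
  "hbar_sphere_J A \<omega> J = Inf {ereal (area A \<omega> UNIV u) | u.
     holomorphic_sphere A J u \<and> \<not> u constant_on UNIV}"

definition hbar_sphere ::
  "('a, 'e::euclidean_space) chart set \<Rightarrow> ('a, 'e) tensor02 \<Rightarrow> ereal" where
  "hbar_sphere A \<omega> = (SUP J\<in>tame_structures A \<omega>. hbar_sphere_J A \<omega> J)"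

definition hbar ::
  "('a, 'e::euclidean_space) chart set \<Rightarrow> ('a, 'e) tensor02 \<Rightarrow> 'a set \<Rightarrow> ereal" where
  "hbar A \<omega> L = min (hbar_disk A \<omega> L) (hbar_sphere A \<omega>)"


section \<open>Closed Lagrangians and their smooth convergence\<close>

text \<open>A symplectic manifold has even dimension; from here on its model space is \<open>'f \<times> 'f\<close>, so that
  Lagrangian submanifolds are modelled on the slice \<open>'f \<times> {0}\<close>.\<close>

definition slice_chart ::
  "('a, 'f::euclidean_space \<times> 'f) chart set \<Rightarrow> 'a set \<Rightarrow> ('a, 'f \<times> 'f) chart \<Rightarrow> bool" where
  "slice_chart A L c \<longleftrightarrow> c \<in> A \<and> snd c ` (fst c \<inter> L) = snd c ` fst c \<inter> (UNIV \<times> {0})"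

definition closed_lagrangian ::
  "'a topology \<Rightarrow> ('a, 'f::euclidean_space \<times> 'f) chart set \<Rightarrow> ('a, 'f \<times> 'f) tensor02 \<Rightarrow> 'a set \<Rightarrow> bool" where
  "closed_lagrangian X A \<omega> L \<longleftrightarrow> compactin X L \<and>
     (\<forall>p\<in>L. \<exists>c. slice_chart A L c \<and> p \<in> fst c) \<and>
     (\<forall>c p u v. slice_chart A L c \<and> p \<in> fst c \<inter> L \<longrightarrow> \<omega> c p (u, 0) (v, 0) = 0)"

text \<open>Coordinates on the submanifold induced by a slice chart: \<open>slice_param c\<close> maps the open set
  \<open>slice_dom c\<close> onto \<open>fst c \<inter> L\<close>.\<close>

definition slice_dom :: "('a, 'f::euclidean_space \<times> 'f) chart \<Rightarrow> 'f set" where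
  "slice_dom c = {y. (y, 0) \<in> snd c ` fst c}"

definition slice_param :: "('a, 'f::euclidean_space \<times> 'f) chart \<Rightarrow> 'f \<Rightarrow> 'a" where
  "slice_param c y = param c (y, 0)"

definition smooth_embedding ::
  "'a topology \<Rightarrow> ('a, 'f::euclidean_space \<times> 'f) chart set \<Rightarrow> 'a set \<Rightarrow> ('a \<Rightarrow> 'a) \<Rightarrow> bool" where
  "smooth_embedding X A L f \<longleftrightarrow> embedding_map (subtopology X L) X f \<and>
     (\<forall>c. slice_chart A L c \<longrightarrow>
        smooth_map_on A (slice_dom c) (f \<circ> slice_param c) \<and>
        (\<forall>y\<in>slice_dom c. \<forall>d\<in>A. f (slice_param c y) \<in> fst d \<longrightarrow>
           inj (frechet_derivative (snd d \<circ> f \<circ> slice_param c) (at y))))"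

definition smooth_convergence ::
  "('a, 'f::euclidean_space \<times> 'f) chart set \<Rightarrow> 'a set \<Rightarrow> (nat \<Rightarrow> 'a \<Rightarrow> 'a) \<Rightarrow> ('a \<Rightarrow> 'a) \<Rightarrow> bool" where
  "smooth_convergence A L F f \<longleftrightarrow>
     (\<forall>c d K. slice_chart A L c \<and> d \<in> A \<and> compact K \<and> K \<subseteq> slice_dom c \<and>
          f ` slice_param c ` K \<subseteq> fst d \<longrightarrow>
        (\<forall>\<^sub>F n in sequentially. F n ` slice_param c ` K \<subseteq> fst d) \<and>
        (\<forall>vs. uniform_limit K (\<lambda>n. iter_deriv vs (snd d \<circ> F n \<circ> slice_param c))
                (iter_deriv vs (snd d \<circ> f \<circ> slice_param c)) sequentially))"

text \<open>The \<open>C\<^sup>\<infinity>\<close> topology on submanifolds is the quotient of the one on embeddings by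
  reparametrization. As the quotient map is open and the space of embeddings of a closed manifold is
  metrizable, a sequence converges to \<open>L\<close> iff it lifts to a sequence of embeddings of \<open>L\<close> that
  converges to the inclusion.\<close>

definition submanifolds_converge ::
  "'a topology \<Rightarrow> ('a, 'f::euclidean_space \<times> 'f) chart set \<Rightarrow> (nat \<Rightarrow> 'a set) \<Rightarrow> 'a set \<Rightarrow> bool" where
  "submanifolds_converge X A Ls L \<longleftrightarrow>
     (\<exists>F. (\<forall>\<^sub>F n in sequentially. smooth_embedding X A L (F n) \<and> F n ` L = Ls n) \<and>
          smooth_convergence A L F (\<lambda>p. p))"

end

theory Submission
  imports Defs
begin

text \<open>The sphere constant does not involve the Lagrangian, so the theorem follows once the disk constant
  is lower semicontinuous: if \<open>\<hbar>\<^sub>D(L) > H\<close>, then \<open>\<hbar>\<^sub>D(L\<^sub>n)\<close> stays above some \<open>K > H\<close> for large \<open>n\<close>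
  (\<open>hbar_disk_lower_semicontinuous\<close>). This is seen by transporting almost complex structures rather than
  by taking limits of disks.

  Let \<open>J\<close> be a tame structure with \<open>\<hbar>\<^sub>D(L, J) > H\<close>. The embeddings of \<open>L\<close> with image \<open>L\<^sub>n\<close> extend to
  diffeomorphisms \<open>\<phi>\<^sub>n\<close> of \<open>M\<close> that are the identity outside a fixed compact set and tend to the
  identity in \<open>C\<^sup>1\<close> (\<open>extend_to_diffeos\<close>). On a compact set \<open>\<omega>(v, J v)\<close> is bounded below by a multiple of
  \<open>|v|\<^sup>2\<close>, hence \<open>\<omega>(d\<phi>\<^sub>n v, d\<phi>\<^sub>n J v) \<ge> (1 - \<epsilon>) \<omega>(v, J v)\<close> for all tangent vectors \<open>v\<close> when \<open>n\<close> is large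
  (\<open>almost_preserves_eventually\<close>). This inequality has two consequences. The structure
  \<open>J\<^sub>n\<close> obtained from \<open>J\<close> by pushing it forward along \<open>\<phi>\<^sub>n\<close> is tame (\<open>push_tame\<close>). And the \<open>J\<^sub>n\<close>-holomorphic disks on
  \<open>L\<^sub>n\<close> are exactly the \<open>\<phi>\<^sub>n \<circ> w\<close> with \<open>w\<close> a \<open>J\<close>-holomorphic disk on \<open>L\<close>, with area at least \<open>1 - \<epsilon>\<close> times the
  area of \<open>w\<close>. So \<open>\<hbar>\<^sub>D(L\<^sub>n) \<ge> \<hbar>\<^sub>D(L\<^sub>n, J\<^sub>n) \<ge> (1 - \<epsilon>) \<hbar>\<^sub>D(L, J)\<close> (\<open>hbar_disk_J_push\<close>).

  The extension is built box by box. In a slice chart, where \<open>L\<close> is \<open>{z = 0}\<close>, an embedding close to the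
  inclusion is \<open>y \<mapsto> (y, 0) + \<delta>(y)\<close> with \<open>\<delta>\<close> small, and for a cutoff function \<open>\<rho>\<close> the map
  \<open>(y, z) \<mapsto> (y, z) + \<rho>(y, z) \<delta>(y)\<close> is a small perturbation of the identity, hence a diffeomorphism supported
  in the chart. Composing the embedding with its inverse produces an embedding that is the inclusion where
  \<open>\<rho> = 1\<close> and wherever it was the inclusion before (\<open>straighten_in_box\<close>). After finitely many boxes
  that cover \<open>L\<close> nothing is left to correct, and the composition of the diffeomorphisms is the extension.\<close>

section \<open>Calculus of smooth maps\<close>


lemma Ck_on_cong:
  assumes "open V" "\<And>x. x \<in> V \<Longrightarrow> f x = g x" "Ck_on k f V"
  shows "Ck_on k g V"
  using assms(2,3)
proof (induction k arbitrary: f g)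
  case 0
  then show ?case by (simp cong: continuous_on_cong)
next
  case (Suc k)
  have D: "(g has_derivative frechet_derivative f (at x)) (at x)" if "x \<in> V" for x
  proof -
    have "(f has_derivative frechet_derivative f (at x)) (at x)"
      using Suc.prems(2) that by (simp add: frechet_derivative_works)
    then show ?thesis
      by (rule has_derivative_transform_within_open[OF _ \<open>open V\<close> that]) (use Suc.prems(1) in auto)
  qed
  have E: "frechet_derivative g (at x) = frechet_derivative f (at x)" if "x \<in> V" for x
    using frechet_derivative_at[OF D[OF that]] by simp
  have "Ck_on k (\<lambda>x. frechet_derivative g (at x) v) V" for v
    by (rule Suc.IH[of "\<lambda>x. frechet_derivative f (at x) v"]) (use E Suc.prems(2) in auto)
  with D show ?case by (auto simp: differentiable_def)
qed

lemma Ck_on_SucI: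
  assumes "open V" "\<And>x. x \<in> V \<Longrightarrow> (f has_derivative D x) (at x)"
    and "\<And>v. Ck_on k (\<lambda>x. D x v) V"
  shows "Ck_on (Suc k) f V"
proof -
  have E: "frechet_derivative f (at x) = D x" if "x \<in> V" for x
    using frechet_derivative_at[OF assms(2)[OF that]] by simp
  have "Ck_on k (\<lambda>x. frechet_derivative f (at x) v) V" for v
    by (rule Ck_on_cong[OF assms(1) _ assms(3)[of v]]) (use E in auto)
  with assms(2) show ?thesis by (auto simp: differentiable_def)
qed

lemma Ck_on_SucD:
  assumes "Ck_on (Suc k) f V" "x \<in> V"
  shows "(f has_derivative frechet_derivative f (at x)) (at x)"
  using assms by (simp add: frechet_derivative_works)

lemma Ck_on_continuous: "Ck_on k f V \<Longrightarrow> continuous_on V f"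
proof (induction k arbitrary: f)
  case (Suc k)
  then show ?case
    by (auto intro!: continuous_at_imp_continuous_on simp: differentiable_imp_continuous_within)
qed simp

lemma Ck_on_lower: "Ck_on (Suc k) f V \<Longrightarrow> Ck_on k f V"
proof (induction k arbitrary: f)
  case 0
  then show ?case using Ck_on_continuous by fastforce
next
  case (Suc k)
  then show ?case by (metis Ck_on.simps(2))
qed

lemma Ck_on_subset: "Ck_on k f V \<Longrightarrow> W \<subseteq> V \<Longrightarrow> Ck_on k f W"
  by (induction k arbitrary: f) (auto intro: continuous_on_subset)

lemma Ck_on_local:
  assumes "\<And>x. x \<in> V \<Longrightarrow> \<exists>W. open W \<and> x \<in> W \<and> Ck_on k f W"
  shows "Ck_on k f V"
  using assms
proof (induction k arbitrary: f)
  case 0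
  then have "isCont f x" if "x \<in> V" for x
    using that 0[OF that] by (metis Ck_on.simps(1) continuous_on_eq_continuous_at)
  then show ?case by (simp add: continuous_at_imp_continuous_on)
next
  case (Suc k)
  have "Ck_on k (\<lambda>x. frechet_derivative f (at x) v) V" for v
    using Suc.prems by (intro Suc.IH) fastforce
  moreover have "f differentiable at x" if "x \<in> V" for x
    using Suc.prems[OF that] by auto
  ultimately show ?case by auto
qed

lemma Ck_on_const: "open V \<Longrightarrow> Ck_on k (\<lambda>x. c) V"
  by (induction k arbitrary: c) (auto intro!: Ck_on_SucI[where D = "\<lambda>x v. 0"] simp del: Ck_on.simps(2))

lemma Ck_on_linear:
  assumes "open V" "bounded_linear f"
  shows "Ck_on k f V"
proof (cases k)
  case 0
  then show ?thesis using linear_continuous_on[OF assms(2)] by simp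
next
  case (Suc k)
  show ?thesis unfolding Suc
    by (rule Ck_on_SucI[OF assms(1), where D = "\<lambda>x. f"])
       (auto intro: bounded_linear_imp_has_derivative assms Ck_on_const)
qed

lemma Ck_on_linear_compose:
  assumes "open V" "bounded_linear l" "Ck_on k f V"
  shows "Ck_on k (\<lambda>x. l (f x)) V"
  using assms(3)
proof (induction k arbitrary: f)
  case 0
  then show ?case using bounded_linear.continuous_on[OF assms(2)] by simp
next
  case (Suc k)
  show ?case
    by (rule Ck_on_SucI[OF assms(1), where D = "\<lambda>x v. l (frechet_derivative f (at x) v)"])
       (use Suc in \<open>auto intro!: bounded_linear.has_derivative[OF assms(2)] simp: frechet_derivative_works\<close>)
qed

lemma Ck_on_add:
  assumes "open V" "Ck_on k f V" "Ck_on k g V"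
  shows "Ck_on k (\<lambda>x. f x + g x) V"
  using assms(2,3)
proof (induction k arbitrary: f g)
  case 0
  then show ?case by (simp add: continuous_on_add)
next
  case (Suc k)
  show ?case
    by (rule Ck_on_SucI[OF assms(1), where
          D = "\<lambda>x v. frechet_derivative f (at x) v + frechet_derivative g (at x) v"])
       (use Suc in \<open>auto intro!: has_derivative_add simp: frechet_derivative_works\<close>)
qed

lemma Ck_on_sum:
  assumes "open V" "\<And>i. i \<in> I \<Longrightarrow> Ck_on k (f i) V"
  shows "Ck_on k (\<lambda>x. \<Sum>i\<in>I. f i x) V"
  using assms(2)
  by (induction I rule: infinite_finite_induct) (auto intro: Ck_on_const Ck_on_add assms(1))

lemma Ck_on_bilinear:
  fixes p :: "'b::euclidean_space \<Rightarrow> 'c::euclidean_space \<Rightarrow> 'd::euclidean_space"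
  assumes "open V" "bounded_bilinear p" "Ck_on k f V" "Ck_on k g V"
  shows "Ck_on k (\<lambda>x. p (f x) (g x)) V"
  using assms(3,4)
proof (induction k arbitrary: f g)
  case 0
  then show ?case using bounded_bilinear.continuous_on[OF assms(2)] by simp
next
  case (Suc k)
  show ?case
  proof (rule Ck_on_SucI[OF assms(1), where D =
      "\<lambda>x v. p (f x) (frechet_derivative g (at x) v) + p (frechet_derivative f (at x) v) (g x)"])
    have "Ck_on k f V" "Ck_on k g V" using Suc.prems Ck_on_lower by blast+
    moreover have "Ck_on k (\<lambda>x. frechet_derivative f (at x) v) V"
      "Ck_on k (\<lambda>x. frechet_derivative g (at x) v) V" for v
      using Suc.prems by auto
    ultimately show "Ck_on k (\<lambda>x. p (f x) (frechet_derivative g (at x) v)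
        + p (frechet_derivative f (at x) v) (g x)) V" for v
      by (intro Ck_on_add[OF assms(1)] Suc.IH)
  qed (use Suc in \<open>auto intro!: bounded_bilinear.FDERIV[OF assms(2)] simp: frechet_derivative_works\<close>)
qed

lemmas Ck_on_scaleR = Ck_on_bilinear[OF _ bounded_bilinear_scaleR]
lemmas Ck_on_mult = Ck_on_bilinear[OF _ bounded_bilinear_mult]

lemma linear_expansion: "linear l \<Longrightarrow> l v = (\<Sum>i\<in>Basis. (v \<bullet> i) *\<^sub>R l i)"
  by (subst euclidean_representation[of v, symmetric]) (simp only: linear_sum linear_scale)

text \<open>The derivative of a composition is expanded in a basis, so that it is a sum of products to
  which the induction hypothesis applies.\<close>

lemma Ck_on_compose:
  fixes g :: "'b::euclidean_space \<Rightarrow> 'c::euclidean_space"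
  assumes "open V" "open U" "f ` V \<subseteq> U" "Ck_on k f V" "Ck_on k g U"
  shows "Ck_on k (\<lambda>x. g (f x)) V"
  using assms(4,5)
proof (induction k arbitrary: g)
  case 0
  then show ?case using continuous_on_compose2 assms(3) by (metis Ck_on.simps(1))
next
  case (Suc k)
  let ?D = "\<lambda>x v. \<Sum>i\<in>Basis. (frechet_derivative f (at x) v \<bullet> i) *\<^sub>R frechet_derivative g (at (f x)) i"
  show ?case
  proof (rule Ck_on_SucI[OF assms(1), where D = ?D])
    fix x assume x: "x \<in> V"
    have "(f has_derivative frechet_derivative f (at x)) (at x)"
      using Suc.prems(1) x by (rule Ck_on_SucD)
    moreover have g: "(g has_derivative frechet_derivative g (at (f x))) (at (f x))"
      using Suc.prems(2) assms(3) x by (intro Ck_on_SucD) auto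
    ultimately have "((\<lambda>x. g (f x)) has_derivative
        (\<lambda>v. frechet_derivative g (at (f x)) (frechet_derivative f (at x) v))) (at x)"
      using diff_chain_at by (fastforce simp: o_def)
    moreover have "(\<lambda>v. frechet_derivative g (at (f x)) (frechet_derivative f (at x) v)) = ?D x"
      by (rule ext) (rule linear_expansion[OF has_derivative_linear[OF g]])
    ultimately show "((\<lambda>x. g (f x)) has_derivative ?D x) (at x)" by simp
  next
    fix v
    have f: "Ck_on k f V" and f': "Ck_on k (\<lambda>x. frechet_derivative f (at x) v) V"
      using Suc.prems(1) Ck_on_lower by auto
    show "Ck_on k (\<lambda>x. ?D x v) V"
      using Suc.prems(2)
      by (intro Ck_on_sum Ck_on_scaleR assms(1) Suc.IH[OF f]
          Ck_on_linear_compose[OF assms(1) bounded_linear_inner_left f']) auto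
  qed
qed

lemma smooth_on_cong: "open V \<Longrightarrow> (\<And>x. x \<in> V \<Longrightarrow> f x = g x) \<Longrightarrow> smooth_on f V \<Longrightarrow> smooth_on g V"
  unfolding smooth_on_def using Ck_on_cong by blast

lemma smooth_on_subset: "smooth_on f V \<Longrightarrow> W \<subseteq> V \<Longrightarrow> smooth_on f W"
  unfolding smooth_on_def using Ck_on_subset by blast

lemma smooth_on_local:
  "(\<And>x. x \<in> V \<Longrightarrow> \<exists>W. open W \<and> x \<in> W \<and> smooth_on f W) \<Longrightarrow> smooth_on f V"
  unfolding smooth_on_def using Ck_on_local by metis

lemma smooth_on_const: "open V \<Longrightarrow> smooth_on (\<lambda>x. c) V"
  by (simp add: smooth_on_def Ck_on_const)

lemma smooth_on_linear: "open V \<Longrightarrow> bounded_linear f \<Longrightarrow> smooth_on f V"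
  by (simp add: smooth_on_def Ck_on_linear)

lemma smooth_on_linear_compose:
  "open V \<Longrightarrow> bounded_linear l \<Longrightarrow> smooth_on f V \<Longrightarrow> smooth_on (\<lambda>x. l (f x)) V"
  by (simp add: smooth_on_def Ck_on_linear_compose)

lemma smooth_on_add:
  "open V \<Longrightarrow> smooth_on f V \<Longrightarrow> smooth_on g V \<Longrightarrow> smooth_on (\<lambda>x. f x + g x) V"
  by (simp add: smooth_on_def Ck_on_add)

lemma smooth_on_diff:
  "open V \<Longrightarrow> smooth_on f V \<Longrightarrow> smooth_on g V \<Longrightarrow> smooth_on (\<lambda>x. f x - g x) V"
  using smooth_on_add[of V f "\<lambda>x. - g x"]
    smooth_on_linear_compose[OF _ bounded_linear_minus[OF bounded_linear_ident], of V g]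
  by simp

lemma smooth_on_scaleR:
  "open V \<Longrightarrow> smooth_on f V \<Longrightarrow> smooth_on g V \<Longrightarrow> smooth_on (\<lambda>x. f x *\<^sub>R g x) V"
  by (simp add: smooth_on_def Ck_on_scaleR)

lemma smooth_on_mult:
  fixes f g :: "'a::euclidean_space \<Rightarrow> real"
  shows "open V \<Longrightarrow> smooth_on f V \<Longrightarrow> smooth_on g V \<Longrightarrow> smooth_on (\<lambda>x. f x * g x) V"
  by (simp add: smooth_on_def Ck_on_mult)

lemma smooth_on_compose:
  "open V \<Longrightarrow> open U \<Longrightarrow> f ` V \<subseteq> U \<Longrightarrow> smooth_on f V \<Longrightarrow> smooth_on g U \<Longrightarrow> smooth_on (\<lambda>x. g (f x)) V"
  unfolding smooth_on_def using Ck_on_compose by blast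

lemma smooth_on_continuous: "smooth_on f V \<Longrightarrow> continuous_on V f"
  unfolding smooth_on_def using Ck_on_continuous by blast

lemma smooth_on_has_derivative:
  "smooth_on f V \<Longrightarrow> x \<in> V \<Longrightarrow> (f has_derivative frechet_derivative f (at x)) (at x)"
  unfolding smooth_on_def using Ck_on_SucD by blast

lemma smooth_on_derivative: "smooth_on f V \<Longrightarrow> smooth_on (\<lambda>x. frechet_derivative f (at x) v) V"
  unfolding smooth_on_def by (metis Ck_on.simps(2))


section \<open>Bump functions\<close>

text \<open>The functions \<open>x\<^sup>-\<^sup>k e\<^sup>-\<^sup>1\<^sup>/\<^sup>x\<close>, extended by \<open>0\<close>. The derivative of each is a linear combination of two others,
  so that one induction shows that all of them are smooth.\<close>

definition flat_exp :: "nat \<Rightarrow> real \<Rightarrow> real" where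
  "flat_exp k x = (if x > 0 then (1 / x) ^ k * exp (- (1 / x)) else 0)"

lemma flat_exp_tendsto_0: "(flat_exp k \<longlongrightarrow> 0) (at 0)"
proof -
  have "((\<lambda>t::real. t ^ k / exp t) \<longlongrightarrow> 0) at_top" by (rule tendsto_power_div_exp_0)
  then have "((\<lambda>x::real. (1 / x) ^ k / exp (1 / x)) \<longlongrightarrow> 0) (at_right 0)"
    using filterlim_compose filterlim_inverse_at_top_right by (fastforce simp: inverse_eq_divide)
  then have "(flat_exp k \<longlongrightarrow> 0) (at_right 0)"
    by (rule Lim_transform_eventually)
       (auto simp: flat_exp_def exp_minus divide_inverse eventually_at_right_less intro!: eventually_at_rightI[of 0 1])
  moreover have "(flat_exp k \<longlongrightarrow> 0) (at_left 0)"
    by (rule tendsto_eventually) (auto simp: flat_exp_def intro!: eventually_at_leftI[of "-1" 0])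
  ultimately show ?thesis by (simp add: filterlim_split_at)
qed

lemma flat_exp_derivative:
  "(flat_exp k has_real_derivative flat_exp (k + 2) x - k * flat_exp (k + 1) x) (at x)"
proof (cases x "0::real" rule: linorder_cases)
  case less
  have "((\<lambda>x. 0) has_real_derivative 0) (at x)" by simp
  then have "(flat_exp k has_real_derivative 0) (at x)"
    by (rule has_field_derivative_transform_within_open[of _ _ _ "{..<0}"]) (use less in \<open>auto simp: flat_exp_def\<close>)
  then show ?thesis using less by (simp add: flat_exp_def)
next
  case equal
  have "((\<lambda>h. flat_exp (k + 1) h) \<longlongrightarrow> 0) (at 0)" by (rule flat_exp_tendsto_0)
  then have "((\<lambda>h. (flat_exp k (0 + h) - flat_exp k 0) / h) \<longlongrightarrow> 0) (at 0)"
    by (rule Lim_transform_eventually) (auto simp: flat_exp_def eventually_at_filter)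
  then show ?thesis unfolding equal by (simp add: DERIV_def flat_exp_def)
next
  case greater
  have inv: "((\<lambda>x::real. 1 / x) has_real_derivative - ((1 / x)\<^sup>2)) (at x)"
    using DERIV_inverse[of x UNIV] greater by (simp add: inverse_eq_divide power_one_over numeral_2_eq_2)
  have "((\<lambda>x. (1 / x) ^ k) has_real_derivative - (k * (1 / x) ^ (k + 1))) (at x)"
  proof (cases k)
    case (Suc m)
    show ?thesis using DERIV_power[OF inv, of k] unfolding Suc by (simp add: power2_eq_square mult_ac)
  qed simp
  moreover have "((\<lambda>x. exp (- (1 / x))) has_real_derivative (1 / x)\<^sup>2 * exp (- (1 / x))) (at x)"
    using DERIV_chain2[OF DERIV_exp DERIV_minus[OF inv]] by (simp add: mult.commute)
  ultimately have *: "((\<lambda>x. (1 / x) ^ k * exp (- (1 / x))) has_real_derivative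
      - (k * (1 / x) ^ (k + 1)) * exp (- (1 / x)) + (1 / x)\<^sup>2 * exp (- (1 / x)) * (1 / x) ^ k) (at x)"
    by (rule DERIV_mult)
  have "((\<lambda>x. (1 / x) ^ k * exp (- (1 / x))) has_real_derivative
      flat_exp (k + 2) x - k * flat_exp (k + 1) x) (at x)"
    using * greater
    by (simp add: flat_exp_def power_add power2_eq_square algebra_simps del: power_one_over)
  then show ?thesis
    by (rule has_field_derivative_transform_within_open[of _ _ _ "{0<..}"]) (use greater in \<open>auto simp: flat_exp_def\<close>)
qed

lemma smooth_on_flat_exp: "smooth_on (flat_exp k) UNIV"
proof -
  have "Ck_on n (flat_exp k) UNIV" for n
  proof (induction n arbitrary: k)
    case 0
    show ?case using flat_exp_derivative[THEN DERIV_isCont] by (simp add: continuous_on_eq_continuous_at)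
  next
    case (Suc n)
    show ?case
    proof (rule Ck_on_SucI[where D = "\<lambda>x v. v *\<^sub>R (flat_exp (k + 2) x + (- real k) *\<^sub>R flat_exp (k + 1) x)"])
      show "(flat_exp k has_derivative (\<lambda>v. v *\<^sub>R (flat_exp (k + 2) x + (- real k) *\<^sub>R flat_exp (k + 1) x))) (at x)" for x
        using flat_exp_derivative[of k x] by (simp add: has_field_derivative_def mult.commute[of _ "flat_exp _ _ - _"])
      show "Ck_on n (\<lambda>x. v *\<^sub>R (flat_exp (k + 2) x + (- real k) *\<^sub>R flat_exp (k + 1) x)) UNIV" for v
        by (intro Ck_on_scaleR Ck_on_add Ck_on_const Suc.IH) auto
    qed simp
  qed
  then show ?thesis by (simp add: smooth_on_def)
qed

lemma smooth_on_inverse: "smooth_on (inverse :: real \<Rightarrow> real) (- {0})"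
proof -
  have "Ck_on n (inverse :: real \<Rightarrow> real) (- {0})" for n
  proof (induction n)
    case 0
    show ?case by (auto intro!: continuous_intros)
  next
    case (Suc n)
    show ?case
    proof (rule Ck_on_SucI[where D = "\<lambda>x v. (- v) * (inverse x * inverse x)"])
      show "((inverse :: real \<Rightarrow> real) has_derivative (\<lambda>v. (- v) * (inverse x * inverse x))) (at x)"
        if "x \<in> - {0}" for x
        using that by (intro has_derivative_eq_rhs[OF has_derivative_inverse']) (auto simp: fun_eq_iff)
      show "Ck_on n (\<lambda>x::real. (- v) * (inverse x * inverse x)) (- {0})" for v
        by (rule Ck_on_mult[OF _ Ck_on_const Ck_on_mult[OF _ Suc.IH Suc.IH]]) auto
    qed auto
  qed
  then show ?thesis by (simp add: smooth_on_def)
qed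

text \<open>With \<open>e = flat_exp 0\<close> the bump function is \<open>e(b\<^sup>2 - |x|\<^sup>2) / (e(b\<^sup>2 - |x|\<^sup>2) + e(|x|\<^sup>2 - a\<^sup>2))\<close>; as \<open>a < b\<close>, the two
  summands of the denominator never vanish together.\<close>

lemma smooth_bump:
  assumes "0 < a" "a < b"
  obtains \<beta> :: "'e::euclidean_space \<Rightarrow> real"
  where "smooth_on \<beta> UNIV"
    "\<And>x. norm x \<le> a \<Longrightarrow> \<beta> x = 1" "\<And>x. b \<le> norm x \<Longrightarrow> \<beta> x = (0::real)"
proof -
  define p q :: "'e \<Rightarrow> real" where "p = (\<lambda>x. flat_exp 0 (b\<^sup>2 - x \<bullet> x))" and "q = (\<lambda>x. flat_exp 0 (x \<bullet> x - a\<^sup>2))"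
  have inner: "smooth_on (\<lambda>x::'e. x \<bullet> x) UNIV"
    unfolding smooth_on_def
    by (intro allI Ck_on_bilinear[OF open_UNIV bounded_bilinear_inner
          Ck_on_linear[OF open_UNIV bounded_linear_ident] Ck_on_linear[OF open_UNIV bounded_linear_ident]])
  have p: "smooth_on p UNIV" unfolding p_def
    using smooth_on_compose[OF open_UNIV open_UNIV _ smooth_on_diff[OF open_UNIV smooth_on_const[OF open_UNIV] inner]
        smooth_on_flat_exp] by simp
  have q: "smooth_on q UNIV" unfolding q_def
    using smooth_on_compose[OF open_UNIV open_UNIV _ smooth_on_diff[OF open_UNIV inner smooth_on_const[OF open_UNIV]]
        smooth_on_flat_exp] by simp
  have ab: "a\<^sup>2 < b\<^sup>2" using assms by (simp add: power_strict_mono)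
  have pos: "p x + q x \<noteq> 0" for x
  proof -
    have "p x \<ge> 0" "q x \<ge> 0" by (simp_all add: p_def q_def flat_exp_def)
    moreover have "p x > 0 \<or> q x > 0" using ab by (auto simp: p_def q_def flat_exp_def)
    ultimately show ?thesis by linarith
  qed
  define \<beta> where "\<beta> = (\<lambda>x. p x * inverse (p x + q x))"
  show ?thesis
  proof
    show "smooth_on \<beta> UNIV" unfolding \<beta>_def
      by (rule smooth_on_mult[OF open_UNIV p smooth_on_compose[OF open_UNIV _ _ smooth_on_add[OF open_UNIV p q] smooth_on_inverse]])
        (use pos in auto)
    show "\<beta> x = 1" if "norm x \<le> a" for x
    proof -
      have "x \<bullet> x \<le> a\<^sup>2" using that by (simp add: power2_norm_eq_inner[symmetric] power_mono)
      then have "q x = 0" by (simp add: q_def flat_exp_def)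
      then show ?thesis using pos[of x] by (simp add: \<beta>_def)
    qed
    show "\<beta> x = 0" if "b \<le> norm x" for x
    proof -
      have "b\<^sup>2 \<le> x \<bullet> x" using that assms by (simp add: power2_norm_eq_inner[symmetric] power_mono)
      then show ?thesis by (simp add: \<beta>_def p_def flat_exp_def)
    qed
  qed
qed

section \<open>Perturbations of the identity\<close>

lemma lipschitz_derivative_bound:
  assumes h: "(h has_derivative h') (at x)"
    and lip: "\<And>y. norm (h y - h x) \<le> L * norm (y - x)"
  shows "norm (h' v) \<le> L * norm v"
proof (rule field_le_epsilon)
  fix e :: real assume e: "e > 0"
  show "norm (h' v) \<le> L * norm v + e"
  proof (cases "v = 0")
    case True
    then show ?thesis using e linear_0[OF has_derivative_linear[OF h]] by simp
  next
    case False
    (* The difference quotient along v, at a parameter t so small that the error is at most e. *)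
    define e' where "e' = e / norm v"
    have e': "e' > 0" using e False by (simp add: e'_def)
    obtain d where d: "d > 0" "\<And>y. norm (y - x) < d \<Longrightarrow> norm (h y - h x - h' (y - x)) \<le> e' * norm (y - x)"
      using h e' unfolding has_derivative_at_alt by blast
    define t where "t = d / (2 * norm v)"
    have t: "t > 0" "norm (t *\<^sub>R v) < d" using d(1) False by (auto simp: t_def)
    have "norm (h' (t *\<^sub>R v)) \<le> norm (h (x + t *\<^sub>R v) - h x) + norm (h (x + t *\<^sub>R v) - h x - h' (t *\<^sub>R v))"
      by (metis norm_triangle_sub norm_minus_commute add.commute)
    also have "\<dots> \<le> L * norm (t *\<^sub>R v) + e' * norm (t *\<^sub>R v)"
      using lip[of "x + t *\<^sub>R v"] d(2)[of "x + t *\<^sub>R v"] t(2) by simp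
    finally have "t * norm (h' v) \<le> t * (L * norm v + e)"
      using t(1) False linear_scale[OF has_derivative_linear[OF h]] by (simp add: e'_def algebra_simps)
    then show ?thesis using t(1) by simp
  qed
qed

text \<open>A product rule for the evaluation of linear maps that are merely continuous in the parameter,
  at a point where the other factor vanishes.\<close>

lemma has_derivative_apply_vanishing:
  fixes p :: "'a::euclidean_space \<Rightarrow> 'b::euclidean_space" and B :: "'a \<Rightarrow> 'b \<Rightarrow> 'c::euclidean_space"
  assumes lin: "\<And>z. linear (B z)" and bound: "\<And>z u. norm (B z u) \<le> C * norm u"
    and cont: "\<And>u. isCont (\<lambda>z. B z u) y"
    and p: "(p has_derivative p') (at y)" "p y = 0"
  shows "((\<lambda>z. B z (p z)) has_derivative (\<lambda>u. B y (p' u))) (at y)"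
proof -
  have bl: "bounded_linear p'" using p(1) by (rule has_derivative_bounded_linear)
  then obtain K where K: "\<And>u. norm (p' u) \<le> norm u * K" using bounded_linear.bounded by blast
  define r where "r = (\<lambda>z. C * (norm (p z - p y - p' (z - y)) / norm (z - y)) + K * (\<Sum>i\<in>Basis. norm (B z i - B y i)))"
  have "((\<lambda>z. norm (p z - p y - p' (z - y)) / norm (z - y)) \<longlongrightarrow> 0) (at y)"
    using p(1) by (simp add: has_derivative_iff_norm)
  moreover have "((\<lambda>z. norm (B z i - B y i)) \<longlongrightarrow> 0) (at y)" for i
    using cont[of i] by (intro tendsto_norm_zero) (simp add: isCont_def LIM_zero)
  ultimately have "(r \<longlongrightarrow> C * 0 + K * (\<Sum>i\<in>(Basis::'b set). 0)) (at y)" unfolding r_def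
    by (intro tendsto_intros)
  then have r: "(r \<longlongrightarrow> 0) (at y)" by simp
  have le: "norm (B z (p z) - B y (p y) - B y (p' (z - y))) / norm (z - y) \<le> r z" if "z \<noteq> y" for z
  proof -
    have nz: "norm (z - y) > 0" using that by simp
    have eq: "B z (p z) - B y (p y) - B y (p' (z - y))
        = B z (p z - p y - p' (z - y)) + (B z (p' (z - y)) - B y (p' (z - y)))"
      using p(2) linear_0[OF lin] by (simp add: linear_diff[OF lin])
    have "B z (p' (z - y)) - B y (p' (z - y)) = (\<Sum>i\<in>Basis. (p' (z - y) \<bullet> i) *\<^sub>R (B z i - B y i))"
      using linear_expansion[OF lin, of z "p' (z - y)"] linear_expansion[OF lin, of y "p' (z - y)"]
      by (simp add: scaleR_diff_right sum_subtractf)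
    also have "norm \<dots> \<le> (\<Sum>i\<in>Basis. (norm (z - y) * K) * norm (B z i - B y i))"
    proof (rule sum_norm_le)
      fix i :: 'b assume "i \<in> Basis"
      then have "\<bar>p' (z - y) \<bullet> i\<bar> \<le> norm (z - y) * K"
        using Basis_le_norm K order_trans by blast
      then show "norm ((p' (z - y) \<bullet> i) *\<^sub>R (B z i - B y i)) \<le> (norm (z - y) * K) * norm (B z i - B y i)"
        by (simp add: mult_right_mono)
    qed
    finally have "norm (B z (p z) - B y (p y) - B y (p' (z - y)))
        \<le> C * norm (p z - p y - p' (z - y)) + (norm (z - y) * K) * (\<Sum>i\<in>Basis. norm (B z i - B y i))"
      unfolding eq sum_distrib_left by (intro norm_triangle_mono bound)
    then have "norm (B z (p z) - B y (p y) - B y (p' (z - y))) / norm (z - y)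
        \<le> (C * norm (p z - p y - p' (z - y)) + (norm (z - y) * K) * (\<Sum>i\<in>Basis. norm (B z i - B y i))) / norm (z - y)"
      using nz divide_right_mono by fastforce
    also have "\<dots> = r z" using that unfolding r_def by (simp add: add_divide_distrib)
    finally show ?thesis .
  qed
  have "((\<lambda>z. norm (B z (p z) - B y (p y) - B y (p' (z - y))) / norm (z - y)) \<longlongrightarrow> 0) (at y)"
    by (rule Lim_null_comparison[OF _ r]) (use le in \<open>auto simp: eventually_at_filter\<close>)
  moreover have "bounded_linear (\<lambda>u. B y (p' u))"
    using bl lin linear_conv_bounded_linear bounded_linear_compose by blast
  ultimately show ?thesis by (simp add: has_derivative_iff_norm)
qed

text \<open>The derivative \<open>B\<close> of the inverse satisfies
  \<open>B(y') v - B(y) v = - B(y') (A(y') - A(y)) B(y) v\<close>, where \<open>A\<close> is the derivative of \<open>f\<close> along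
  the inverse. So \<open>B\<close> is differentiable, and its derivative is a polynomial in \<open>B\<close> and the second
  derivatives of \<open>f\<close>; each order of differentiability of \<open>B\<close> gives the next one.\<close>

lemma smooth_on_global_inverse:
  fixes f g :: "'e::euclidean_space \<Rightarrow> 'e"
  assumes f: "smooth_on f UNIV" and gf: "\<And>x. g (f x) = x" and fg: "\<And>y. f (g y) = y"
    and g: "continuous_on UNIV g" and "c > 0"
    and low: "\<And>x v. c * norm v \<le> norm (frechet_derivative f (at x) v)"
  shows "smooth_on g UNIV"
proof -
  define A where "A = (\<lambda>x. frechet_derivative f (at x))"
  have fA: "(f has_derivative A x) (at x)" for x
    unfolding A_def using f by (rule smooth_on_has_derivative) simp
  have linA: "linear (A x)" for x using fA by (rule has_derivative_linear)
  have "inj (A x)" for x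
    using low[of _ x] \<open>c > 0\<close> unfolding linear_injective_0[OF linA]
    by (metis A_def mult_le_0_iff norm_le_zero_iff norm_zero not_less)
  then have "\<exists>B. linear B \<and> (\<forall>v. B (A (g y) v) = v) \<and> (\<forall>v. A (g y) (B v) = v)" for y
    using linear_injective_isomorphism[OF linA] by blast
  then obtain B where linB: "\<And>y. linear (B y)" and BA: "\<And>y v. B y (A (g y) v) = v"
    and AB: "\<And>y v. A (g y) (B y v) = v" by metis
  have gcont: "isCont g y" for y using g by (simp add: continuous_on_eq_continuous_at)
  have gB: "(g has_derivative B y) (at y)" for y
    by (rule has_derivative_inverse_basic[where f = f and f' = "A (g y)" and T = UNIV])
       (use fA linB linear_conv_bounded_linear BA gcont fg in auto)
  have normB: "norm (B y u) \<le> (1 / c) * norm u" for y u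
    using low[of "B y u" "g y"] AB[of y u] \<open>c > 0\<close> by (simp add: A_def field_simps)
  have smoothA: "smooth_on (\<lambda>x. A x w) UNIV" for w
    unfolding A_def using f by (rule smooth_on_derivative)
  have contAg: "isCont (\<lambda>z. A (g z) w) y" for w y
    by (rule isCont_o2[OF gcont])
      (use smooth_on_continuous[OF smoothA] in \<open>simp add: continuous_on_eq_continuous_at\<close>)
  have contB: "isCont (\<lambda>z. B z u) y" for y u
  proof -
    define w where "w = B y u"
    have eq: "B z u - B y u = - B z (A (g z) w - A (g y) w)" for z
      using BA AB by (simp add: linear_diff[OF linB] w_def)
    have "((\<lambda>z. (1 / c) * norm (A (g z) w - A (g y) w)) \<longlongrightarrow> (1 / c) * 0) (at y)"
      using contAg[of y w] by (intro tendsto_intros tendsto_norm_zero) (simp add: isCont_def LIM_zero)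
    then have lim: "((\<lambda>z. (1 / c) * norm (A (g z) w - A (g y) w)) \<longlongrightarrow> 0) (at y)" by simp
    have "((\<lambda>z. B z u - B y u) \<longlongrightarrow> 0) (at y)"
      by (rule Lim_null_comparison[OF _ lim]) (simp add: eq normB del: times_divide_eq_left)
    then show ?thesis by (simp add: isCont_def LIM_zero_iff)
  qed
  define F where "F = (\<lambda>i j x. frechet_derivative (\<lambda>x. A x j) (at x) i)"
  have smoothF: "smooth_on (F i j) UNIV" for i j
    unfolding F_def using smoothA by (rule smooth_on_derivative)
  define D where "D = (\<lambda>y v u. - (\<Sum>j\<in>Basis. \<Sum>i\<in>Basis. \<Sum>l\<in>Basis.
      ((B y v \<bullet> j) * ((B y u \<bullet> i) * (F i j (g y) \<bullet> l))) *\<^sub>R B y l))"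
  have BD: "((\<lambda>z. B z v) has_derivative D y v) (at y)" for y v
  proof -
    define w where "w = B y v"
    define q where "q = (\<lambda>z. A (g z) w - v)"
    define q' where "q' = (\<lambda>u. \<Sum>j\<in>Basis. (w \<bullet> j) *\<^sub>R (\<Sum>i\<in>Basis. (B y u \<bullet> i) *\<^sub>R F i j (g y)))"
    have "((\<lambda>x. A x j) has_derivative (\<lambda>h. \<Sum>i\<in>Basis. (h \<bullet> i) *\<^sub>R F i j x)) (at x)" for j x
    proof -
      have "((\<lambda>x. A x j) has_derivative frechet_derivative (\<lambda>x. A x j) (at x)) (at x)"
        using smoothA by (rule smooth_on_has_derivative) simp
      moreover from this have "frechet_derivative (\<lambda>x. A x j) (at x) = (\<lambda>h. \<Sum>i\<in>Basis. (h \<bullet> i) *\<^sub>R F i j x)"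
        unfolding F_def by (intro ext linear_expansion has_derivative_linear)
      ultimately show ?thesis by simp
    qed
    from has_derivative_compose[OF gB this]
    have "((\<lambda>z. A (g z) j) has_derivative (\<lambda>u. \<Sum>i\<in>Basis. (B y u \<bullet> i) *\<^sub>R F i j (g y))) (at y)" for j .
    then have "((\<lambda>z. (\<Sum>j\<in>Basis. (w \<bullet> j) *\<^sub>R A (g z) j) - v) has_derivative q') (at y)"
      unfolding q'_def by (auto intro!: derivative_eq_intros)
    then have q: "(q has_derivative q') (at y)"
      unfolding q_def linear_expansion[OF linA, of _ w, symmetric] .
    have "q y = 0" using AB by (simp add: q_def w_def)
    from has_derivative_apply_vanishing[OF linB normB contB q this]
    have "((\<lambda>z. w - B z (q z)) has_derivative (\<lambda>u. - B y (q' u))) (at y)"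
      by (auto intro!: derivative_eq_intros)
    moreover have "(\<lambda>z. w - B z (q z)) = (\<lambda>z. B z v)"
      using BA by (simp add: q_def linear_diff[OF linB])
    moreover have "(\<lambda>u. - B y (q' u)) = D y v"
    proof
      fix u
      have "B y (F i j (g y)) = (\<Sum>l\<in>Basis. (F i j (g y) \<bullet> l) *\<^sub>R B y l)" for i j
        using linB by (rule linear_expansion)
      then show "- B y (q' u) = D y v u"
        by (simp add: q'_def D_def w_def linear_sum[OF linB] linear_scale[OF linB] scaleR_sum_right mult.assoc)
    qed
    ultimately show ?thesis by simp
  qed
  have CB: "(\<forall>v. Ck_on k (\<lambda>y. B y v) UNIV) \<and> Ck_on k g UNIV" for k
  proof (induction k)
    case 0
    then show ?case using contB g by (simp add: continuous_on_eq_continuous_at)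
  next
    case (Suc k)
    have gk: "Ck_on (Suc k) g UNIV"
      by (rule Ck_on_SucI[where D = B]) (use gB Suc in auto)
    have Fg: "Ck_on k (\<lambda>y. F i j (g y)) UNIV" for i j
      by (rule Ck_on_compose[where U = UNIV]) (use smoothF Suc in \<open>auto simp: smooth_on_def\<close>)
    have Bk: "Ck_on k (\<lambda>y. B y v) UNIV" for v using Suc by blast
    note inner = Ck_on_linear_compose[OF open_UNIV bounded_linear_inner_left]
    have summand: "Ck_on k (\<lambda>y. ((B y v \<bullet> j) * ((B y u \<bullet> i) * (F i j (g y) \<bullet> l))) *\<^sub>R B y l) UNIV" for v u i j l
      by (rule Ck_on_scaleR[OF open_UNIV Ck_on_mult[OF open_UNIV inner[OF Bk]
            Ck_on_mult[OF open_UNIV inner[OF Bk] inner[OF Fg]]] Bk])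
    have "Ck_on k (\<lambda>y. D y v u) UNIV" for v u
      unfolding D_def
      by (rule Ck_on_linear_compose[OF open_UNIV bounded_linear_minus[OF bounded_linear_ident]])
        (intro Ck_on_sum open_UNIV summand)
    then have "Ck_on (Suc k) (\<lambda>y. B y v) UNIV" for v
      by (rule Ck_on_SucI[where D = "\<lambda>y. D y v", OF open_UNIV BD])
    with gk show ?case by blast
  qed
  then show ?thesis by (simp add: smooth_on_def)
qed

text \<open>The equation \<open>x + h x = y\<close> is solved by the fixed point of the contraction \<open>x \<mapsto> y - h x\<close>. The inverse
  is smooth because the Lipschitz bound keeps the derivative of \<open>id + h\<close> away from \<open>0\<close>.\<close>

lemma perturbed_identity_diffeo:
  fixes h :: "'e::euclidean_space \<Rightarrow> 'e"
  assumes h: "smooth_on h UNIV" and lip: "\<And>x y. norm (h x - h y) \<le> (1 / 2) * norm (x - y)"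
  obtains g where "smooth_on g UNIV" "\<And>x. g (x + h x) = x" "\<And>y. g y + h (g y) = y"
proof -
  have ex: "\<exists>!x. x + h x = y" for y
  proof -
    have "norm (h z - h x) \<le> (1 / 2) * norm (x - z)" for x z
      using lip[of x z] by (simp add: norm_minus_commute)
    then have "\<exists>!x\<in>UNIV. (\<lambda>x. y - h x) x = x"
      by (intro Banach_fix[where c = "1 / 2"]) (auto simp: dist_norm complete_UNIV)
    moreover have "y - h x = x \<longleftrightarrow> x + h x = y" for x by (auto simp: algebra_simps)
    ultimately show ?thesis by simp
  qed
  define g where "g = (\<lambda>y. THE x. x + h x = y)"
  have fg: "g y + h (g y) = y" for y unfolding g_def using theI'[OF ex[of y]] .
  have gf: "g (x + h x) = x" for x using ex[of "x + h x"] fg[of "x + h x"] by blast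
  have "norm (g y - g z) \<le> 2 * norm (y - z)" for y z
  proof -
    have "g y - g z = (y - z) - (h (g y) - h (g z))" using fg[of y] fg[of z] by (simp add: algebra_simps)
    then have "norm (g y - g z) \<le> norm (y - z) + norm (h (g y) - h (g z))" by (metis norm_triangle_ineq4)
    then show ?thesis using lip[of "g y" "g z"] by simp
  qed
  then have "2-lipschitz_on UNIV g" by (auto intro!: lipschitz_onI simp: dist_norm)
  then have gc: "continuous_on UNIV g" by (rule lipschitz_on_continuous_on)
  have f: "smooth_on (\<lambda>x. x + h x) UNIV"
    by (intro smooth_on_add h smooth_on_linear bounded_linear_ident) auto
  have D: "((\<lambda>x. x + h x) has_derivative (\<lambda>v. v + frechet_derivative h (at x) v)) (at x)" for x
    using smooth_on_has_derivative[OF h] by (intro has_derivative_add has_derivative_ident) auto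
  have "smooth_on g UNIV"
  proof (rule smooth_on_global_inverse[OF f gf fg gc])
    fix x v
    have "norm (frechet_derivative h (at x) v) \<le> (1 / 2) * norm v"
      by (rule lipschitz_derivative_bound[OF smooth_on_has_derivative[OF h]]) (use lip in auto)
    moreover have "norm v \<le> norm (v + frechet_derivative h (at x) v) + norm (frechet_derivative h (at x) v)"
      by (metis add_diff_cancel_right' norm_triangle_ineq4)
    ultimately show "1 / 2 * norm v \<le> norm (frechet_derivative (\<lambda>x. x + h x) (at x) v)"
      unfolding frechet_derivative_at[OF D[of x], symmetric] by simp
  qed simp
  then show ?thesis using that gf fg by blast
qed

section \<open>Local uniform limits of the derivative\<close>

text \<open>\<open>C1_limit f x y D\<close>: near \<open>x\<close> the maps \<open>f n\<close> converge in \<open>C\<^sup>1\<close>, with limit value \<open>y\<close> and limit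
  derivative \<open>D\<close> at \<open>x\<close>. Letting the index and the point vary together in one product filter makes
  this a locally uniform statement that is stable under composition without any estimate.\<close>

definition C1_limit ::
  "(nat \<Rightarrow> 'b::euclidean_space \<Rightarrow> 'c::euclidean_space) \<Rightarrow> 'b \<Rightarrow> 'c \<Rightarrow> ('b \<Rightarrow>\<^sub>L 'c) \<Rightarrow> bool" where
  "C1_limit f x y D \<longleftrightarrow> (\<exists>D'.
     (\<forall>\<^sub>F p in sequentially \<times>\<^sub>F nhds x. (f (fst p) has_derivative blinfun_apply (D' p)) (at (snd p))) \<and>
     ((\<lambda>p. f (fst p) (snd p)) \<longlongrightarrow> y) (sequentially \<times>\<^sub>F nhds x) \<and>
     (D' \<longlongrightarrow> D) (sequentially \<times>\<^sub>F nhds x))"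

lemma isCont_tendsto_nhds: "isCont f x \<Longrightarrow> (f \<longlongrightarrow> f x) (nhds x)"
  by (simp add: isCont_def tendsto_at_iff_tendsto_nhds)

lemma eventually_prod_nhds_open:
  "eventually P (F \<times>\<^sub>F nhds x) \<longleftrightarrow>
     (\<exists>Q U. eventually Q F \<and> open U \<and> x \<in> U \<and> (\<forall>n z. Q n \<longrightarrow> z \<in> U \<longrightarrow> P (n, z)))"
proof
  assume "eventually P (F \<times>\<^sub>F nhds x)"
  then obtain Q R where QR: "eventually Q F" "eventually R (nhds x)" "\<And>n z. Q n \<Longrightarrow> R z \<Longrightarrow> P (n, z)"
    unfolding eventually_prod_filter by blast
  obtain U where "open U" "x \<in> U" "\<And>z. z \<in> U \<Longrightarrow> R z" using QR(2) unfolding eventually_nhds by blast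
  with QR show "\<exists>Q U. eventually Q F \<and> open U \<and> x \<in> U \<and> (\<forall>n z. Q n \<longrightarrow> z \<in> U \<longrightarrow> P (n, z))" by blast
next
  assume "\<exists>Q U. eventually Q F \<and> open U \<and> x \<in> U \<and> (\<forall>n z. Q n \<longrightarrow> z \<in> U \<longrightarrow> P (n, z))"
  then obtain Q U where "eventually Q F" "open U" "x \<in> U" "\<And>n z. Q n \<Longrightarrow> z \<in> U \<Longrightarrow> P (n, z)" by blast
  then show "eventually P (F \<times>\<^sub>F nhds x)"
    unfolding eventually_prod_filter
    by (intro exI[of _ Q] exI[of _ "\<lambda>z. z \<in> U"]) (auto simp: eventually_nhds_in_open)
qed

lemma eventually_prod_snd: "eventually P G \<Longrightarrow> \<forall>\<^sub>F p in F \<times>\<^sub>F G. P (snd p)"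
  using eventually_prodI[of "\<lambda>_. True" F P G] by simp

lemma eventually_prod_fst: "eventually P F \<Longrightarrow> \<forall>\<^sub>F p in F \<times>\<^sub>F G. P (fst p)"
  using eventually_prodI[of P F "\<lambda>_. True" G] by simp

lemma eventually_prod_slice_nhds:
  assumes "eventually P (F \<times>\<^sub>F nhds x)"
  shows "\<forall>\<^sub>F p in F \<times>\<^sub>F nhds x. \<forall>\<^sub>F z in nhds (snd p). P (fst p, z)"
proof -
  obtain Q U where "eventually Q F" "open U" "x \<in> U" and P: "\<And>n z. Q n \<Longrightarrow> z \<in> U \<Longrightarrow> P (n, z)"
    using assms unfolding eventually_prod_nhds_open by blast
  moreover have "\<forall>\<^sub>F w in nhds z. P (n, w)" if "Q n" "z \<in> U" for n z
    using eventually_nhds_in_open[OF \<open>open U\<close> that(2)] P[OF that(1)] by (rule eventually_mono)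
  ultimately show ?thesis unfolding eventually_prod_nhds_open
    by (intro exI[of _ Q] exI[of _ U]) auto
qed

text \<open>This is how convergence in the product filters at the points of a compact set becomes uniform: the
  finitely many neighbourhoods of a subcover have a common index.\<close>

lemma eventually_compact_uniform:
  assumes "compact K" "\<And>x. x \<in> K \<Longrightarrow> eventually P (F \<times>\<^sub>F nhds x)"
  shows "\<forall>\<^sub>F n in F. \<forall>x\<in>K. P (n, x)"
proof -
  have "\<forall>x\<in>K. \<exists>U. open U \<and> x \<in> U \<and> (\<forall>\<^sub>F n in F. \<forall>z\<in>U. P (n, z))"
  proof
    fix x assume "x \<in> K"
    from assms(2)[OF this] obtain Q U where Q: "eventually Q F" and U: "open U" "x \<in> U"
      and P: "\<And>n z. Q n \<Longrightarrow> z \<in> U \<Longrightarrow> P (n, z)"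
      unfolding eventually_prod_nhds_open by blast
    from Q have "\<forall>\<^sub>F n in F. \<forall>z\<in>U. P (n, z)" by (rule eventually_mono) (use P in blast)
    with U show "\<exists>U. open U \<and> x \<in> U \<and> (\<forall>\<^sub>F n in F. \<forall>z\<in>U. P (n, z))" by blast
  qed
  then obtain U where U: "\<And>x. x \<in> K \<Longrightarrow> open (U x)" "\<And>x. x \<in> K \<Longrightarrow> x \<in> U x"
    "\<And>x. x \<in> K \<Longrightarrow> \<forall>\<^sub>F n in F. \<forall>z\<in>U x. P (n, z)" by metis
  obtain C where C: "C \<subseteq> K" "finite C" "K \<subseteq> (\<Union>x\<in>C. U x)"
    using compactE_image[OF assms(1), of K U] U by blast
  have "\<forall>\<^sub>F n in F. \<forall>x\<in>C. \<forall>z\<in>U x. P (n, z)"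
    using C U(3) by (intro eventually_ball_finite) auto
  then show ?thesis by (rule eventually_mono) (use C(3) in blast)
qed

lemma C1_limit_tendsto:
  "C1_limit f x y D \<Longrightarrow> ((\<lambda>p. f (fst p) (snd p)) \<longlongrightarrow> y) (sequentially \<times>\<^sub>F nhds x)"
  by (auto simp: C1_limit_def)

lemma C1_limit_tendsto_Pair:
  assumes "C1_limit f x y D"
  shows "LIM p sequentially \<times>\<^sub>F nhds x. (fst p, f (fst p) (snd p)) :> sequentially \<times>\<^sub>F nhds y"
  by (intro filterlim_Pair filterlim_fst C1_limit_tendsto[OF assms])

lemma C1_limit_compose:
  assumes f: "C1_limit f x y D" and g: "C1_limit g y z E"
  shows "C1_limit (\<lambda>n w. g n (f n w)) x z (E o\<^sub>L D)"
proof -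
  let ?F = "sequentially \<times>\<^sub>F nhds x"
  obtain D' where D': "\<forall>\<^sub>F p in ?F. (f (fst p) has_derivative blinfun_apply (D' p)) (at (snd p))"
    and limD: "(D' \<longlongrightarrow> D) ?F" using f unfolding C1_limit_def by blast
  obtain E' where E': "\<forall>\<^sub>F p in sequentially \<times>\<^sub>F nhds y. (g (fst p) has_derivative blinfun_apply (E' p)) (at (snd p))"
    and limg: "((\<lambda>p. g (fst p) (snd p)) \<longlongrightarrow> z) (sequentially \<times>\<^sub>F nhds y)"
    and limE: "(E' \<longlongrightarrow> E) (sequentially \<times>\<^sub>F nhds y)" using g unfolding C1_limit_def by blast
  define r where "r = (\<lambda>p. (fst p, f (fst p) (snd p)))"
  have r: "filterlim r (sequentially \<times>\<^sub>F nhds y) ?F"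
    unfolding r_def by (rule C1_limit_tendsto_Pair[OF f])
  have "\<forall>\<^sub>F p in ?F. (g (fst p) has_derivative blinfun_apply (E' (r p))) (at (f (fst p) (snd p)))"
    using filterlim_iff[THEN iffD1, OF r, rule_format, OF E'] by (simp add: r_def)
  with D' have "\<forall>\<^sub>F p in ?F. ((\<lambda>w. g (fst p) (f (fst p) w)) has_derivative blinfun_apply (E' (r p) o\<^sub>L D' p)) (at (snd p))"
  proof eventually_elim
    case (elim p)
    then show ?case using diff_chain_at[OF elim] by (simp add: o_def blinfun_compose.rep_eq)
  qed
  moreover have "((\<lambda>p. g (fst p) (f (fst p) (snd p))) \<longlongrightarrow> z) ?F"
    using filterlim_compose[OF limg r] by (simp add: r_def)
  moreover have "((\<lambda>p. E' (r p) o\<^sub>L D' p) \<longlongrightarrow> E o\<^sub>L D) ?F"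
    by (intro bounded_bilinear.tendsto[OF bounded_bilinear_blinfun_compose] filterlim_compose[OF limE r] limD)
  ultimately show ?thesis unfolding C1_limit_def
    by (intro exI[of _ "\<lambda>p. E' (r p) o\<^sub>L D' p"] conjI)
qed

lemma C1_limit_cong:
  assumes "C1_limit f x y D" "\<forall>\<^sub>F p in sequentially \<times>\<^sub>F nhds x. f (fst p) (snd p) = g (fst p) (snd p)"
  shows "C1_limit g x y D"
proof -
  let ?F = "sequentially \<times>\<^sub>F nhds x"
  obtain D' where D': "\<forall>\<^sub>F p in ?F. (f (fst p) has_derivative blinfun_apply (D' p)) (at (snd p))"
    and lim: "((\<lambda>p. f (fst p) (snd p)) \<longlongrightarrow> y) ?F" "(D' \<longlongrightarrow> D) ?F"
    using assms(1) unfolding C1_limit_def by blast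
  have "\<forall>\<^sub>F p in ?F. \<forall>\<^sub>F z in nhds (snd p). f (fst p) z = g (fst p) z"
    using eventually_prod_slice_nhds[OF assms(2)] by simp
  with D' have "\<forall>\<^sub>F p in ?F. (g (fst p) has_derivative blinfun_apply (D' p)) (at (snd p))"
  proof eventually_elim
    case (elim p)
    then obtain U where "open U" "snd p \<in> U" "\<And>z. z \<in> U \<Longrightarrow> f (fst p) z = g (fst p) z"
      unfolding eventually_nhds by blast
    with elim(1) show ?case by (metis has_derivative_transform_within_open)
  qed
  moreover have "((\<lambda>p. g (fst p) (snd p)) \<longlongrightarrow> y) ?F"
    using lim(1) assms(2) by (rule Lim_transform_eventually)
  ultimately show ?thesis using lim(2) unfolding C1_limit_def
    by (intro exI[of _ D'] conjI)
qed

lemma C1_limit_smooth: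
  assumes f: "smooth_on f V" "open V" "x \<in> V" and D: "(f has_derivative blinfun_apply D) (at x)"
  shows "C1_limit (\<lambda>n. f) x (f x) D"
proof -
  define D' where "D' = (\<lambda>z. Blinfun (frechet_derivative f (at z)))"
  have app: "blinfun_apply (D' z) = frechet_derivative f (at z)" if "z \<in> V" for z
    unfolding D'_def using smooth_on_has_derivative[OF f(1) that]
    by (intro bounded_linear_Blinfun_apply has_derivative_bounded_linear)
  have V: "\<forall>\<^sub>F z in nhds x. z \<in> V" using f eventually_nhds_in_open by blast
  have "(D' \<longlongrightarrow> D) (nhds x)"
  proof (rule tendsto_componentwise1)
    fix j :: 'a assume "j \<in> Basis"
    have "isCont (\<lambda>z. frechet_derivative f (at z) j) x"
      using smooth_on_continuous[OF smooth_on_derivative[OF f(1)]] f by (simp add: continuous_on_eq_continuous_at)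
    then have "((\<lambda>z. frechet_derivative f (at z) j) \<longlongrightarrow> frechet_derivative f (at x) j) (nhds x)"
      by (rule isCont_tendsto_nhds)
    moreover have "frechet_derivative f (at x) = blinfun_apply D"
      using frechet_derivative_at[OF D] by simp
    ultimately have "((\<lambda>z. frechet_derivative f (at z) j) \<longlongrightarrow> blinfun_apply D j) (nhds x)" by simp
    then show "((\<lambda>z. blinfun_apply (D' z) j) \<longlongrightarrow> blinfun_apply D j) (nhds x)"
      by (rule Lim_transform_eventually) (use V in eventually_elim, use app in simp)
  qed
  moreover have "(f \<longlongrightarrow> f x) (nhds x)"
    by (rule isCont_tendsto_nhds)
      (use smooth_on_continuous[OF f(1)] f(2,3) in \<open>simp add: continuous_on_eq_continuous_at\<close>)
  moreover have "\<forall>\<^sub>F z in nhds x. (f has_derivative blinfun_apply (D' z)) (at z)"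
    using V by eventually_elim (use smooth_on_has_derivative[OF f(1)] app in simp)
  ultimately show ?thesis
    unfolding C1_limit_def
    by (intro exI[of _ "\<lambda>p. D' (snd p)"] conjI)
      (auto intro: eventually_prod_snd filterlim_compose[OF _ filterlim_snd])
qed

lemma C1_limit_id: "C1_limit (\<lambda>n w. w) x x id_blinfun"
proof -
  have "smooth_on (\<lambda>w::'b::euclidean_space. w) UNIV" by (simp add: smooth_on_linear bounded_linear_ident)
  from C1_limit_smooth[OF this open_UNIV, of x id_blinfun] show ?thesis
    by (simp add: has_derivative_ident id_blinfun.rep_eq eta_contract_eq)
qed

lemma C1_limit_Pair:
  fixes f :: "nat \<Rightarrow> 'b::euclidean_space \<Rightarrow> 'c::euclidean_space" and g :: "nat \<Rightarrow> 'b \<Rightarrow> 'd::euclidean_space"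
  assumes f: "C1_limit f x y D" and g: "C1_limit g x z E"
  shows "C1_limit (\<lambda>n w. (f n w, g n w)) x (y, z)
    ((Blinfun (\<lambda>v. (v, 0)) o\<^sub>L D) + (Blinfun (\<lambda>v. (0, v)) o\<^sub>L E))"
proof -
  let ?F = "sequentially \<times>\<^sub>F nhds x"
  obtain D' where D': "\<forall>\<^sub>F p in ?F. (f (fst p) has_derivative blinfun_apply (D' p)) (at (snd p))"
    and limf: "((\<lambda>p. f (fst p) (snd p)) \<longlongrightarrow> y) ?F" "(D' \<longlongrightarrow> D) ?F" using f unfolding C1_limit_def by blast
  obtain E' where E': "\<forall>\<^sub>F p in ?F. (g (fst p) has_derivative blinfun_apply (E' p)) (at (snd p))"
    and limg: "((\<lambda>p. g (fst p) (snd p)) \<longlongrightarrow> z) ?F" "(E' \<longlongrightarrow> E) ?F" using g unfolding C1_limit_def by blast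
  let ?l = "Blinfun (\<lambda>v. (v, 0)) :: 'c \<Rightarrow>\<^sub>L ('c \<times> 'd)" and ?r = "Blinfun (\<lambda>v. (0, v)) :: 'd \<Rightarrow>\<^sub>L ('c \<times> 'd)"
  have l: "blinfun_apply ?l = (\<lambda>v. (v, 0))" and r: "blinfun_apply ?r = (\<lambda>v. (0, v))"
    by (intro bounded_linear_Blinfun_apply bounded_linear_Pair bounded_linear_ident bounded_linear_zero)+
  have "\<forall>\<^sub>F p in ?F. ((\<lambda>w. (f (fst p) w, g (fst p) w)) has_derivative
      blinfun_apply ((?l o\<^sub>L D' p) + (?r o\<^sub>L E' p))) (at (snd p))"
    using D' E'
  proof eventually_elim
    case (elim p)
    have "((\<lambda>w. (f (fst p) w, g (fst p) w)) has_derivative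
      (\<lambda>v. (blinfun_apply (D' p) v, blinfun_apply (E' p) v))) (at (snd p))"
      using elim by (rule has_derivative_Pair)
    moreover have "(\<lambda>v. (blinfun_apply (D' p) v, blinfun_apply (E' p) v)) = blinfun_apply ((?l o\<^sub>L D' p) + (?r o\<^sub>L E' p))"
      by (rule ext) (simp add: blinfun.add_left l r)
    ultimately show ?case by simp
  qed
  moreover have "((\<lambda>p. (f (fst p) (snd p), g (fst p) (snd p))) \<longlongrightarrow> (y, z)) ?F"
    by (rule tendsto_Pair[OF limf(1) limg(1)])
  moreover have "((\<lambda>p. (?l o\<^sub>L D' p) + (?r o\<^sub>L E' p)) \<longlongrightarrow> (?l o\<^sub>L D) + (?r o\<^sub>L E)) ?F"
    by (intro tendsto_add bounded_bilinear.tendsto[OF bounded_bilinear_blinfun_compose] tendsto_const limf limg)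
  ultimately show ?thesis
    unfolding C1_limit_def by (intro exI[of _ "\<lambda>p. (?l o\<^sub>L D' p) + (?r o\<^sub>L E' p)"] conjI)
qed

lemma C1_limit_unique:
  assumes "C1_limit f x y D" "C1_limit f x z E"
  shows "D = E"
proof -
  let ?F = "sequentially \<times>\<^sub>F nhds x"
  obtain D' where D': "\<forall>\<^sub>F p in ?F. (f (fst p) has_derivative blinfun_apply (D' p)) (at (snd p))" "(D' \<longlongrightarrow> D) ?F"
    using assms(1) unfolding C1_limit_def by blast
  obtain E' where E': "\<forall>\<^sub>F p in ?F. (f (fst p) has_derivative blinfun_apply (E' p)) (at (snd p))" "(E' \<longlongrightarrow> E) ?F"
    using assms(2) unfolding C1_limit_def by blast
  have "\<forall>\<^sub>F p in ?F. E' p = D' p"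
    using D'(1) E'(1)
  proof eventually_elim
    case (elim p)
    from has_derivative_unique[OF elim] show ?case by (simp add: blinfun_apply_inject)
  qed
  with E'(2) have "(D' \<longlongrightarrow> E) ?F" by (rule Lim_transform_eventually)
  with D'(2) show ?thesis
    by (intro tendsto_unique[of ?F D']) (auto simp: prod_filter_eq_bot)
qed

lemma C1_limit_bound:
  assumes "C1_limit f x 0 0" "e > 0"
  shows "\<forall>\<^sub>F p in sequentially \<times>\<^sub>F nhds x. norm (f (fst p) (snd p)) \<le> e \<and>
    (\<exists>D. (f (fst p) has_derivative D) (at (snd p)) \<and> onorm D \<le> e)"
proof -
  let ?F = "sequentially \<times>\<^sub>F nhds x"
  obtain D' where D': "\<forall>\<^sub>F p in ?F. (f (fst p) has_derivative blinfun_apply (D' p)) (at (snd p))"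
    and lim: "((\<lambda>p. f (fst p) (snd p)) \<longlongrightarrow> 0) ?F" "(D' \<longlongrightarrow> 0) ?F" using assms(1) unfolding C1_limit_def by blast
  show ?thesis
    using D' tendstoD[OF lim(1) assms(2)] tendstoD[OF lim(2) assms(2)]
    by eventually_elim (auto simp: norm_blinfun.rep_eq[symmetric] intro!: less_imp_le)
qed

text \<open>The bound on the derivative is expressed by a Lipschitz constant, which is the form that passes
  to the inverse of a perturbed identity.\<close>

definition C1_small :: "(nat \<Rightarrow> 'e::euclidean_space \<Rightarrow> 'e) \<Rightarrow> bool" where
  "C1_small h \<longleftrightarrow> (\<forall>e>0. \<forall>\<^sub>F n in sequentially.
     (\<forall>x. norm (h n x) \<le> e) \<and> (\<forall>x y. norm (h n x - h n y) \<le> e * norm (x - y)))"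

lemma C1_limit_perturbed_identity:
  assumes small: "C1_small h" and smooth: "\<forall>\<^sub>F n in sequentially. smooth_on (h n) UNIV"
  shows "C1_limit (\<lambda>n x. x + h n x) x x id_blinfun"
proof -
  let ?F = "sequentially \<times>\<^sub>F nhds x"
  define E where "E = (\<lambda>p. Blinfun (frechet_derivative (h (fst p)) (at (snd p))))"
  have app: "blinfun_apply (E (n, z)) = frechet_derivative (h n) (at z)"
    "(h n has_derivative frechet_derivative (h n) (at z)) (at z)"
    if "smooth_on (h n) UNIV" for n z
    using smooth_on_has_derivative[OF that, of z]
    by (auto simp: E_def intro!: bounded_linear_Blinfun_apply has_derivative_bounded_linear)
  have "\<forall>\<^sub>F p in ?F. smooth_on (h (fst p)) UNIV"
    using smooth by (rule eventually_prod_fst)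
  then have "\<forall>\<^sub>F p in ?F. ((\<lambda>x. x + h (fst p) x) has_derivative blinfun_apply (id_blinfun + E p)) (at (snd p))"
  proof eventually_elim
    case (elim p)
    have "((\<lambda>x. x + h (fst p) x) has_derivative (\<lambda>v. v + blinfun_apply (E p) v)) (at (snd p))"
      using app[OF elim, of "snd p"] by (auto intro!: derivative_eq_intros)
    moreover have "(\<lambda>v. v + blinfun_apply (E p) v) = blinfun_apply (id_blinfun + E p)"
      by (rule ext) (simp add: blinfun.add_left)
    ultimately show ?case by simp
  qed
  moreover have "((\<lambda>p. h (fst p) (snd p)) \<longlongrightarrow> 0) ?F"
  proof (rule tendstoI)
    fix e :: real assume "e > 0"
    then have "\<forall>\<^sub>F n in sequentially. \<forall>x. norm (h n x) \<le> e / 2"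
      using small[unfolded C1_small_def, rule_format, of "e / 2"] by (auto elim: eventually_mono)
    then have "\<forall>\<^sub>F p in ?F. \<forall>x. norm (h (fst p) x) \<le> e / 2" by (rule eventually_prod_fst)
    then show "\<forall>\<^sub>F p in ?F. dist (h (fst p) (snd p)) 0 < e"
    proof eventually_elim
      case (elim p)
      then have "norm (h (fst p) (snd p)) \<le> e / 2" by blast
      then show ?case using \<open>e > 0\<close> by simp
    qed
  qed
  then have "((\<lambda>p. snd p + h (fst p) (snd p)) \<longlongrightarrow> x + 0) ?F"
    by (intro tendsto_add filterlim_snd)
  moreover have "(E \<longlongrightarrow> 0) ?F"
  proof (rule tendstoI)
    fix e :: real assume e: "e > 0"
    then have "\<forall>\<^sub>F n in sequentially. \<forall>x y. norm (h n x - h n y) \<le> e / 2 * norm (x - y)"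
      using small[unfolded C1_small_def, rule_format, of "e / 2"] by (auto elim: eventually_mono)
    with smooth have "\<forall>\<^sub>F n in sequentially. smooth_on (h n) UNIV \<and> (\<forall>x y. norm (h n x - h n y) \<le> e / 2 * norm (x - y))"
      by eventually_elim auto
    then have "\<forall>\<^sub>F p in ?F. smooth_on (h (fst p)) UNIV \<and> (\<forall>x y. norm (h (fst p) x - h (fst p) y) \<le> e / 2 * norm (x - y))"
      by (rule eventually_prod_fst)
    then show "\<forall>\<^sub>F p in ?F. dist (E p) 0 < e"
    proof eventually_elim
      case (elim p)
      have "norm (E p) \<le> e / 2"
      proof (rule norm_blinfun_bound)
        fix v
        show "norm (blinfun_apply (E p) v) \<le> e / 2 * norm v"
          using lipschitz_derivative_bound[OF app(2), of "fst p" "snd p" "e / 2" v] app(1)[of "fst p" "snd p"] elim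
          by simp
      qed (use e in simp)
      then show ?case using e by simp
    qed
  qed
  then have "((\<lambda>p. id_blinfun + E p) \<longlongrightarrow> id_blinfun + 0) ?F"
    by (intro tendsto_intros)
  ultimately show ?thesis unfolding C1_limit_def by (auto intro!: exI[of _ "\<lambda>p. id_blinfun + E p"])
qed

text \<open>If \<open>id + h n\<close> is invertible, then the inverse is \<open>id - h n \<circ> g n\<close>, a perturbation of the same kind.\<close>

lemma C1_small_inverse:
  assumes small: "C1_small h"
    and inv: "\<forall>\<^sub>F n in sequentially. \<forall>y. g n y + h n (g n y) = y"
  shows "C1_small (\<lambda>n y. g n y - y)"
  unfolding C1_small_def
proof (intro allI impI)
  fix e :: real assume e: "e > 0"
  define d where "d = min (1 / 2) (e / 2)"
  have d: "d > 0" "d \<le> 1 / 2" "2 * d \<le> e" "d \<le> e" using e by (auto simp: d_def)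
  from small d(1) have "\<forall>\<^sub>F n in sequentially.
     (\<forall>x. norm (h n x) \<le> d) \<and> (\<forall>x y. norm (h n x - h n y) \<le> d * norm (x - y))"
    unfolding C1_small_def by blast
  with inv show "\<forall>\<^sub>F n in sequentially. (\<forall>x. norm (g n x - x) \<le> e) \<and>
      (\<forall>x y. norm ((g n x - x) - (g n y - y)) \<le> e * norm (x - y))"
  proof eventually_elim
    case (elim n)
    have eq: "g n y - y = - h n (g n y)" for y
      using elim(1)[rule_format, of y] by (metis add_diff_cancel_left' minus_diff_eq)
    have "norm (g n y - y) \<le> e" for y
      using elim(2) d(4) eq[of y] by (metis norm_minus_cancel order_trans)
    moreover have "norm ((g n x - x) - (g n y - y)) \<le> e * norm (x - y)" for x y
    proof -
      have *: "norm ((g n x - x) - (g n y - y)) \<le> d * norm (g n x - g n y)"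
        unfolding eq using elim(2) by (metis minus_diff_minus norm_minus_cancel)
      have "norm (g n x - g n y) \<le> norm ((g n x - x) - (g n y - y)) + norm (x - y)"
        by (rule order_trans[OF _ norm_triangle_ineq]) simp
      also have "\<dots> \<le> (1 / 2) * norm (g n x - g n y) + norm (x - y)"
        using * d(2) by (meson add_right_mono mult_right_mono norm_ge_zero order_trans)
      finally have "norm (g n x - g n y) \<le> 2 * norm (x - y)" by simp
      then have "d * norm (g n x - g n y) \<le> (2 * d) * norm (x - y)"
        using d(1) by (simp add: mult_left_mono)
      also have "\<dots> \<le> e * norm (x - y)" using d(3) by (simp add: mult_right_mono)
      finally show ?thesis using * by linarith
    qed
    ultimately show ?case by blast
  qed
qed

section \<open>Diffeomorphisms of a manifold\<close>

text \<open>As the atlas is maximal, a diffeomorphism is a bijection that carries charts to charts. This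
  makes tensors and maps natural under diffeomorphisms without any use of the chain rule.\<close>

definition pull_chart :: "'a topology \<Rightarrow> ('a \<Rightarrow> 'a) \<Rightarrow> ('a, 'e) chart \<Rightarrow> ('a, 'e) chart" where
  "pull_chart X \<phi> c = ({p \<in> topspace X. \<phi> p \<in> fst c}, \<lambda>p. snd c (\<phi> p))"

definition diffeos ::
  "'a topology \<Rightarrow> ('a, 'e::euclidean_space) chart set \<Rightarrow> ('a \<Rightarrow> 'a) \<Rightarrow> ('a \<Rightarrow> 'a) \<Rightarrow> bool" where
  "diffeos X A \<phi> \<psi> \<longleftrightarrow>
     (\<forall>p\<in>topspace X. \<phi> p \<in> topspace X \<and> \<psi> p \<in> topspace X \<and> \<psi> (\<phi> p) = p \<and> \<phi> (\<psi> p) = p) \<and>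
     (\<forall>c\<in>A. pull_chart X \<phi> c \<in> A \<and> pull_chart X \<psi> c \<in> A)"

lemma diffeos_sym: "diffeos X A \<phi> \<psi> \<Longrightarrow> diffeos X A \<psi> \<phi>"
  by (simp add: diffeos_def)

lemma diffeos_id:
  assumes "\<And>c. c \<in> A \<Longrightarrow> fst c \<subseteq> topspace X"
  shows "diffeos X A (\<lambda>p. p) (\<lambda>p. p)"
proof -
  have "pull_chart X (\<lambda>p. p) c = c" if "c \<in> A" for c
    using assms[OF that] by (cases c) (auto simp: pull_chart_def)
  then show ?thesis by (simp add: diffeos_def)
qed

lemma diffeos_compose:
  assumes "diffeos X A \<phi> \<psi>" "diffeos X A \<phi>' \<psi>'"
  shows "diffeos X A (\<lambda>p. \<phi> (\<phi>' p)) (\<lambda>p. \<psi>' (\<psi> p))"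
proof -
  have "pull_chart X (\<lambda>p. \<phi> (\<phi>' p)) c = pull_chart X \<phi>' (pull_chart X \<phi> c)"
    "pull_chart X (\<lambda>p. \<psi>' (\<psi> p)) c = pull_chart X \<psi> (pull_chart X \<psi>' c)" for c :: "('a, 'b) chart"
    using assms by (auto simp: pull_chart_def diffeos_def)
  then show ?thesis using assms by (simp add: diffeos_def)
qed

locale smooth_mfd =
  fixes X :: "'a topology" and A :: "('a, 'e::euclidean_space) chart set"
  assumes manifold: "smooth_manifold X A"
begin

lemma chart_openin: "c \<in> A \<Longrightarrow> openin X (fst c)"
  and chart_open_image: "c \<in> A \<Longrightarrow> open (snd c ` fst c)"
  using manifold by (auto simp: smooth_manifold_def chart_of_def)

lemma chart_subset: "c \<in> A \<Longrightarrow> fst c \<subseteq> topspace X"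
  by (simp add: chart_openin openin_subset)

lemma chart_homeo:
  "c \<in> A \<Longrightarrow> homeomorphic_map (subtopology X (fst c)) (top_of_set (snd c ` fst c)) (snd c)"
  using manifold by (auto simp: smooth_manifold_def chart_of_def)

lemma chart_inj: "c \<in> A \<Longrightarrow> inj_on (snd c) (fst c)"
  using homeomorphic_imp_injective_map[OF chart_homeo, of c] chart_subset[of c]
  by (simp add: Int_absorb1)

lemma param_chart [simp]: "c \<in> A \<Longrightarrow> p \<in> fst c \<Longrightarrow> param c (snd c p) = p"
  by (simp add: chart_inj)

lemma param_in [simp]: "x \<in> snd c ` fst c \<Longrightarrow> param c x \<in> fst c"
  by (rule inv_into_into)

lemma chart_param [simp]: "x \<in> snd c ` fst c \<Longrightarrow> snd c (param c x) = x"
  by (rule f_inv_into_f)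

lemma chart_cover: "p \<in> topspace X \<Longrightarrow> \<exists>c\<in>A. p \<in> fst c"
proof -
  have "(\<Union>c\<in>A. fst c) = topspace X" using manifold unfolding smooth_manifold_def by (elim conjE)
  moreover assume "p \<in> topspace X"
  ultimately show ?thesis by blast
qed

lemma atlas_maximal: "chart_of X c \<Longrightarrow> (\<And>d. d \<in> A \<Longrightarrow> compatible c d) \<Longrightarrow> c \<in> A"
proof -
  assume c: "chart_of X c" "\<And>d. d \<in> A \<Longrightarrow> compatible c d"
  have "chart_of X c \<and> (\<forall>d\<in>A. compatible c d) \<longrightarrow> c \<in> A"
    using manifold unfolding smooth_manifold_def by (elim conjE) (erule allE)
  with c show "c \<in> A" by simp
qed

lemma transition_smooth:
  assumes "c \<in> A" "d \<in> A"
  shows "smooth_on (\<lambda>x. snd d (param c x)) (snd c ` (fst c \<inter> fst d))"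
proof -
  have "\<forall>c\<in>A. \<forall>d\<in>A. compatible c d" using manifold unfolding smooth_manifold_def by (elim conjE)
  with assms have "compatible c d" by blast
  then show ?thesis unfolding compatible_def o_def by (elim conjE)
qed

lemma chart_image_open:
  assumes "c \<in> A" "openin X U"
  shows "open (snd c ` (fst c \<inter> U))"
proof -
  have "openin (subtopology X (fst c)) (fst c \<inter> U)"
    using assms(2) by (simp add: openin_subtopology_Int2)
  moreover have "open_map (subtopology X (fst c)) (top_of_set (snd c ` fst c)) (snd c)"
    using chart_homeo[OF assms(1)] by (rule homeomorphic_imp_open_map)
  ultimately have "openin (top_of_set (snd c ` fst c)) (snd c ` (fst c \<inter> U))"
    by (simp add: open_map_def)
  then show ?thesis using chart_open_image[OF assms(1)] openin_open_eq by blast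
qed

lemma chart_preimage_openin:
  assumes "c \<in> A" "open V"
  shows "openin X {p \<in> fst c. snd c p \<in> V}"
proof -
  have "continuous_map (subtopology X (fst c)) (top_of_set (snd c ` fst c)) (snd c)"
    using chart_homeo[OF assms(1)] by (rule homeomorphic_imp_continuous_map)
  then have "continuous_map (subtopology X (fst c)) euclidean (snd c)"
    by (simp add: continuous_map_in_subtopology)
  then have "openin (subtopology X (fst c)) {p \<in> topspace (subtopology X (fst c)). snd c p \<in> V}"
    using assms(2) by (intro openin_continuous_map_preimage[of _ euclidean]) auto
  moreover have "topspace (subtopology X (fst c)) = fst c"
    using chart_subset[OF assms(1)] by auto
  ultimately have "openin (subtopology X (fst c)) {p \<in> fst c. snd c p \<in> V}" by (simp only:)
  then show ?thesis using chart_openin[OF assms(1)] by (rule openin_trans_full)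
qed

lemma param_continuous:
  assumes "c \<in> A"
  shows "continuous_map (top_of_set (snd c ` fst c)) X (param c)"
  unfolding continuous_map_alt
proof (intro conjI allI impI)
  fix W assume W: "openin X W"
  have "param c -` W \<inter> topspace (top_of_set (snd c ` fst c)) = snd c ` (fst c \<inter> W)"
    using assms by auto
  then show "openin (top_of_set (snd c ` fst c)) (param c -` W \<inter> topspace (top_of_set (snd c ` fst c)))"
    using chart_image_open[OF assms W] by (simp add: open_subset image_mono)
next
  show "param c \<in> topspace (top_of_set (snd c ` fst c)) \<rightarrow> topspace X"
    using chart_subset[OF assms] by (auto intro!: param_in)
qed

lemma compactin_param_image:
  assumes "c \<in> A" "compact K" "K \<subseteq> snd c ` fst c"
  shows "compactin X (param c ` K)"
  by (rule image_compactin[OF _ param_continuous[OF assms(1)]])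
     (use assms in \<open>simp add: compactin_subtopology\<close>)

lemma diffeosD:
  assumes "diffeos X A \<phi> \<psi>"
  shows "\<And>p. p \<in> topspace X \<Longrightarrow> \<phi> p \<in> topspace X" "\<And>p. p \<in> topspace X \<Longrightarrow> \<psi> p \<in> topspace X"
    "\<And>p. p \<in> topspace X \<Longrightarrow> \<psi> (\<phi> p) = p" "\<And>p. p \<in> topspace X \<Longrightarrow> \<phi> (\<psi> p) = p"
    "\<And>c. c \<in> A \<Longrightarrow> pull_chart X \<phi> c \<in> A" "\<And>c. c \<in> A \<Longrightarrow> pull_chart X \<psi> c \<in> A"
  using assms by (auto simp: diffeos_def)

text \<open>Smoothness of \<open>\<phi>\<close> in charts, as opposed to the condition on charts in \<open>diffeos\<close>: this is what can be
  checked for a map given by a formula.\<close>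

definition smooth_self :: "('a \<Rightarrow> 'a) \<Rightarrow> bool" where
  "smooth_self \<phi> \<longleftrightarrow> continuous_map X X \<phi> \<and>
     (\<forall>c\<in>A. \<forall>d\<in>A. smooth_on (\<lambda>x. snd d (\<phi> (param c x))) (snd c ` {p \<in> fst c. \<phi> p \<in> fst d}))"

text \<open>The coordinate changes between the chart \<open>c \<circ> \<phi>\<close> and a chart \<open>d\<close> are the coordinate expressions of
  \<open>\<phi>\<close> and \<open>\<psi>\<close> in the charts \<open>c\<close> and \<open>d\<close>, so the maximality of the atlas applies.\<close>

lemma pull_chart_in_atlas:
  assumes \<phi>: "smooth_self \<phi>" and \<psi>: "smooth_self \<psi>"
    and inv: "\<And>p. p \<in> topspace X \<Longrightarrow> \<psi> (\<phi> p) = p" "\<And>p. p \<in> topspace X \<Longrightarrow> \<phi> (\<psi> p) = p"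
    and c: "c \<in> A"
  shows "pull_chart X \<phi> c \<in> A"
proof -
  let ?U = "{p \<in> topspace X. \<phi> p \<in> fst c}"
  have top: "\<phi> p \<in> topspace X" "\<psi> p \<in> topspace X" if "p \<in> topspace X" for p
    using that \<phi> \<psi> by (auto simp: smooth_self_def continuous_map_def)
  have U: "openin X ?U"
    using \<phi> chart_openin[OF c] by (simp add: smooth_self_def continuous_map_def)
  have "\<phi> ` ?U = fst c"
  proof
    show "fst c \<subseteq> \<phi> ` ?U"
    proof
      fix q assume "q \<in> fst c"
      moreover from this have "q \<in> topspace X" using chart_subset[OF c] by blast
      ultimately show "q \<in> \<phi> ` ?U" using inv(2) top(2) by (intro image_eqI[of _ _ "\<psi> q"]) auto
    qed
  qed auto
  then have img: "(\<lambda>p. snd c (\<phi> p)) ` ?U = snd c ` fst c" by (metis image_image)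
  have "homeomorphic_maps X X \<phi> \<psi>"
    using \<phi> \<psi> inv by (simp add: homeomorphic_maps_def smooth_self_def)
  then have hom: "homeomorphic_map X X \<phi>" using homeomorphic_map_maps by blast
  have "homeomorphic_map (subtopology X ?U) (subtopology X (fst c)) \<phi>"
    by (rule homeomorphic_map_subtopologies[OF hom])
      (use \<open>\<phi> ` ?U = fst c\<close> chart_subset[OF c] in \<open>auto simp: Int_absorb1\<close>)
  then have "homeomorphic_map (subtopology X ?U) (top_of_set (snd c ` fst c)) (snd c \<circ> \<phi>)"
    using chart_homeo[OF c] by (rule homeomorphic_map_compose)
  then have chart: "chart_of X (pull_chart X \<phi> c)"
    using U img chart_open_image[OF c] by (simp add: chart_of_def pull_chart_def o_def)
  have inj: "inj_on (\<lambda>p. snd c (\<phi> p)) ?U"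
    using inv(1) chart_inj[OF c] by (intro inj_onI) (metis (no_types, lifting) inj_onD mem_Collect_eq)
  have "compatible (pull_chart X \<phi> c) d" if d: "d \<in> A" for d
  proof -
    have "smooth_on (snd c \<circ> \<phi> \<circ> param d) (snd d ` {p \<in> fst d. \<phi> p \<in> fst c})"
      using \<phi> c d by (simp add: smooth_self_def o_def)
    moreover have "{p \<in> fst d. \<phi> p \<in> fst c} = ?U \<inter> fst d" using chart_subset[OF d] by blast
    ultimately have 1: "smooth_on (\<lambda>x. snd c (\<phi> (param d x))) (snd d ` (?U \<inter> fst d))"
      by (simp add: o_def)
    have eq: "(\<lambda>p. snd c (\<phi> p)) ` (?U \<inter> fst d) = snd c ` {p \<in> fst c. \<psi> p \<in> fst d}" (is "?l = ?r")
    proof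
      show "?l \<subseteq> ?r" using inv(1) by auto
      show "?r \<subseteq> ?l"
      proof
        fix x assume "x \<in> ?r"
        then obtain q where q: "q \<in> fst c" "\<psi> q \<in> fst d" "x = snd c q" by blast
        moreover from q have "q \<in> topspace X" using chart_subset[OF c] by blast
        ultimately show "x \<in> ?l" using inv(2) top(2) by (intro image_eqI[of _ _ "\<psi> q"]) auto
      qed
    qed
    have opn: "open (snd c ` {p \<in> fst c. \<psi> p \<in> fst d})"
    proof -
      have "openin X {p \<in> topspace X. \<psi> p \<in> fst d}"
        using \<psi> chart_openin[OF d] by (simp add: smooth_self_def continuous_map_def)
      moreover have "{p \<in> fst c. \<psi> p \<in> fst d} = fst c \<inter> {p \<in> topspace X. \<psi> p \<in> fst d}"
        using chart_subset[OF c] by blast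
      ultimately show ?thesis using chart_image_open[OF c] by simp
    qed
    have "smooth_on (\<lambda>x. snd d (\<psi> (param c x))) (snd c ` {p \<in> fst c. \<psi> p \<in> fst d})"
      using \<psi> c d by (simp add: smooth_self_def)
    then have 2: "smooth_on (\<lambda>x. snd d (inv_into ?U (\<lambda>p. snd c (\<phi> p)) x)) (snd c ` {p \<in> fst c. \<psi> p \<in> fst d})"
    proof (rule smooth_on_cong[OF opn, rotated])
      fix x assume "x \<in> snd c ` {p \<in> fst c. \<psi> p \<in> fst d}"
      then obtain q where q: "q \<in> fst c" "\<psi> q \<in> fst d" "x = snd c q" by blast
      then have "q \<in> topspace X" using chart_subset[OF c] by blast
      then have "inv_into ?U (\<lambda>p. snd c (\<phi> p)) x = \<psi> q"
        using q inv(2) top(2) by (intro inv_into_f_eq[OF inj]) auto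
      then show "snd d (\<psi> (param c x)) = snd d (inv_into ?U (\<lambda>p. snd c (\<phi> p)) x)"
        using q c by simp
    qed
    show ?thesis
      using 1 2 unfolding compatible_def pull_chart_def fst_conv snd_conv eq
      by (simp add: o_def Int_commute)
  qed
  with chart show ?thesis by (rule atlas_maximal)
qed

lemma diffeosI:
  assumes "smooth_self \<phi>" "smooth_self \<psi>"
    and "\<And>p. p \<in> topspace X \<Longrightarrow> \<psi> (\<phi> p) = p" "\<And>p. p \<in> topspace X \<Longrightarrow> \<phi> (\<psi> p) = p"
  shows "diffeos X A \<phi> \<psi>"
  unfolding diffeos_def
  using pull_chart_in_atlas[OF assms] pull_chart_in_atlas[OF assms(2,1,4,3)] assms
  by (auto simp: smooth_self_def continuous_map_def)

text \<open>In the chart \<open>c \<circ> \<psi>\<close> the map \<open>\<phi> \<circ> u\<close> has the same coordinate expression as \<open>u\<close> has in the chart \<open>c\<close>.\<close>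

lemma smooth_map_on_diffeo:
  assumes \<phi>: "diffeos X A \<phi> \<psi>" and u: "smooth_map_on A K u"
  shows "smooth_map_on A K (\<lambda>z. \<phi> (u z))"
  unfolding smooth_map_on_def
proof
  fix z assume "z \<in> K"
  then obtain V u' c where V: "c \<in> A" "open V" "z \<in> V" "u' ` V \<subseteq> fst c" "smooth_on (snd c \<circ> u') V"
    "\<And>w. w \<in> V \<inter> K \<Longrightarrow> u' w = u w" using u unfolding smooth_map_on_def by metis
  have top: "u' w \<in> topspace X" if "w \<in> V" for w using that V(4) chart_subset[OF V(1)] by blast
  have 1: "(\<lambda>w. \<phi> (u' w)) ` V \<subseteq> fst (pull_chart X \<psi> c)"
    using V(4) top diffeosD[OF \<phi>] by (auto simp: pull_chart_def)
  have "smooth_on (snd (pull_chart X \<psi> c) \<circ> (\<lambda>w. \<phi> (u' w))) V"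
    by (rule smooth_on_cong[OF V(2) _ V(5)]) (use top diffeosD[OF \<phi>] in \<open>simp add: pull_chart_def\<close>)
  with V 1 show "\<exists>V u'. \<exists>c\<in>A. open V \<and> z \<in> V \<and> u' ` V \<subseteq> fst c \<and> smooth_on (snd c \<circ> u') V \<and>
        (\<forall>w\<in>V \<inter> K. u' w = \<phi> (u w))"
    by (intro exI[of _ V] exI[of _ "\<lambda>w. \<phi> (u' w)"] bexI[of _ "pull_chart X \<psi> c"])
       (auto simp: diffeosD(6)[OF \<phi>])
qed


section \<open>Diffeomorphisms supported in a chart\<close>

text \<open>The self-map of the manifold that is \<open>f\<close> in the chart \<open>c\<close> and the identity elsewhere.\<close>

definition chart_map :: "('a, 'e) chart \<Rightarrow> ('e \<Rightarrow> 'e) \<Rightarrow> 'a \<Rightarrow> 'a" where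
  "chart_map c f p = (if p \<in> fst c then param c (f (snd c p)) else p)"

text \<open>Injectivity is included because it forces \<open>f\<close> to map every set that contains \<open>K\<close> into itself; so \<open>f\<close>
  acts on the image of any chart that contains \<open>K\<close>.\<close>

definition supported_in :: "'e set \<Rightarrow> ('e \<Rightarrow> 'e) \<Rightarrow> bool" where
  "supported_in K f \<longleftrightarrow> inj f \<and> (\<forall>x. x \<notin> K \<longrightarrow> f x = x)"

lemma supported_in_mem:
  assumes "supported_in K f" "K \<subseteq> U" "x \<in> U"
  shows "f x \<in> U"
proof (rule ccontr)
  assume "f x \<notin> U"
  then have "f (f x) = f x" using assms by (auto simp: supported_in_def)
  then have "f x = x" using assms(1) by (auto simp: supported_in_def dest: injD)
  with assms(3) \<open>f x \<notin> U\<close> show False by simp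
qed

lemma chart_map_outside:
  assumes "c \<in> A" "supported_in K f" "K \<subseteq> snd c ` fst c" "p \<notin> param c ` K"
  shows "chart_map c f p = p"
proof (cases "p \<in> fst c")
  case True
  then have "snd c p \<notin> K" using assms(1,4) by (metis image_eqI param_chart)
  then show ?thesis using True assms(1,2) by (simp add: chart_map_def supported_in_def)
qed (simp add: chart_map_def)

lemma chart_map_smooth_self:
  assumes c: "c \<in> A" and f: "smooth_on f UNIV" "supported_in K f" and K: "compact K" "K \<subseteq> snd c ` fst c"
  shows "smooth_self (chart_map c f)"
proof -
  let ?U = "snd c ` fst c" and ?\<phi> = "chart_map c f" and ?K = "param c ` K"
  have fU: "f x \<in> ?U" if "x \<in> ?U" for x using supported_in_mem[OF f(2) K(2) that] .
  have snd_\<phi>: "snd c (?\<phi> p) = f (snd c p)" "?\<phi> p \<in> fst c" if "p \<in> fst c" for p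
    using that fU by (auto simp: chart_map_def intro!: param_in)
  have top: "?\<phi> p \<in> topspace X" if "p \<in> topspace X" for p
    using that snd_\<phi>(2) chart_subset[OF c] by (cases "p \<in> fst c") (auto simp: chart_map_def)
  have out: "?\<phi> p = p" if "p \<notin> ?K" for p
    using chart_map_outside[OF c f(2) K(2) that] .
  have KX: "?K \<subseteq> fst c" using K(2) by (auto intro!: param_in)
  have "closedin X ?K"
    using compactin_imp_closedin[OF _ compactin_param_image[OF c K]] manifold
    by (simp add: smooth_manifold_def)
  then have Kc: "openin X (topspace X - ?K)" by blast
  have cont: "openin X {p \<in> topspace X. ?\<phi> p \<in> W}" if W: "openin X W" for W
  proof -
    have "continuous_on UNIV f" using f(1) by (rule smooth_on_continuous)
    then have "open (f -` (snd c ` (fst c \<inter> W)))"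
      using chart_image_open[OF c W] by (simp add: open_vimage)
    then have "openin X ({p \<in> fst c. snd c p \<in> f -` (snd c ` (fst c \<inter> W))} \<union> (W \<inter> (topspace X - ?K)))"
      by (intro openin_Un openin_Int W Kc chart_preimage_openin c)
    moreover have "{p \<in> topspace X. ?\<phi> p \<in> W}
        = {p \<in> fst c. snd c p \<in> f -` (snd c ` (fst c \<inter> W))} \<union> (W \<inter> (topspace X - ?K))" (is "?l = ?r")
    proof (intro equalityI subsetI)
      fix p assume p: "p \<in> ?l"
      show "p \<in> ?r"
      proof (cases "p \<in> fst c")
        case True
        have "snd c (?\<phi> p) \<in> snd c ` (fst c \<inter> W)" using p snd_\<phi>(2)[OF True] by blast
        then show ?thesis using True unfolding snd_\<phi>(1)[OF True] by blast
      next
        case False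
        moreover from this have "?\<phi> p = p" by (simp add: chart_map_def)
        ultimately show ?thesis using p KX by auto
      qed
    next
      fix p assume p: "p \<in> ?r"
      show "p \<in> ?l"
      proof (cases "p \<in> fst c \<and> snd c p \<in> f -` (snd c ` (fst c \<inter> W))")
        case True
        then have "snd c (?\<phi> p) \<in> snd c ` (fst c \<inter> W)" using snd_\<phi>(1) by simp
        then obtain q where q: "q \<in> fst c" "q \<in> W" "snd c (?\<phi> p) = snd c q" by blast
        then have "?\<phi> p = q" using snd_\<phi>(2) True inj_onD[OF chart_inj[OF c] q(3)] by blast
        then show ?thesis using True q(2) chart_subset[OF c] by blast
      next
        case False
        then have "p \<in> W" "p \<in> topspace X" "p \<notin> ?K" using p by blast+
        then show ?thesis using out[of p] by simp
      qed
    qed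
    ultimately show ?thesis by simp
  qed
  then have "continuous_map X X ?\<phi>" using top by (auto simp: continuous_map_def)
  moreover have "smooth_on (\<lambda>x. snd e (?\<phi> (param d x))) (snd d ` {p \<in> fst d. ?\<phi> p \<in> fst e})"
    if d: "d \<in> A" and e: "e \<in> A" for d e
  proof (rule smooth_on_local)
    fix x assume "x \<in> snd d ` {p \<in> fst d. ?\<phi> p \<in> fst e}"
    then obtain p where p: "p \<in> fst d" "?\<phi> p \<in> fst e" "x = snd d p" by blast
    show "\<exists>W. open W \<and> x \<in> W \<and> smooth_on (\<lambda>x. snd e (?\<phi> (param d x))) W"
    proof (cases "p \<in> fst c")
      case True
      let ?N = "fst c \<inter> {p \<in> topspace X. ?\<phi> p \<in> fst e}"
      define W where "W = snd d ` (fst d \<inter> ?N)"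
      have W: "open W" unfolding W_def
        by (intro chart_image_open d openin_Int chart_openin c cont e)
      have x: "x \<in> W" using p True chart_subset[OF c] by (auto simp: W_def)
      have 1: "smooth_on (\<lambda>x. snd c (param d x)) W"
        by (rule smooth_on_subset[OF transition_smooth[OF d c]]) (auto simp: W_def)
      have 2: "smooth_on (\<lambda>x. f (snd c (param d x))) W"
        by (rule smooth_on_compose[OF W open_UNIV _ 1 f(1)]) simp
      have 3: "(\<lambda>x. f (snd c (param d x))) ` W \<subseteq> snd c ` (fst c \<inter> fst e)"
      proof
        fix y assume "y \<in> (\<lambda>x. f (snd c (param d x))) ` W"
        then obtain q where "q \<in> fst d" "q \<in> ?N" "y = f (snd c q)" using d by (auto simp: W_def)
        moreover from this have "snd c (?\<phi> q) = f (snd c q)" "?\<phi> q \<in> fst c" using snd_\<phi> by blast+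
        ultimately show "y \<in> snd c ` (fst c \<inter> fst e)"
          by (intro image_eqI[of _ _ "?\<phi> q"]) simp_all
      qed
      have "smooth_on (\<lambda>x. snd e (param c (f (snd c (param d x))))) W"
        by (rule smooth_on_compose[OF W _ 3 2 transition_smooth[OF c e]])
          (use chart_image_open[OF c chart_openin[OF e]] in auto)
      then have "smooth_on (\<lambda>x. snd e (?\<phi> (param d x))) W"
        by (rule smooth_on_cong[OF W, rotated]) (use d in \<open>auto simp: W_def chart_map_def\<close>)
      with W x show ?thesis by blast
    next
      case False
      define W where "W = snd d ` (fst d \<inter> (fst e \<inter> (topspace X - ?K)))"
      have W: "open W" unfolding W_def
        by (intro chart_image_open d openin_Int chart_openin e Kc)
      have "p \<notin> ?K" using False KX by blast
      then have x: "x \<in> W" using p chart_subset[OF d] out[of p] by (auto simp: W_def)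
      have "smooth_on (\<lambda>x. snd e (param d x)) W"
        by (rule smooth_on_subset[OF transition_smooth[OF d e]]) (auto simp: W_def)
      then have "smooth_on (\<lambda>x. snd e (?\<phi> (param d x))) W"
        by (rule smooth_on_cong[OF W, rotated]) (use d out in \<open>auto simp: W_def\<close>)
      with W x show ?thesis by blast
    qed
  qed
  ultimately show ?thesis by (simp add: smooth_self_def)
qed

lemma chart_map_inverse:
  assumes "c \<in> A" "supported_in K f" "K \<subseteq> snd c ` fst c" "\<And>x. g (f x) = x"
  shows "chart_map c g (chart_map c f p) = p"
proof (cases "p \<in> fst c")
  case True
  then have "f (snd c p) \<in> snd c ` fst c" using supported_in_mem[OF assms(2,3)] by blast
  then show ?thesis using True assms(1,4) by (simp add: chart_map_def param_in)
qed (simp add: chart_map_def)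

lemma chart_map_diffeos:
  assumes c: "c \<in> A" and f: "smooth_on f UNIV" "supported_in K f" and K: "compact K" "K \<subseteq> snd c ` fst c"
    and g: "smooth_on g UNIV" "\<And>x. g (f x) = x" "\<And>x. f (g x) = x"
  shows "diffeos X A (chart_map c f) (chart_map c g)"
proof -
  have sg: "supported_in K g"
    unfolding supported_in_def
  proof (intro conjI allI impI)
    show "inj g" using g(3) by (metis injI)
    fix x assume "x \<notin> K"
    then have "f x = x" using f(2) by (simp add: supported_in_def)
    then show "g x = x" using g(2) by metis
  qed
  show ?thesis
    by (rule diffeosI[OF chart_map_smooth_self[OF c f K] chart_map_smooth_self[OF c g(1) sg K]
          chart_map_inverse[OF c f(2) K(2) g(2)] chart_map_inverse[OF c sg K(2) g(3)]])
qed


section \<open>Convergence of diffeomorphisms to the identity\<close>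

text \<open>\<open>C\<^sup>1\<close> convergence of maps \<open>u n\<close> into the manifold, near a parameter \<open>x\<close> at which the limit is \<open>p\<close>. In
  \<open>C1_to_id\<close> the same chart is used for the source and the target, so that the limit derivative is the
  identity in every chart.\<close>

definition chart_limit ::
  "('a, 'e) chart \<Rightarrow> (nat \<Rightarrow> 'b::euclidean_space \<Rightarrow> 'a) \<Rightarrow> 'b \<Rightarrow> 'a \<Rightarrow> ('b \<Rightarrow>\<^sub>L 'e) \<Rightarrow> bool" where
  "chart_limit c u x p D \<longleftrightarrow> (\<forall>\<^sub>F q in sequentially \<times>\<^sub>F nhds x. u (fst q) (snd q) \<in> fst c) \<and>
     C1_limit (\<lambda>n w. snd c (u n w)) x (snd c p) D"

definition C1_to_id :: "(nat \<Rightarrow> 'a \<Rightarrow> 'a) \<Rightarrow> bool" where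
  "C1_to_id \<Phi> \<longleftrightarrow> (\<forall>c\<in>A. \<forall>p\<in>fst c.
     chart_limit c (\<lambda>n w. \<Phi> n (param c w)) (snd c p) p id_blinfun)"

lemma chart_limit_compose:
  assumes c: "c \<in> A" "p \<in> fst c" and u: "chart_limit c u x p D" and \<Phi>: "C1_to_id \<Phi>"
  shows "chart_limit c (\<lambda>n w. \<Phi> n (u n w)) x p D"
proof -
  let ?F = "sequentially \<times>\<^sub>F nhds x"
  define v where "v = (\<lambda>n w. snd c (u n w))"
  have u_in: "\<forall>\<^sub>F q in ?F. u (fst q) (snd q) \<in> fst c" and v: "C1_limit v x (snd c p) D"
    using u by (simp_all add: chart_limit_def v_def)
  have \<Phi>_in: "\<forall>\<^sub>F q in sequentially \<times>\<^sub>F nhds (snd c p). \<Phi> (fst q) (param c (snd q)) \<in> fst c"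
    and \<Phi>_lim: "C1_limit (\<lambda>n w. snd c (\<Phi> n (param c w))) (snd c p) (snd c p) id_blinfun"
    using \<Phi> c by (simp_all add: C1_to_id_def chart_limit_def)
  have "\<forall>\<^sub>F q in ?F. \<Phi> (fst q) (param c (v (fst q) (snd q))) \<in> fst c"
    using filterlim_iff[THEN iffD1, OF C1_limit_tendsto_Pair[OF v], rule_format, OF \<Phi>_in] by simp
  with u_in have "\<forall>\<^sub>F q in ?F. \<Phi> (fst q) (u (fst q) (snd q)) \<in> fst c"
    by eventually_elim (simp add: v_def c)
  moreover have "C1_limit (\<lambda>n w. snd c (\<Phi> n (param c (v n w)))) x (snd c p) (id_blinfun o\<^sub>L D)"
    by (rule C1_limit_compose[OF v \<Phi>_lim])
  then have "C1_limit (\<lambda>n w. snd c (\<Phi> n (u n w))) x (snd c p) (id_blinfun o\<^sub>L D)"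
    by (rule C1_limit_cong) (use u_in in eventually_elim, simp add: v_def c)
  moreover have "id_blinfun o\<^sub>L D = D" by (rule blinfun_eqI) simp
  ultimately show ?thesis by (simp add: chart_limit_def)
qed

lemma C1_to_id_compose: "C1_to_id \<Phi> \<Longrightarrow> C1_to_id \<Psi> \<Longrightarrow> C1_to_id (\<lambda>n p. \<Psi> n (\<Phi> n p))"
  using chart_limit_compose[of _ _ "\<lambda>n w. \<Phi> n (param _ w)" _ id_blinfun \<Psi>]
  unfolding C1_to_id_def[of \<Phi>] C1_to_id_def[of "\<lambda>n p. \<Psi> n (\<Phi> n p)"] by blast

lemma transition_C1_limit:
  assumes "c \<in> A" "d \<in> A" "p \<in> fst c" "p \<in> fst d"
  obtains S T where "C1_limit (\<lambda>n x. snd d (param c x)) (snd c p) (snd d p) T"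
    "C1_limit (\<lambda>n x. snd c (param d x)) (snd d p) (snd c p) S" "T o\<^sub>L S = id_blinfun"
proof -
  let ?V = "snd c ` (fst c \<inter> fst d)" and ?W = "snd d ` (fst d \<inter> fst c)"
  let ?\<tau> = "\<lambda>x. snd d (param c x)" and ?\<sigma> = "\<lambda>x. snd c (param d x)"
  have opn: "open ?V" "open ?W" using assms chart_image_open chart_openin by auto
  have mem: "snd c p \<in> ?V" "snd d p \<in> ?W" using assms by auto
  have smooth: "smooth_on ?\<tau> ?V" "smooth_on ?\<sigma> ?W"
    using transition_smooth assms by blast+
  define T where "T = Blinfun (frechet_derivative ?\<tau> (at (snd c p)))"
  define S where "S = Blinfun (frechet_derivative ?\<sigma> (at (snd d p)))"
  have T: "(?\<tau> has_derivative blinfun_apply T) (at (snd c p))"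
    using smooth_on_has_derivative[OF smooth(1) mem(1)] unfolding T_def
    by (simp add: bounded_linear_Blinfun_apply has_derivative_bounded_linear)
  have S: "(?\<sigma> has_derivative blinfun_apply S) (at (snd d p))"
    using smooth_on_has_derivative[OF smooth(2) mem(2)] unfolding S_def
    by (simp add: bounded_linear_Blinfun_apply has_derivative_bounded_linear)
  have "(?\<tau> has_derivative blinfun_apply T) (at (?\<sigma> (snd d p)))" using T assms by simp
  with S have "((\<lambda>x. ?\<tau> (?\<sigma> x)) has_derivative (\<lambda>v. blinfun_apply T (blinfun_apply S v))) (at (snd d p))"
    by (rule has_derivative_compose)
  then have "((\<lambda>x. x) has_derivative (\<lambda>v. blinfun_apply T (blinfun_apply S v))) (at (snd d p))"
    by (rule has_derivative_transform_within_open[OF _ opn(2) mem(2)]) (use assms in auto)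
  then have "(\<lambda>v. blinfun_apply T (blinfun_apply S v)) = (\<lambda>v. v)"
    using has_derivative_unique has_derivative_ident by blast
  then have "T o\<^sub>L S = id_blinfun" by (intro blinfun_eqI) (simp add: fun_eq_iff)
  moreover have "C1_limit (\<lambda>n. ?\<tau>) (snd c p) (snd d p) T" "C1_limit (\<lambda>n. ?\<sigma>) (snd d p) (snd c p) S"
    using C1_limit_smooth[OF smooth(1) opn(1) mem(1) T] C1_limit_smooth[OF smooth(2) opn(2) mem(2) S] assms
    by simp_all
  ultimately show ?thesis using that by blast
qed

text \<open>In the new chart the maps are conjugated by the coordinate change, and conjugation fixes the identity
  as limit derivative.\<close>

lemma chart_limit_id_change:
  assumes c: "c \<in> A" "p \<in> fst c" and d: "d \<in> A" "p \<in> fst d"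
    and \<Phi>: "chart_limit c (\<lambda>n w. \<Phi> n (param c w)) (snd c p) p id_blinfun"
  shows "chart_limit d (\<lambda>n w. \<Phi> n (param d w)) (snd d p) p id_blinfun"
proof -
  let ?Fc = "sequentially \<times>\<^sub>F nhds (snd c p)" and ?Fd = "sequentially \<times>\<^sub>F nhds (snd d p)"
  let ?\<sigma> = "\<lambda>x. snd c (param d x)"
  obtain S T where T: "C1_limit (\<lambda>n x. snd d (param c x)) (snd c p) (snd d p) T"
    and S: "C1_limit (\<lambda>n. ?\<sigma>) (snd d p) (snd c p) S" and TS: "T o\<^sub>L S = id_blinfun"
    using transition_C1_limit[OF c(1) d(1) c(2) d(2)] .
  define f where "f = (\<lambda>n w. snd c (\<Phi> n (param c w)))"
  have f: "C1_limit f (snd c p) (snd c p) id_blinfun"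
    and f_in: "\<forall>\<^sub>F q in ?Fc. \<Phi> (fst q) (param c (snd q)) \<in> fst c"
    using \<Phi> by (simp_all add: chart_limit_def f_def)
  have "\<forall>\<^sub>F z in nhds (snd c p). z \<in> snd c ` (fst c \<inter> fst d)"
    using c d chart_image_open chart_openin by (intro eventually_nhds_in_open) auto
  then have "\<forall>\<^sub>F q in ?Fc. f (fst q) (snd q) \<in> snd c ` (fst c \<inter> fst d)"
    using C1_limit_tendsto[OF f] unfolding filterlim_iff by blast
  with f_in have f_in_d: "\<forall>\<^sub>F q in ?Fc. \<Phi> (fst q) (param c (snd q)) \<in> fst c \<inter> fst d"
  proof eventually_elim
    case (elim q)
    then obtain r where "r \<in> fst c" "r \<in> fst d" "snd c (\<Phi> (fst q) (param c (snd q))) = snd c r"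
      by (auto simp: f_def)
    with elim show ?case using inj_onD[OF chart_inj[OF c(1)]] by blast
  qed
  have "\<forall>\<^sub>F q in ?Fd. \<Phi> (fst q) (param c (?\<sigma> (snd q))) \<in> fst c \<inter> fst d"
    using filterlim_iff[THEN iffD1, OF C1_limit_tendsto_Pair[OF S], rule_format, OF f_in_d] by simp
  moreover have "\<forall>\<^sub>F z in nhds (snd d p). z \<in> snd d ` (fst d \<inter> fst c)"
    using c d chart_image_open chart_openin by (intro eventually_nhds_in_open) auto
  then have "\<forall>\<^sub>F q in ?Fd. snd q \<in> snd d ` (fst d \<inter> fst c)" by (rule eventually_prod_snd)
  then have eq: "\<forall>\<^sub>F q in ?Fd. param c (?\<sigma> (snd q)) = param d (snd q)"
    by eventually_elim (use c d in auto)
  ultimately have in_d: "\<forall>\<^sub>F q in ?Fd. \<Phi> (fst q) (param d (snd q)) \<in> fst c \<inter> fst d"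
    by eventually_elim simp
  have "C1_limit (\<lambda>n x. snd d (param c (f n (?\<sigma> x)))) (snd d p) (snd d p) (T o\<^sub>L (id_blinfun o\<^sub>L S))"
    by (rule C1_limit_compose[OF C1_limit_compose[OF S f] T])
  then have "C1_limit (\<lambda>n w. snd d (\<Phi> n (param d w))) (snd d p) (snd d p) (T o\<^sub>L (id_blinfun o\<^sub>L S))"
  proof (rule C1_limit_cong)
    show "\<forall>\<^sub>F q in ?Fd. snd d (param c (f (fst q) (?\<sigma> (snd q)))) = snd d (\<Phi> (fst q) (param d (snd q)))"
      using eq in_d by eventually_elim (simp add: f_def c)
  qed
  moreover have "T o\<^sub>L (id_blinfun o\<^sub>L S) = id_blinfun"
  proof -
    have "id_blinfun o\<^sub>L S = S" by (rule blinfun_eqI) simp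
    with TS show ?thesis by simp
  qed
  ultimately show ?thesis using in_d by (simp add: chart_limit_def eventually_conj_iff)
qed

lemma C1_to_id_const: "C1_to_id (\<lambda>n p. p)"
  unfolding C1_to_id_def chart_limit_def
proof (intro ballI conjI)
  fix c p assume c: "c \<in> A" "p \<in> fst c"
  have "\<forall>\<^sub>F z in nhds (snd c p). z \<in> snd c ` fst c"
    using c chart_open_image by (intro eventually_nhds_in_open) auto
  then have ev: "\<forall>\<^sub>F q in sequentially \<times>\<^sub>F nhds (snd c p). snd q \<in> snd c ` fst c"
    by (rule eventually_prod_snd)
  then show "\<forall>\<^sub>F q in sequentially \<times>\<^sub>F nhds (snd c p). param c (snd q) \<in> fst c"
    by eventually_elim (rule param_in)
  show "C1_limit (\<lambda>n w. snd c (param c w)) (snd c p) (snd c p) id_blinfun"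
    using C1_limit_id by (rule C1_limit_cong) (use ev in eventually_elim, simp)
qed

lemma chart_map_C1_to_id:
  assumes c: "c \<in> A" and K: "compact K" "K \<subseteq> snd c ` fst c" and small: "C1_small h"
    and smooth: "\<forall>\<^sub>F n in sequentially. smooth_on (h n) UNIV"
    and supp: "\<forall>\<^sub>F n in sequentially. supported_in K (\<lambda>x. x + h n x)"
  shows "C1_to_id (\<lambda>n. chart_map c (\<lambda>x. x + h n x))"
  unfolding C1_to_id_def
proof (intro ballI)
  fix d p assume d: "d \<in> A" "p \<in> fst d"
  show "chart_limit d (\<lambda>n w. chart_map c (\<lambda>x. x + h n x) (param d w)) (snd d p) p id_blinfun"
  proof (cases "p \<in> fst c")
    case True
    let ?F = "sequentially \<times>\<^sub>F nhds (snd c p)"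
    have "\<forall>\<^sub>F z in nhds (snd c p). z \<in> snd c ` fst c"
      using c True chart_open_image by (intro eventually_nhds_in_open) auto
    then have "\<forall>\<^sub>F q in ?F. snd q \<in> snd c ` fst c" by (rule eventually_prod_snd)
    moreover have "\<forall>\<^sub>F q in ?F. supported_in K (\<lambda>x. x + h (fst q) x)"
      using supp by (rule eventually_prod_fst)
    ultimately have ev: "\<forall>\<^sub>F q in ?F. snd q \<in> snd c ` fst c \<and> snd q + h (fst q) (snd q) \<in> snd c ` fst c"
      by eventually_elim (use supported_in_mem[OF _ K(2)] in blast)
    then have "\<forall>\<^sub>F q in ?F. chart_map c (\<lambda>x. x + h (fst q) x) (param c (snd q)) \<in> fst c"
      by eventually_elim (simp add: chart_map_def)
    moreover have "C1_limit (\<lambda>n w. snd c (chart_map c (\<lambda>x. x + h n x) (param c w))) (snd c p) (snd c p) id_blinfun"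
      using C1_limit_perturbed_identity[OF small smooth]
      by (rule C1_limit_cong) (use ev in eventually_elim, simp add: chart_map_def)
    ultimately show ?thesis
      by (intro chart_limit_id_change[OF c True d]) (simp add: chart_limit_def)
  next
    case False
    let ?F = "sequentially \<times>\<^sub>F nhds (snd d p)"
    have "closedin X (param c ` K)"
      using compactin_imp_closedin[OF _ compactin_param_image[OF c K]] manifold
      by (simp add: smooth_manifold_def)
    then have Kc: "openin X (topspace X - param c ` K)" by blast
    have "p \<notin> param c ` K" using False K(2) by (auto intro: param_in)
    then have "\<forall>\<^sub>F z in nhds (snd d p). z \<in> snd d ` (fst d \<inter> (topspace X - param c ` K))"
      using d chart_image_open[OF d(1) Kc] chart_subset[OF d(1)] by (intro eventually_nhds_in_open) auto
    then have "\<forall>\<^sub>F q in ?F. snd q \<in> snd d ` (fst d \<inter> (topspace X - param c ` K))"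
      by (rule eventually_prod_snd)
    moreover have "\<forall>\<^sub>F q in ?F. supported_in K (\<lambda>x. x + h (fst q) x)"
      using supp by (rule eventually_prod_fst)
    ultimately have ev: "\<forall>\<^sub>F q in ?F. param d (snd q) \<in> fst d \<and>
        chart_map c (\<lambda>x. x + h (fst q) x) (param d (snd q)) = param d (snd q) \<and> snd d (param d (snd q)) = snd q"
    proof eventually_elim
      case (elim q)
      then show ?case using chart_map_outside[OF c elim(2) K(2)] d by auto
    qed
    have "C1_limit (\<lambda>n w. snd d (chart_map c (\<lambda>x. x + h n x) (param d w))) (snd d p) (snd d p) id_blinfun"
      using C1_limit_id by (rule C1_limit_cong) (use ev in eventually_elim, simp)
    moreover from ev have "\<forall>\<^sub>F q in ?F. chart_map c (\<lambda>x. x + h (fst q) x) (param d (snd q)) \<in> fst d"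
      by eventually_elim simp
    ultimately show ?thesis by (simp add: chart_limit_def)
  qed
qed

text \<open>Smoothness is defined by means of some chart near each point; by the smoothness of the coordinate
  changes it can be read off in any given chart.\<close>

lemma smooth_map_on_chart:
  assumes c: "c \<in> A" and V: "open V" and u: "smooth_map_on A V u"
  shows "open {y \<in> V. u y \<in> fst c}" and "smooth_on (\<lambda>y. snd c (u y)) {y \<in> V. u y \<in> fst c}"
proof -
  have *: "\<exists>W. open W \<and> y \<in> W \<and> W \<subseteq> {y \<in> V. u y \<in> fst c} \<and> smooth_on (\<lambda>y. snd c (u y)) W"
    if y: "y \<in> V" "u y \<in> fst c" for y
  proof -
    obtain V' u' d where V': "d \<in> A" "open V'" "y \<in> V'" "u' ` V' \<subseteq> fst d" "smooth_on (snd d \<circ> u') V'"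
      and eq: "\<And>w. w \<in> V' \<inter> V \<Longrightarrow> u' w = u w" using u y(1) unfolding smooth_map_on_def by metis
    let ?T = "snd d ` (fst d \<inter> fst c)"
    define W where "W = (V' \<inter> V) \<inter> ((snd d \<circ> u') -` ?T)"
    have T: "open ?T" using c V'(1) chart_image_open chart_openin by blast
    have sm: "smooth_on (snd d \<circ> u') (V' \<inter> V)" using V'(5) by (rule smooth_on_subset) blast
    have W: "open W" unfolding W_def
      by (rule continuous_open_preimage[OF smooth_on_continuous[OF sm]]) (use V V'(2) T in auto)
    have sub: "u w \<in> fst c \<and> u w \<in> fst d \<and> u' w = u w \<and> w \<in> V" if "w \<in> W" for w
    proof -
      have w: "w \<in> V'" "w \<in> V" and "snd d (u' w) \<in> ?T" using that by (auto simp: W_def)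
      then obtain r where "r \<in> fst d" "r \<in> fst c" "snd d (u' w) = snd d r" by blast
      moreover have "u' w \<in> fst d" using w V'(4) by blast
      ultimately have "u' w \<in> fst c" using inj_onD[OF chart_inj[OF V'(1)]] by blast
      with w eq[of w] \<open>u' w \<in> fst d\<close> show ?thesis by simp
    qed
    have yW: "y \<in> W" using y V' eq[of y] by (auto simp: W_def)
    have "smooth_on (\<lambda>w. snd c (param d ((snd d \<circ> u') w))) W"
      by (rule smooth_on_compose[OF W T _ smooth_on_subset[OF sm] transition_smooth[OF V'(1) c]])
        (auto simp: W_def)
    then have "smooth_on (\<lambda>y. snd c (u y)) W"
      by (rule smooth_on_cong[OF W, rotated]) (use sub V'(1) in \<open>simp\<close>)
    then show ?thesis using W yW sub by blast
  qed
  show "open {y \<in> V. u y \<in> fst c}" using * by (subst open_subopen) blast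
  show "smooth_on (\<lambda>y. snd c (u y)) {y \<in> V. u y \<in> fst c}"
    by (rule smooth_on_local) (use * in blast)
qed

end

section \<open>Extending embeddings of a submanifold to diffeomorphisms\<close>

locale slice_mfd = smooth_mfd X A
  for X :: "'a topology" and A :: "('a, 'f::euclidean_space \<times> 'f) chart set"
begin

definition slice_inclusion :: "'f \<Rightarrow>\<^sub>L ('f \<times> 'f)" where
  "slice_inclusion = Blinfun (\<lambda>v. (v, 0))"

lemma slice_inclusion_apply: "blinfun_apply slice_inclusion = (\<lambda>v. (v, 0))"
  unfolding slice_inclusion_def
  by (intro bounded_linear_Blinfun_apply bounded_linear_Pair bounded_linear_ident bounded_linear_zero)

lemma slice_dom_open:
  assumes "slice_chart A L c"
  shows "open (slice_dom c)"
proof -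
  have "slice_dom c = (\<lambda>y. (y, 0)) -` (snd c ` fst c)" by (auto simp: slice_dom_def)
  moreover have "open (snd c ` fst c)" using assms chart_open_image by (simp add: slice_chart_def)
  ultimately show ?thesis by (auto intro!: open_vimage continuous_intros)
qed

lemma slice_param_mem:
  assumes "slice_chart A L c" "y \<in> slice_dom c"
  shows "slice_param c y \<in> fst c" "slice_param c y \<in> L" "snd c (slice_param c y) = (y, 0)"
proof -
  have c: "c \<in> A" and im: "snd c ` (fst c \<inter> L) = snd c ` fst c \<inter> (UNIV \<times> {0})"
    using assms(1) by (auto simp: slice_chart_def)
  have y: "(y, 0) \<in> snd c ` fst c" using assms(2) by (simp add: slice_dom_def)
  then have "(y, 0) \<in> snd c ` (fst c \<inter> L)" unfolding im by blast
  then obtain q where q: "q \<in> fst c" "q \<in> L" "(y, 0) = snd c q" by blast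
  then have "slice_param c y = q" using c by (simp add: slice_param_def)
  with q show "slice_param c y \<in> fst c" "slice_param c y \<in> L" "snd c (slice_param c y) = (y, 0)" by auto
qed

lemma slice_param_exhaust:
  assumes "slice_chart A L c" "p \<in> fst c" "p \<in> L"
  obtains y where "y \<in> slice_dom c" "p = slice_param c y" "snd c p = (y, 0)"
proof -
  have c: "c \<in> A" and im: "snd c ` (fst c \<inter> L) = snd c ` fst c \<inter> (UNIV \<times> {0})"
    using assms(1) by (auto simp: slice_chart_def)
  have "snd c p \<in> snd c ` (fst c \<inter> L)" using assms by blast
  then have "snd c p \<in> UNIV \<times> {0}" unfolding im by blast
  then obtain y where y: "snd c p = (y, 0)" by auto
  moreover have "p = slice_param c y" using param_chart[OF c assms(2)] y by (simp add: slice_param_def)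
  moreover have "y \<in> slice_dom c" using y assms(2) by (auto simp: slice_dom_def intro!: image_eqI[of _ _ p])
  ultimately show ?thesis using that by blast
qed

text \<open>A sequence of smooth maps \<open>L \<rightarrow> M\<close> that converges to the inclusion in \<open>C\<^sup>1\<close>. This class is stable under
  composition with diffeomorphisms that tend to the identity, hence under the steps of the construction.\<close>

definition C1_to_inclusion :: "'a set \<Rightarrow> (nat \<Rightarrow> 'a \<Rightarrow> 'a) \<Rightarrow> bool" where
  "C1_to_inclusion L G \<longleftrightarrow> (\<forall>\<^sub>F n in sequentially. \<forall>p\<in>L. G n p \<in> topspace X) \<and>
     (\<forall>c. slice_chart A L c \<longrightarrow>
        (\<forall>\<^sub>F n in sequentially. smooth_map_on A (slice_dom c) (\<lambda>y. G n (slice_param c y))) \<and>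
        (\<forall>y\<in>slice_dom c. chart_limit c (\<lambda>n y. G n (slice_param c y)) y (slice_param c y) slice_inclusion))"

lemma C1_to_inclusionD:
  assumes "C1_to_inclusion L G"
  shows "\<forall>\<^sub>F n in sequentially. \<forall>p\<in>L. G n p \<in> topspace X"
    and "\<And>c. slice_chart A L c \<Longrightarrow>
      \<forall>\<^sub>F n in sequentially. smooth_map_on A (slice_dom c) (\<lambda>y. G n (slice_param c y))"
    and "\<And>c y. slice_chart A L c \<Longrightarrow> y \<in> slice_dom c \<Longrightarrow>
      chart_limit c (\<lambda>n y. G n (slice_param c y)) y (slice_param c y) slice_inclusion"
  using assms unfolding C1_to_inclusion_def by blast+

lemma C1_to_inclusion_compose:
  assumes G: "C1_to_inclusion L G" and \<Psi>: "C1_to_id \<Psi>"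
    and diffeo: "\<forall>\<^sub>F n in sequentially. diffeos X A (\<Phi> n) (\<Psi> n)"
  shows "C1_to_inclusion L (\<lambda>n p. \<Psi> n (G n p))"
  unfolding C1_to_inclusion_def
proof (intro conjI allI impI ballI)
  show "\<forall>\<^sub>F n in sequentially. \<forall>p\<in>L. \<Psi> n (G n p) \<in> topspace X"
    using C1_to_inclusionD(1)[OF G] diffeo
    by eventually_elim (simp add: diffeosD)
next
  fix c assume c: "slice_chart A L c"
  from diffeo C1_to_inclusionD(2)[OF G c] show "\<forall>\<^sub>F n in sequentially. smooth_map_on A (slice_dom c) (\<lambda>y. \<Psi> n (G n (slice_param c y)))"
    by eventually_elim (rule smooth_map_on_diffeo[OF diffeos_sym])
next
  fix c y assume c: "slice_chart A L c" and y: "y \<in> slice_dom c"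
  show "chart_limit c (\<lambda>n y. \<Psi> n (G n (slice_param c y))) y (slice_param c y) slice_inclusion"
  proof (rule chart_limit_compose[OF _ slice_param_mem(1)[OF c y] _ \<Psi>])
    show "c \<in> A" using c by (simp add: slice_chart_def)
    show "chart_limit c (\<lambda>n y. G n (slice_param c y)) y (slice_param c y) slice_inclusion"
      using G c y by (rule C1_to_inclusionD(3))
  qed
qed

text \<open>A product neighbourhood of the point \<open>(y0, 0)\<close> of \<open>L\<close> in the image of a slice chart.\<close>

definition slice_box :: "'a set \<Rightarrow> ('a, 'f \<times> 'f) chart \<Rightarrow> 'f \<Rightarrow> real \<Rightarrow> bool" where
  "slice_box L c y0 r \<longleftrightarrow> slice_chart A L c \<and> 0 < r \<and> cball y0 r \<times> cball 0 r \<subseteq> snd c ` fst c"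

text \<open>The correction is a fixed smooth function \<open>T\<close> of the point \<open>q\<close> and of the value of \<open>g n\<close>. Hence it converges in
  \<open>C\<^sup>1\<close>, and its limit is the limit of the constant sequence of the correction for the inclusion, which is
  identically \<open>0\<close>.\<close>

lemma correction_limit:
  fixes \<rho> :: "'f \<times> 'f \<Rightarrow> real"
  assumes \<rho>: "smooth_on \<rho> UNIV" and g: "C1_limit g (fst q) (fst q, 0) slice_inclusion"
  shows "C1_limit (\<lambda>n q. \<rho> q *\<^sub>R (g n (fst q) - (fst q, 0))) q 0 0"
proof -
  define T where "T = (\<lambda>w :: ('f \<times> 'f) \<times> ('f \<times> 'f). \<rho> (fst w) *\<^sub>R (snd w - (fst (fst w), 0)))"
  have bl: "bounded_linear (\<lambda>w :: ('f \<times> 'f) \<times> ('f \<times> 'f). snd w - (fst (fst w), 0))"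
    by (intro bounded_linear_sub bounded_linear_Pair bounded_linear_zero bounded_linear_snd
        bounded_linear_fst_comp bounded_linear_fst)
  have "smooth_on T UNIV" unfolding T_def
    by (rule smooth_on_scaleR[OF open_UNIV smooth_on_compose[OF open_UNIV open_UNIV _
            smooth_on_linear[OF open_UNIV bounded_linear_fst] \<rho>] smooth_on_linear[OF open_UNIV bl]]) simp
  then obtain DT where DT: "C1_limit (\<lambda>n. T) (q, (fst q, 0)) (T (q, (fst q, 0))) DT"
  proof -
    have "(T has_derivative frechet_derivative T (at (q, (fst q, 0)))) (at (q, (fst q, 0)))"
      using smooth_on_has_derivative[OF \<open>smooth_on T UNIV\<close>] by blast
    then have "(T has_derivative blinfun_apply (Blinfun (frechet_derivative T (at (q, (fst q, 0))))))
        (at (q, (fst q, 0)))"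
      by (subst bounded_linear_Blinfun_apply[OF has_derivative_bounded_linear])
    from C1_limit_smooth[OF \<open>smooth_on T UNIV\<close> open_UNIV UNIV_I this] that show ?thesis by blast
  qed
  have T0: "T (q, (fst q, 0)) = 0" for q by (simp add: T_def)
  define \<pi> where "\<pi> = (Blinfun fst :: ('f \<times> 'f) \<Rightarrow>\<^sub>L 'f)"
  have \<pi>: "C1_limit (\<lambda>n. fst) q (fst q) \<pi>"
    unfolding \<pi>_def
    by (rule C1_limit_smooth[OF smooth_on_linear[OF open_UNIV bounded_linear_fst] open_UNIV UNIV_I])
      (simp add: bounded_linear_Blinfun_apply bounded_linear_fst bounded_linear_imp_has_derivative)
  have incl: "C1_limit (\<lambda>n y. (y, 0 :: 'f)) (fst q) (fst q, 0) slice_inclusion"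
  proof (rule C1_limit_smooth[OF _ open_UNIV UNIV_I])
    have "bounded_linear (\<lambda>y :: 'f. (y, 0 :: 'f))"
      by (intro bounded_linear_Pair bounded_linear_ident bounded_linear_zero)
    then show "smooth_on (\<lambda>y :: 'f. (y, 0 :: 'f)) UNIV"
      "((\<lambda>y :: 'f. (y, 0 :: 'f)) has_derivative blinfun_apply slice_inclusion) (at (fst q))"
      by (auto simp: smooth_on_linear slice_inclusion_apply intro: bounded_linear_imp_has_derivative)
  qed
  note lim = C1_limit_compose[OF C1_limit_Pair[OF C1_limit_id C1_limit_compose[OF \<pi>]] DT, unfolded T0]
  from lim[OF g] lim[OF incl]
  obtain D where D: "C1_limit (\<lambda>n q. T (q, g n (fst q))) q 0 D" "C1_limit (\<lambda>n q :: 'f \<times> 'f. 0 :: 'f \<times> 'f) q 0 D"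
    unfolding T0 by blast
  have "C1_limit (\<lambda>n q :: 'f \<times> 'f. 0 :: 'f \<times> 'f) q 0 0"
    by (rule C1_limit_smooth[OF smooth_on_const[OF open_UNIV] open_UNIV UNIV_I]) (simp add: zero_blinfun.rep_eq)
  with D(2) have "D = 0" by (rule C1_limit_unique)
  with D(1) show ?thesis by (simp add: T_def)
qed

text \<open>The correction, cut off in the box. It agrees with \<open>g n - inclusion\<close> on the points \<open>(y, 0)\<close> of the
  smaller box, where the cutoff function is \<open>1\<close>, and it is small because \<open>g n\<close> is close to the inclusion.\<close>

lemma cutoff_correction:
  fixes g :: "nat \<Rightarrow> 'f \<Rightarrow> 'f \<times> 'f" and y0 :: 'f
  assumes r: "r > 0" and V: "cball y0 r \<subseteq> V"
    and lim: "\<And>y. y \<in> V \<Longrightarrow> C1_limit g y (y, 0) slice_inclusion"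
    and smooth: "\<forall>\<^sub>F n in sequentially. \<exists>W. open W \<and> cball y0 r \<subseteq> W \<and> smooth_on (g n) W"
  obtains h :: "nat \<Rightarrow> 'f \<times> 'f \<Rightarrow> 'f \<times> 'f" where "C1_small h"
    "\<forall>\<^sub>F n in sequentially. smooth_on (h n) UNIV"
    "\<And>n q. q \<notin> cball y0 r \<times> cball 0 r \<Longrightarrow> h n q = 0"
    "\<And>n y. y \<in> cball y0 (r / 2) \<Longrightarrow> (y, 0) + h n (y, 0) = g n y"
    "\<And>n y. g n y = (y, 0) \<Longrightarrow> h n (y, 0) = 0"
proof -
  obtain \<beta> :: "'f \<Rightarrow> real" where \<beta>: "smooth_on \<beta> UNIV"
    "\<And>x. norm x \<le> r / 2 \<Longrightarrow> \<beta> x = 1" "\<And>x. 3 / 4 * r \<le> norm x \<Longrightarrow> \<beta> x = 0"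
    using smooth_bump[of "r / 2" "3 / 4 * r"] r by auto
  define \<rho> where "\<rho> = (\<lambda>q :: 'f \<times> 'f. \<beta> (fst q - y0) * \<beta> (snd q))"
  have "smooth_on (\<lambda>q :: 'f \<times> 'f. fst q - y0) UNIV"
    by (intro smooth_on_diff smooth_on_linear smooth_on_const bounded_linear_fst open_UNIV)
  from smooth_on_compose[OF open_UNIV open_UNIV _ this \<beta>(1)]
  have 1: "smooth_on (\<lambda>q :: 'f \<times> 'f. \<beta> (fst q - y0)) UNIV" by simp
  from smooth_on_compose[OF open_UNIV open_UNIV _ smooth_on_linear[OF open_UNIV bounded_linear_snd] \<beta>(1)]
  have 2: "smooth_on (\<lambda>q :: 'f \<times> 'f. \<beta> (snd q)) UNIV" by simp
  have \<rho>: "smooth_on \<rho> UNIV" unfolding \<rho>_def by (rule smooth_on_mult[OF open_UNIV 1 2])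
  define h where "h = (\<lambda>n (q :: 'f \<times> 'f). \<rho> q *\<^sub>R (g n (fst q) - (fst q, 0)))"
  let ?K = "cball y0 r \<times> cball (0 :: 'f) r"
  (* The correction vanishes off the box K', which lies in the interior of K. So it vanishes near every
     point outside K, where g n need not be smooth. *)
  let ?K' = "cball y0 (3 / 4 * r) \<times> cball (0 :: 'f) (3 / 4 * r)"
  have zero: "h n q = 0" if "q \<notin> ?K'" for n q
    using that \<beta>(3)[of "fst q - y0"] \<beta>(3)[of "snd q"]
    by (cases q) (auto simp: h_def \<rho>_def mem_Times_iff dist_norm norm_minus_commute not_le)
  have sub: "?K' \<subseteq> ?K" using r by (auto intro: order_trans)
  have openK': "open (- ?K')" by (simp add: closed_Times open_Compl)
  have smooth_h: "\<forall>\<^sub>F n in sequentially. smooth_on (h n) UNIV"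
    using smooth
  proof eventually_elim
    case (elim n)
    then obtain W where W: "open W" "cball y0 r \<subseteq> W" "smooth_on (g n) W" by blast
    show "smooth_on (h n) UNIV"
    proof (rule smooth_on_local)
      fix q :: "'f \<times> 'f"
      show "\<exists>N. open N \<and> q \<in> N \<and> smooth_on (h n) N"
      proof (cases "q \<in> ?K'")
        case True
        let ?N = "W \<times> (UNIV :: 'f set)"
        have N: "open ?N" using W(1) by (simp add: open_Times)
        have gN: "smooth_on (\<lambda>q :: 'f \<times> 'f. g n (fst q)) ?N"
          by (rule smooth_on_compose[OF N W(1) _ smooth_on_linear[OF N bounded_linear_fst] W(3)]) auto
        have bl: "bounded_linear (\<lambda>q :: 'f \<times> 'f. (fst q, 0 :: 'f))"
          by (intro bounded_linear_Pair bounded_linear_fst bounded_linear_zero)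
        have "smooth_on (h n) ?N" unfolding h_def
          by (rule smooth_on_scaleR[OF N smooth_on_subset[OF \<rho> subset_UNIV]
                smooth_on_diff[OF N gN smooth_on_linear[OF N bl]]])
        moreover have "fst q \<in> cball y0 r" using subsetD[OF sub True] by (simp only: mem_Times_iff)
        then have "q \<in> ?N" using W(2) by (auto simp: mem_Times_iff)
        ultimately show ?thesis using N by blast
      next
        case False
        have "smooth_on (h n) (- ?K')"
          by (rule smooth_on_cong[OF openK' _ smooth_on_const[OF openK']]) (use zero in auto)
        with False openK' show ?thesis by blast
      qed
    qed
  qed
  have small: "C1_small h"
    unfolding C1_small_def
  proof (intro allI impI)
    fix e :: real assume e: "e > 0"
    have "compact ?K" by (intro compact_Times compact_cball)
    then have "\<forall>\<^sub>F n in sequentially. \<forall>q\<in>?K. norm (h (fst (n, q)) (snd (n, q))) \<le> e \<and>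
        (\<exists>D. (h (fst (n, q)) has_derivative D) (at (snd (n, q))) \<and> onorm D \<le> e)"
    proof (rule eventually_compact_uniform)
      fix q assume "q \<in> ?K"
      then have "fst q \<in> V" using V by auto
      then have "C1_limit h q 0 0" unfolding h_def by (intro correction_limit \<rho> lim)
      then show "\<forall>\<^sub>F p in sequentially \<times>\<^sub>F nhds q. norm (h (fst p) (snd p)) \<le> e \<and>
          (\<exists>D. (h (fst p) has_derivative D) (at (snd p)) \<and> onorm D \<le> e)"
        using e by (rule C1_limit_bound)
    qed
    then show "\<forall>\<^sub>F n in sequentially. (\<forall>x. norm (h n x) \<le> e) \<and>
        (\<forall>x y. norm (h n x - h n y) \<le> e * norm (x - y))"
    proof eventually_elim
      case (elim n)
      have "\<exists>D. (h n has_derivative D) (at q) \<and> onorm D \<le> e" for q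
      proof (cases "q \<in> ?K")
        case True
        then show ?thesis using elim by fastforce
      next
        case False
        then have q: "q \<in> - ?K'" using sub by blast
        have "((\<lambda>q. 0) has_derivative (\<lambda>v. 0)) (at q)" by simp
        then have "(h n has_derivative (\<lambda>v. 0)) (at q)"
          by (rule has_derivative_transform_within_open[OF _ openK' q]) (use zero in auto)
        moreover have "onorm (\<lambda>v :: 'f \<times> 'f. 0 :: 'f \<times> 'f) \<le> e" using e by (simp add: onorm_zero)
        ultimately show ?thesis by blast
      qed
      then obtain D where D: "\<And>q. (h n has_derivative D q) (at q)" "\<And>q. onorm (D q) \<le> e" by metis
      have "norm (h n x - h n y) \<le> e * norm (x - y)" for x y
        by (rule differentiable_bound[OF convex_UNIV _ D(2)]) (use D(1) in auto)
      moreover have "norm (h n q) \<le> e" for q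
      proof (cases "q \<in> ?K")
        case True
        from bspec[OF elim this] show ?thesis by (simp only: fst_conv snd_conv)
      next
        case False
        then have "q \<notin> ?K'" using sub by blast
        with zero[OF this] e show ?thesis by simp
      qed
      ultimately show ?case by blast
    qed
  qed
  have "h n q = 0" if "q \<notin> ?K" for n q using zero[of q n] sub that by blast
  moreover have "(y, 0) + h n (y, 0) = g n y" if "y \<in> cball y0 (r / 2)" for n y
    using that \<beta>(2)[of "y - y0"] \<beta>(2)[of 0] r
    by (simp add: h_def \<rho>_def dist_norm norm_minus_commute)
  moreover have "h n (y, 0) = 0" if "g n y = (y, 0)" for n y
    using that by (simp add: h_def)
  ultimately show ?thesis using that[OF small smooth_h] by blast
qed

text \<open>One step of the construction. The new maps \<open>\<psi> n \<circ> G n\<close> are the inclusion on the core of the box,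
  and they remain the inclusion wherever \<open>G n\<close> was: there the correction is \<open>0\<close>. So finitely many
  steps, one for each box of a cover, turn \<open>G n\<close> into the inclusion without any shrinking of the
  boxes.\<close>

lemma straighten_in_box:
  assumes L: "L \<subseteq> topspace X" and box: "slice_box L c y0 r" and G: "C1_to_inclusion L G"
  obtains \<phi> \<psi> C where "\<forall>\<^sub>F n in sequentially. diffeos X A (\<phi> n) (\<psi> n)" "compactin X C"
    "\<forall>\<^sub>F n in sequentially. \<forall>p. p \<notin> C \<longrightarrow> \<phi> n p = p" "C1_to_id \<phi>" "C1_to_id \<psi>"
    "\<forall>\<^sub>F n in sequentially. \<forall>p\<in>L. G n p = p \<or> p \<in> fst c \<and> fst (snd c p) \<in> cball y0 (r / 2)
       \<longrightarrow> \<psi> n (G n p) = p"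
proof -
  have sc: "slice_chart A L c" and r: "r > 0" and sub: "cball y0 r \<times> cball 0 r \<subseteq> snd c ` fst c"
    using box by (auto simp: slice_box_def)
  have c: "c \<in> A" using sc by (simp add: slice_chart_def)
  let ?V = "slice_dom c" and ?B = "cball y0 r"
  have V: "open ?V" using sc by (rule slice_dom_open)
  have BV: "?B \<subseteq> ?V"
  proof
    fix y assume "y \<in> ?B"
    then have "(y, 0) \<in> ?B \<times> cball 0 r" using r by simp
    then show "y \<in> ?V" using sub by (auto simp: slice_dom_def)
  qed
  define g where "g = (\<lambda>n y. snd c (G n (slice_param c y)))"
  note lim = C1_to_inclusionD(3)[OF G sc]
  have lim_g: "C1_limit g y (y, 0) slice_inclusion" if "y \<in> ?V" for y
    using lim[OF that] slice_param_mem(3)[OF sc that] by (simp add: chart_limit_def g_def)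
  have "\<forall>\<^sub>F n in sequentially. \<forall>y\<in>?B. G (fst (n, y)) (slice_param c (snd (n, y))) \<in> fst c"
    by (rule eventually_compact_uniform[OF compact_cball]) (use lim BV in \<open>auto simp: chart_limit_def\<close>)
  then have in_c: "\<forall>\<^sub>F n in sequentially. \<forall>y\<in>?B. G n (slice_param c y) \<in> fst c" by simp
  have smooth_g: "\<forall>\<^sub>F n in sequentially. \<exists>W. open W \<and> ?B \<subseteq> W \<and> smooth_on (g n) W"
    using in_c C1_to_inclusionD(2)[OF G sc]
  proof eventually_elim
    case (elim n)
    show ?case unfolding g_def
      using smooth_map_on_chart[OF c V elim(2)] elim(1) BV
      by (intro exI[of _ "{y \<in> ?V. G n (slice_param c y) \<in> fst c}"]) auto
  qed
  obtain h where small: "C1_small h" and smooth_h: "\<forall>\<^sub>F n in sequentially. smooth_on (h n) UNIV"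
    and out: "\<And>n q. q \<notin> ?B \<times> cball 0 r \<Longrightarrow> h n q = 0"
    and core: "\<And>n y. y \<in> cball y0 (r / 2) \<Longrightarrow> (y, 0) + h n (y, 0) = g n y"
    and fix0: "\<And>n y. g n y = (y, 0) \<Longrightarrow> h n (y, 0) = 0"
    using cutoff_correction[OF r BV lim_g smooth_g] by blast
  (* The inverse k n of id + h n exists for large n, when h n is a contraction with constant 1/2. *)
  define P where "P = (\<lambda>n k. smooth_on k UNIV \<and> (\<forall>x. k (x + h n x) = x) \<and> (\<forall>y. k y + h n (k y) = y))"
  define k where "k = (\<lambda>n. SOME k. P n k)"
  have "\<forall>\<^sub>F n in sequentially. \<forall>x y. norm (h n x - h n y) \<le> 1 / 2 * norm (x - y)"
    using small[unfolded C1_small_def, rule_format, of "1 / 2"] by (auto elim: eventually_mono)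
  with smooth_h have Pk: "\<forall>\<^sub>F n in sequentially. P n (k n)"
  proof eventually_elim
    case (elim n)
    obtain k' where "P n k'"
    proof (rule perturbed_identity_diffeo[OF elim(1)])
      show "norm (h n x - h n y) \<le> 1 / 2 * norm (x - y)" for x y using elim(2) by blast
    next
      fix k' assume "smooth_on k' UNIV" "\<And>x. k' (x + h n x) = x" "\<And>y. k' y + h n (k' y) = y"
      then have "P n k'" unfolding P_def by blast
      then show thesis by (rule that)
    qed
    then show ?case unfolding k_def using someI[of "P n" k'] by simp
  qed
  let ?K = "?B \<times> cball (0 :: 'f) r"
  have K: "compact ?K" by (intro compact_Times compact_cball)
  have supp: "\<forall>\<^sub>F n in sequentially. supported_in ?K (\<lambda>x. x + h n x)"
    using Pk
  proof eventually_elim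
    case (elim n)
    then have "k n (x + h n x) = x" for x by (simp only: P_def)
    then have "inj (\<lambda>x. x + h n x)" by (rule inj_on_inverseI)
    moreover have "x + h n x = x" if "x \<notin> ?K" for x using out[OF that, of n] by simp
    ultimately show ?case unfolding supported_in_def by blast
  qed
  define h' where "h' = (\<lambda>n y. k n y - y)"
  have small': "C1_small h'"
    unfolding h'_def by (rule C1_small_inverse[OF small]) (use Pk in eventually_elim, simp add: P_def)
  have smooth': "\<forall>\<^sub>F n in sequentially. smooth_on (h' n) UNIV"
    using Pk unfolding h'_def
  proof eventually_elim
    case (elim n)
    then have "smooth_on (k n) UNIV" by (simp only: P_def)
    then show ?case
      by (rule smooth_on_diff[OF open_UNIV _ smooth_on_linear[OF open_UNIV bounded_linear_ident]])
  qed
  have supp': "\<forall>\<^sub>F n in sequentially. supported_in ?K (\<lambda>x. x + h' n x)"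
    using Pk
  proof eventually_elim
    case (elim n)
    then have inv: "k n (x + h n x) = x" "k n x + h n (k n x) = x" for x by (simp_all only: P_def)
    from inv(2) have "inj (k n)" by (rule inj_on_inverseI)
    moreover have "k n q = q" if "q \<notin> ?K" for q
      using inv(1)[of q] out[OF that, of n] by simp
    ultimately show ?case unfolding supported_in_def h'_def by simp
  qed
  define \<phi> where "\<phi> = (\<lambda>n. chart_map c (\<lambda>x. x + h n x))"
  define \<psi> where "\<psi> = (\<lambda>n. chart_map c (\<lambda>x. x + h' n x))"
  have k: "(\<lambda>x. x + h' n x) = k n" for n by (simp add: h'_def)
  have diffeo: "\<forall>\<^sub>F n in sequentially. diffeos X A (\<phi> n) (\<psi> n)"
    using Pk supp smooth_h
  proof eventually_elim
    case (elim n)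
    have "smooth_on (\<lambda>x. x + h n x) UNIV"
      by (rule smooth_on_add[OF open_UNIV smooth_on_linear[OF open_UNIV bounded_linear_ident] elim(3)])
    then show ?case unfolding \<phi>_def \<psi>_def k
      by (rule chart_map_diffeos[OF c _ elim(2) K sub]) (use elim(1) in \<open>auto simp: P_def\<close>)
  qed
  have id\<phi>: "C1_to_id \<phi>" unfolding \<phi>_def by (rule chart_map_C1_to_id[OF c K sub small smooth_h supp])
  have id\<psi>: "C1_to_id \<psi>" unfolding \<psi>_def by (rule chart_map_C1_to_id[OF c K sub small' smooth' supp'])
  have outside: "\<forall>\<^sub>F n in sequentially. \<forall>p. p \<notin> param c ` ?K \<longrightarrow> \<phi> n p = p"
    using supp unfolding \<phi>_def by eventually_elim (use chart_map_outside[OF c _ sub] in blast)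
  have "\<forall>\<^sub>F n in sequentially. \<forall>p\<in>L. G n p = p \<or> p \<in> fst c \<and> fst (snd c p) \<in> cball y0 (r / 2)
       \<longrightarrow> \<psi> n (G n p) = p"
    using diffeo in_c
  proof eventually_elim
    case (elim n)
    show ?case
    proof (intro ballI impI)
      fix p assume p: "p \<in> L" "G n p = p \<or> p \<in> fst c \<and> fst (snd c p) \<in> cball y0 (r / 2)"
      (* It suffices that the diffeomorphism takes p to G n p: then its inverse takes G n p back to p. *)
      have "\<phi> n p = G n p"
      proof (cases "p \<in> fst c")
        case False
        then show ?thesis using p by (simp add: \<phi>_def chart_map_def)
      next
        case True
        then obtain y where y: "y \<in> ?V" "p = slice_param c y" "snd c p = (y, 0)"
          using slice_param_exhaust[OF sc True p(1)] by blast
        have gy: "g n y = snd c (G n p)" using y by (simp add: g_def)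
        have "snd c p + h n (snd c p) = snd c (G n p) \<and> G n p \<in> fst c"
        proof (cases "G n p = p")
          case True
          then have "h n (y, 0) = 0" using y gy by (intro fix0) simp
          then show ?thesis using True \<open>p \<in> fst c\<close> y(3) by simp
        next
          case False
          then have "y \<in> cball y0 (r / 2)" using p(2) y(3) by simp
          moreover from this have "y \<in> ?B" using r by simp
          ultimately show ?thesis using core[of y n] gy elim(2) y by auto
        qed
        then show ?thesis using True c by (simp add: \<phi>_def chart_map_def)
      qed
      then show "\<psi> n (G n p) = p"
        using diffeosD(3)[OF elim(1), of p] p(1) L by auto
    qed
  qed
  then show ?thesis
    using that[OF diffeo compactin_param_image[OF c K sub] outside id\<phi> id\<psi>] by blast
qed

lemma slice_box_exists:
  assumes "slice_chart A L c" "p \<in> fst c" "p \<in> L"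
  obtains y0 r where "slice_box L c y0 r" "fst (snd c p) = y0"
proof -
  obtain y0 where y0: "snd c p = (y0, 0)" using slice_param_exhaust[OF assms] by metis
  have "open (snd c ` fst c)" using assms(1) chart_open_image by (simp add: slice_chart_def)
  moreover have "(y0, 0) \<in> snd c ` fst c" using assms(2) y0 by (metis imageI)
  ultimately obtain s where s: "s > 0" "cball (y0, 0) s \<subseteq> snd c ` fst c"
    using open_contains_cball by blast
  have "cball y0 (s / 2) \<times> cball (0 :: 'f) (s / 2) \<subseteq> cball (y0, 0) s"
  proof
    fix q :: "'f \<times> 'f" assume "q \<in> cball y0 (s / 2) \<times> cball 0 (s / 2)"
    then have "dist y0 (fst q) + dist 0 (snd q) \<le> s" by (auto simp: mem_Times_iff)
    moreover have "dist (y0, 0) q \<le> dist y0 (fst q) + dist 0 (snd q)"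
      by (cases q) (auto simp: dist_prod_def intro!: sqrt_sum_squares_le_sum)
    ultimately show "q \<in> cball (y0, 0) s" by simp
  qed
  with s have "slice_box L c y0 (s / 2)" using assms(1) by (simp add: slice_box_def)
  then show ?thesis using that y0 by simp
qed

definition box_core :: "'a set \<Rightarrow> 'a set \<Rightarrow> bool" where
  "box_core L N \<longleftrightarrow> (\<exists>c y0 r. slice_box L c y0 r \<and> N = {p \<in> fst c. snd c p \<in> ball y0 (r / 2) \<times> UNIV})"

lemma box_coreE:
  assumes "box_core L N"
  obtains c y0 r where "slice_box L c y0 r" "N = {p \<in> fst c. snd c p \<in> ball y0 (r / 2) \<times> UNIV}"
  using assms unfolding box_core_def by (elim exE conjE) (rule that)

text \<open>Induction on the number of boxes outside which \<open>G n\<close> is the inclusion. Straightening in one box by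
  \<open>\<phi> n\<close> leaves the maps \<open>\<psi> n \<circ> G n\<close> with one box less, and an extension \<open>\<phi>' n\<close> of these gives the
  extension \<open>\<phi> n \<circ> \<phi>' n\<close> of \<open>G n\<close>.\<close>

lemma extend_by_straightening:
  assumes L: "L \<subseteq> topspace X" and "finite \<F>" "\<And>N. N \<in> \<F> \<Longrightarrow> box_core L N"
    and "C1_to_inclusion L G" "\<forall>\<^sub>F n in sequentially. \<forall>p\<in>L - \<Union>\<F>. G n p = p"
  shows "\<exists>\<phi> \<psi> C. (\<forall>\<^sub>F n in sequentially. diffeos X A (\<phi> n) (\<psi> n)) \<and> compactin X C \<and>
    (\<forall>\<^sub>F n in sequentially. \<forall>p. p \<notin> C \<longrightarrow> \<phi> n p = p) \<and> C1_to_id \<phi> \<and>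
    (\<forall>\<^sub>F n in sequentially. \<forall>p\<in>L. \<phi> n p = G n p)"
  using assms(2-)
proof (induction \<F> arbitrary: G rule: finite_induct)
  case empty
  have "diffeos X A (\<lambda>p. p) (\<lambda>p. p)" by (rule diffeos_id[OF chart_subset])
  moreover have "\<forall>\<^sub>F n in sequentially. \<forall>p\<in>L. p = G n p"
    using empty(3) by eventually_elim auto
  ultimately show ?case
    by (intro exI[of _ "\<lambda>n p. p"] exI[of _ "{}"]) (simp add: C1_to_id_const)
next
  case (insert N \<F>)
  obtain c y0 r where box: "slice_box L c y0 r" and N: "N = {p \<in> fst c. snd c p \<in> ball y0 (r / 2) \<times> UNIV}"
    using box_coreE[OF insert.prems(1)[OF insertI1]] .
  obtain \<phi> \<psi> C where 1: "\<forall>\<^sub>F n in sequentially. diffeos X A (\<phi> n) (\<psi> n)" "compactin X C"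
    "\<forall>\<^sub>F n in sequentially. \<forall>p. p \<notin> C \<longrightarrow> \<phi> n p = p" "C1_to_id \<phi>" "C1_to_id \<psi>"
    "\<forall>\<^sub>F n in sequentially. \<forall>p\<in>L. G n p = p \<or> p \<in> fst c \<and> fst (snd c p) \<in> cball y0 (r / 2)
       \<longrightarrow> \<psi> n (G n p) = p"
    using straighten_in_box[OF L box insert.prems(2)] by blast
  have H: "C1_to_inclusion L (\<lambda>n p. \<psi> n (G n p))"
    using insert.prems(2) 1(5,1) by (rule C1_to_inclusion_compose)
  have "\<forall>\<^sub>F n in sequentially. \<forall>p\<in>L - \<Union>\<F>. \<psi> n (G n p) = p"
    using 1(6) insert.prems(3)
  proof eventually_elim
    case (elim n)
    show ?case
    proof
      fix p assume p: "p \<in> L - \<Union>\<F>"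
      show "\<psi> n (G n p) = p"
      proof (cases "p \<in> N")
        case True
        then have "p \<in> fst c \<and> fst (snd c p) \<in> cball y0 (r / 2)"
          by (auto simp: N mem_Times_iff)
        with elim(1) p show ?thesis by blast
      next
        case False
        with elim(2) p have "G n p = p" by blast
        with elim(1) p show ?thesis by blast
      qed
    qed
  qed
  from insert.IH[OF insert.prems(1)[OF insertI2] H this] obtain \<phi>' \<psi>' C' where
    2: "\<forall>\<^sub>F n in sequentially. diffeos X A (\<phi>' n) (\<psi>' n)" "compactin X C'"
    "\<forall>\<^sub>F n in sequentially. \<forall>p. p \<notin> C' \<longrightarrow> \<phi>' n p = p" "C1_to_id \<phi>'"
    "\<forall>\<^sub>F n in sequentially. \<forall>p\<in>L. \<phi>' n p = \<psi> n (G n p)" by blast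
  have "\<forall>\<^sub>F n in sequentially. diffeos X A (\<lambda>p. \<phi> n (\<phi>' n p)) (\<lambda>p. \<psi>' n (\<psi> n p))"
    using 1(1) 2(1) by eventually_elim (rule diffeos_compose)
  moreover have "compactin X (C \<union> C')" using 1(2) 2(2) by (rule compactin_Un)
  moreover have "\<forall>\<^sub>F n in sequentially. \<forall>p. p \<notin> C \<union> C' \<longrightarrow> \<phi> n (\<phi>' n p) = p"
    using 1(3) 2(3) by eventually_elim simp
  moreover have "C1_to_id (\<lambda>n p. \<phi> n (\<phi>' n p))" using 2(4) 1(4) by (rule C1_to_id_compose)
  moreover have "\<forall>\<^sub>F n in sequentially. \<forall>p\<in>L. \<phi> n (\<phi>' n p) = G n p"
    using 1(1) 2(5) C1_to_inclusionD(1)[OF insert.prems(2)]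
  proof eventually_elim
    case (elim n)
    then show ?case using diffeosD(4)[OF elim(1)] by auto
  qed
  ultimately show ?case
    by (intro exI[of _ "\<lambda>n p. \<phi> n (\<phi>' n p)"] exI[of _ "\<lambda>n p. \<psi>' n (\<psi> n p)"] exI[of _ "C \<union> C'"] conjI)
qed

theorem extend_to_diffeos:
  assumes L: "compactin X L" and slice: "\<And>p. p \<in> L \<Longrightarrow> \<exists>c. slice_chart A L c \<and> p \<in> fst c"
    and G: "C1_to_inclusion L G"
  obtains \<phi> \<psi> C where "\<forall>\<^sub>F n in sequentially. diffeos X A (\<phi> n) (\<psi> n)" "compactin X C"
    "\<forall>\<^sub>F n in sequentially. \<forall>p. p \<notin> C \<longrightarrow> \<phi> n p = p" "C1_to_id \<phi>"
    "\<forall>\<^sub>F n in sequentially. \<forall>p\<in>L. \<phi> n p = G n p"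
proof -
  have "openin X N" if core: "box_core L N" for N
  proof -
    obtain c y0 r where c: "slice_box L c y0 r" and N: "N = {p \<in> fst c. snd c p \<in> ball y0 (r / 2) \<times> UNIV}"
      using box_coreE[OF core] .
    show ?thesis unfolding N
      by (rule chart_preimage_openin) (use c in \<open>auto simp: slice_box_def slice_chart_def open_Times\<close>)
  qed
  moreover have "L \<subseteq> \<Union>(Collect (box_core L))"
  proof
    fix p assume p: "p \<in> L"
    from slice[OF p] obtain c where c: "slice_chart A L c" "p \<in> fst c" by blast
    obtain y0 r where box: "slice_box L c y0 r" "fst (snd c p) = y0"
      using slice_box_exists[OF c p] .
    let ?N = "{p \<in> fst c. snd c p \<in> ball y0 (r / 2) \<times> UNIV}"
    have "p \<in> ?N" using c(2) box by (auto simp: slice_box_def mem_Times_iff)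
    moreover have "box_core L ?N" unfolding box_core_def
      using box(1) by (intro exI[of _ c] exI[of _ y0] exI[of _ r] conjI refl)
    ultimately show "p \<in> \<Union>(Collect (box_core L))" by (intro UnionI[of ?N]) auto
  qed
  ultimately have "\<exists>\<F>. finite \<F> \<and> \<F> \<subseteq> Collect (box_core L) \<and> L \<subseteq> \<Union>\<F>"
    by (intro compactinD[OF L]) (simp_all only: mem_Collect_eq)
  then obtain \<F> where \<F>: "finite \<F>" "\<F> \<subseteq> Collect (box_core L)" "L \<subseteq> \<Union>\<F>"
    by (elim exE conjE)
  have "\<forall>\<^sub>F n in sequentially. \<forall>p\<in>L - \<Union>\<F>. G n p = p"
    using \<F>(3) by (intro always_eventually) blast
  moreover have "box_core L N" if "N \<in> \<F>" for N using subsetD[OF \<F>(2) that] by (rule CollectD)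
  ultimately obtain \<phi> \<psi> C where "\<forall>\<^sub>F n in sequentially. diffeos X A (\<phi> n) (\<psi> n)" "compactin X C"
    "\<forall>\<^sub>F n in sequentially. \<forall>p. p \<notin> C \<longrightarrow> \<phi> n p = p" "C1_to_id \<phi>"
    "\<forall>\<^sub>F n in sequentially. \<forall>p\<in>L. \<phi> n p = G n p"
    using extend_by_straightening[OF compactin_subset_topspace[OF L] \<F>(1) _ G] by blast
  then show ?thesis by (rule that)
qed

text \<open>Uniform convergence on a ball around the given point, together with the continuity of the limit, is
  convergence in the product filter; it is applied to the values and to the first derivatives.\<close>

lemma embeddings_C1_to_inclusion:
  assumes L: "L \<subseteq> topspace X"
    and F: "\<forall>\<^sub>F n in sequentially. smooth_embedding X A L (F n)"
    and conv: "smooth_convergence A L F (\<lambda>p. p)"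
  shows "C1_to_inclusion L F"
proof -
  have smooth: "\<forall>\<^sub>F n in sequentially. smooth_map_on A (slice_dom c) (\<lambda>y. F n (slice_param c y))"
    if "slice_chart A L c" for c
    using F
  proof eventually_elim
    case (elim n)
    with that have "smooth_map_on A (slice_dom c) (F n \<circ> slice_param c)"
      unfolding smooth_embedding_def by blast
    then show ?case by (simp only: o_def)
  qed
  show ?thesis
  unfolding C1_to_inclusion_def
proof (intro conjI allI impI ballI)
  show "\<forall>\<^sub>F n in sequentially. \<forall>p\<in>L. F n p \<in> topspace X"
    using F
  proof eventually_elim
    case (elim n)
    then have "homeomorphic_map (subtopology X L) (subtopology X (F n ` topspace (subtopology X L))) (F n)"
      unfolding smooth_embedding_def embedding_map_def by (elim conjE)
    then have "continuous_map (subtopology X L) X (F n)"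
      using homeomorphic_imp_continuous_map continuous_map_in_subtopology by blast
    then show ?case using L by (auto simp: continuous_map_def)
  qed
next
  fix c assume "slice_chart A L c"
  then show "\<forall>\<^sub>F n in sequentially. smooth_map_on A (slice_dom c) (\<lambda>y. F n (slice_param c y))"
    by (rule smooth)
next
  fix c y assume sc: "slice_chart A L c" and y: "y \<in> slice_dom c"
  have c: "c \<in> A" using sc by (simp add: slice_chart_def)
  have V: "open (slice_dom c)" using sc by (rule slice_dom_open)
  obtain r where r: "r > 0" "cball y r \<subseteq> slice_dom c" using V y open_contains_cball by blast
  define K where "K = cball y r"
  define g where "g = (\<lambda>n x. snd c (F n (slice_param c x)))"
  define g0 where "g0 = (\<lambda>x. snd c (slice_param c x))"
  have "slice_param c ` K \<subseteq> fst c" using r slice_param_mem(1)[OF sc] by (auto simp: K_def)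
  then have "(\<forall>\<^sub>F n in sequentially. F n ` slice_param c ` K \<subseteq> fst c) \<and>
      (\<forall>vs. uniform_limit K (\<lambda>n. iter_deriv vs (snd c \<circ> F n \<circ> slice_param c))
              (iter_deriv vs (snd c \<circ> (\<lambda>p. p) \<circ> slice_param c)) sequentially)"
    using conv[unfolded smooth_convergence_def, THEN spec[of _ c], THEN spec[of _ c], THEN spec[of _ K], THEN mp]
      sc c r by (simp add: K_def)
  then have in_c: "\<forall>\<^sub>F n in sequentially. F n ` slice_param c ` K \<subseteq> fst c"
    and ul: "uniform_limit K (\<lambda>n. iter_deriv vs (g n)) (iter_deriv vs g0) sequentially" for vs
    by (simp_all add: g_def g0_def o_def)
  let ?F = "sequentially \<times>\<^sub>F nhds y"
  have near: "\<forall>\<^sub>F q in ?F. snd q \<in> ball y r"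
    using r by (intro eventually_prod_snd eventually_nhds_in_open) auto
  have u_in: "\<forall>\<^sub>F q in ?F. F (fst q) (slice_param c (snd q)) \<in> fst c"
    using near eventually_prod_fst[OF in_c] by eventually_elim (auto simp: K_def)
  have smooth_c: "\<forall>\<^sub>F n in sequentially. smooth_map_on A (slice_dom c) (\<lambda>y. F n (slice_param c y))"
    using sc by (rule smooth)
  have der: "\<forall>\<^sub>F q in ?F. (g (fst q) has_derivative frechet_derivative (g (fst q)) (at (snd q))) (at (snd q))"
    using near eventually_prod_fst[OF smooth_c] u_in
  proof eventually_elim
    case (elim q)
    have "snd q \<in> {y \<in> slice_dom c. F (fst q) (slice_param c y) \<in> fst c}"
      using elim(1,3) r by auto
    then show ?case unfolding g_def
      using smooth_on_has_derivative[OF smooth_map_on_chart(2)[OF c V elim(2)]] by blast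
  qed
  have lim: "((\<lambda>q. iter_deriv vs (g (fst q)) (snd q)) \<longlongrightarrow> l) ?F"
    if l: "\<And>x. x \<in> slice_dom c \<Longrightarrow> iter_deriv vs g0 x = lf x" "isCont lf y" "l = lf y" for vs l lf
  proof (rule tendstoI)
    fix e :: real assume e: "e > 0"
    have 1: "\<forall>\<^sub>F n in sequentially. \<forall>x\<in>K. dist (iter_deriv vs (g n) x) (iter_deriv vs g0 x) < e / 2"
      using ul[of vs] e by (intro uniform_limitD) auto
    have 2: "\<forall>\<^sub>F x in nhds y. dist (lf x) l < e / 2"
      using tendstoD[OF isCont_tendsto_nhds[OF l(2)], of "e / 2"] e l(3) by simp
    from near eventually_prod_fst[OF 1] eventually_prod_snd[OF 2]
    show "\<forall>\<^sub>F q in ?F. dist (iter_deriv vs (g (fst q)) (snd q)) l < e"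
    proof eventually_elim
      case (elim q)
      then have "snd q \<in> K" "snd q \<in> slice_dom c" using r by (auto simp: K_def)
      then have "dist (iter_deriv vs (g (fst q)) (snd q)) (lf (snd q)) < e / 2"
        using elim(2) l(1) by metis
      with elim(3) dist_triangle[of "iter_deriv vs (g (fst q)) (snd q)" l "lf (snd q)"] show ?case
        by linarith
    qed
  qed
  have g0: "g0 x = (x, 0)" if "x \<in> slice_dom c" for x
    using slice_param_mem(3)[OF sc that] by (simp add: g0_def)
  have "((\<lambda>q. iter_deriv [] (g (fst q)) (snd q)) \<longlongrightarrow> (y, 0)) ?F"
    by (rule lim[of "[]" "\<lambda>x. (x, 0)"]) (auto simp: g0 intro!: continuous_intros)
  then have val: "((\<lambda>q. g (fst q) (snd q)) \<longlongrightarrow> (y, 0)) ?F" by simp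
  have "frechet_derivative g0 (at x) v = (v, 0)" if x: "x \<in> slice_dom c" for x v
  proof -
    have "bounded_linear (\<lambda>x :: 'f. (x, 0 :: 'f))"
      by (intro bounded_linear_Pair bounded_linear_ident bounded_linear_zero)
    then have "((\<lambda>x. (x, 0 :: 'f)) has_derivative (\<lambda>v. (v, 0))) (at x)" by (rule bounded_linear_imp_has_derivative)
    then have "(g0 has_derivative (\<lambda>v. (v, 0))) (at x)"
      by (rule has_derivative_transform_within_open[OF _ V x]) (simp add: g0)
    then show ?thesis using frechet_derivative_at by metis
  qed
  then have "((\<lambda>q. iter_deriv [v] (g (fst q)) (snd q)) \<longlongrightarrow> (v, 0)) ?F" for v
    by (intro lim[of "[v]" "\<lambda>x. (v, 0)"]) auto
  then have der_lim: "((\<lambda>q. frechet_derivative (g (fst q)) (at (snd q)) v) \<longlongrightarrow> (v, 0)) ?F" for v by simp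
  define D where "D = (\<lambda>q. Blinfun (frechet_derivative (g (fst q)) (at (snd q))))"
  have D: "\<forall>\<^sub>F q in ?F. blinfun_apply (D q) = frechet_derivative (g (fst q)) (at (snd q))"
    using der unfolding D_def
    by eventually_elim (rule bounded_linear_Blinfun_apply[OF has_derivative_bounded_linear])
  have "(D \<longlongrightarrow> slice_inclusion) ?F"
  proof (rule tendsto_componentwise1)
    fix j :: 'f
    have "((\<lambda>q. frechet_derivative (g (fst q)) (at (snd q)) j) \<longlongrightarrow> blinfun_apply slice_inclusion j) ?F"
      using der_lim by (simp add: slice_inclusion_apply)
    then show "((\<lambda>q. blinfun_apply (D q) j) \<longlongrightarrow> blinfun_apply slice_inclusion j) ?F"
      by (rule Lim_transform_eventually) (use D in eventually_elim, simp)
  qed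
  moreover have "\<forall>\<^sub>F q in ?F. (g (fst q) has_derivative blinfun_apply (D q)) (at (snd q))"
    using D der by eventually_elim simp
  ultimately have "C1_limit g y (y, 0) slice_inclusion"
    using val unfolding C1_limit_def by (intro exI[of _ D] conjI)
  with u_in show "chart_limit c (\<lambda>n y. F n (slice_param c y)) y (slice_param c y) slice_inclusion"
    using slice_param_mem(3)[OF sc y] by (simp add: chart_limit_def g_def)
qed
qed

end

context smooth_mfd
begin

section \<open>Tensors under diffeomorphisms\<close>

lemma change_coords_derivative:
  assumes "c \<in> A" "d \<in> A" "p \<in> fst c" "p \<in> fst d"
  shows "((\<lambda>x. snd d (param c x)) has_derivative change_coords c d p) (at (snd c p))"
proof -
  have "snd c p \<in> snd c ` (fst c \<inter> fst d)" using assms by blast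
  from smooth_on_has_derivative[OF transition_smooth[OF assms(1,2)] this]
  show ?thesis by (simp add: change_coords_def o_def)
qed

lemma pull_chart_mem:
  assumes "p \<in> topspace X"
  shows "p \<in> fst (pull_chart X \<phi> c) \<longleftrightarrow> \<phi> p \<in> fst c" "snd (pull_chart X \<phi> c) p = snd c (\<phi> p)"
  using assms by (simp_all add: pull_chart_def)

lemma param_pull_chart:
  assumes \<phi>: "diffeos X A \<phi> \<psi>" and c: "c \<in> A" and x: "x \<in> snd c ` fst c"
  shows "param (pull_chart X \<phi> c) x = \<psi> (param c x)"
proof -
  have "param c x \<in> topspace X" using param_in[OF x] chart_subset[OF c] by blast
  note top = diffeosD(2)[OF \<phi> this] and inv = diffeosD(4)[OF \<phi> this]
  have "\<psi> (param c x) \<in> fst (pull_chart X \<phi> c)"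
    using top inv param_in[OF x] by (simp add: pull_chart_mem)
  from param_chart[OF diffeosD(5)[OF \<phi> c] this] show ?thesis
    using top inv x by (simp add: pull_chart_mem)
qed

lemma change_coords_pull:
  assumes \<phi>: "diffeos X A \<phi> \<psi>" and c: "c \<in> A" and d: "d \<in> A"
    and q: "q \<in> topspace X" "\<phi> q \<in> fst c" "\<phi> q \<in> fst d"
  shows "change_coords (pull_chart X \<phi> c) (pull_chart X \<phi> d) q = change_coords c d (\<phi> q)"
proof -
  have "((\<lambda>x. snd d (param c x)) has_derivative change_coords c d (\<phi> q)) (at (snd c (\<phi> q)))"
    by (rule change_coords_derivative[OF c d q(2,3)])
  then have "((\<lambda>x. snd (pull_chart X \<phi> d) (param (pull_chart X \<phi> c) x)) has_derivative change_coords c d (\<phi> q))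
      (at (snd c (\<phi> q)))"
  proof (rule has_derivative_transform_within_open[OF _ chart_open_image[OF c]])
    fix x assume x: "x \<in> snd c ` fst c"
    then have "param c x \<in> topspace X" using param_in[OF x] chart_subset[OF c] by blast
    then show "snd d (param c x) = snd (pull_chart X \<phi> d) (param (pull_chart X \<phi> c) x)"
      using param_pull_chart[OF \<phi> c x] diffeosD(4)[OF \<phi>] by (simp add: pull_chart_def)
  qed (use q in blast)
  from frechet_derivative_at[OF this] show ?thesis
    using q(1) by (simp add: change_coords_def o_def pull_chart_mem)
qed

text \<open>The components of the push-forward of \<open>J\<close> in a chart \<open>c\<close> at \<open>p\<close> are the components of \<open>J\<close> in the chart
  \<open>c \<circ> \<phi>\<close> at \<open>\<psi> p\<close>. So the properties of a tensor field are inherited from \<open>J\<close> chart by chart.\<close>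

definition push_tensor11 :: "('a \<Rightarrow> 'a) \<Rightarrow> ('a \<Rightarrow> 'a) \<Rightarrow> ('a, 'e) tensor11 \<Rightarrow> ('a, 'e) tensor11" where
  "push_tensor11 \<phi> \<psi> J = (\<lambda>c p. J (pull_chart X \<phi> c) (\<psi> p))"

lemma push_almost_complex:
  assumes \<phi>: "diffeos X A \<phi> \<psi>" and J: "almost_complex_structure A J"
  shows "almost_complex_structure A (push_tensor11 \<phi> \<psi> J)"
proof -
  have lin: "\<And>c p. c \<in> A \<Longrightarrow> p \<in> fst c \<Longrightarrow> linear (J c p)"
    and sm: "\<And>c u. c \<in> A \<Longrightarrow> smooth_on (\<lambda>x. J c (param c x) u) (snd c ` fst c)"
    and law: "\<And>c d p u. c \<in> A \<Longrightarrow> d \<in> A \<Longrightarrow> p \<in> fst c \<Longrightarrow> p \<in> fst d \<Longrightarrow>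
      change_coords c d p (J c p u) = J d p (change_coords c d p u)"
    and sq: "\<And>c p u. c \<in> A \<Longrightarrow> p \<in> fst c \<Longrightarrow> J c p (J c p u) = - u"
    using J unfolding almost_complex_structure_def smooth_tensor11_def by blast+
  have mem: "\<psi> p \<in> fst (pull_chart X \<phi> c)" "\<psi> p \<in> topspace X" "\<phi> (\<psi> p) = p" if "c \<in> A" "p \<in> fst c" for c p
  proof -
    have "p \<in> topspace X" using that chart_subset by blast
    then show "\<psi> p \<in> fst (pull_chart X \<phi> c)" "\<psi> p \<in> topspace X" "\<phi> (\<psi> p) = p"
      using that(2) diffeosD[OF \<phi>] by (simp_all add: pull_chart_mem)
  qed
  have smooth': "smooth_on (\<lambda>x. J (pull_chart X \<phi> c) (\<psi> (param c x)) u) (snd c ` fst c)" if c: "c \<in> A" for c u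
  proof -
    let ?e = "pull_chart X \<phi> c"
    have "snd ?e ` fst ?e = snd c ` fst c"
    proof
      show "snd ?e ` fst ?e \<subseteq> snd c ` fst c" by (auto simp: pull_chart_def)
      show "snd c ` fst c \<subseteq> snd ?e ` fst ?e"
      proof
        fix x assume "x \<in> snd c ` fst c"
        then obtain p where p: "p \<in> fst c" "x = snd c p" by blast
        then show "x \<in> snd ?e ` fst ?e"
          using mem[OF c p(1)] by (intro image_eqI[of _ _ "\<psi> p"]) (simp_all add: pull_chart_mem)
      qed
    qed
    with sm[OF diffeosD(5)[OF \<phi> c], of u]
    have "smooth_on (\<lambda>x. J ?e (param ?e x) u) (snd c ` fst c)" by simp
    then show ?thesis
      by (rule smooth_on_cong[OF chart_open_image[OF c], rotated]) (simp add: param_pull_chart[OF \<phi> c])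
  qed
  have law': "change_coords c d p (J (pull_chart X \<phi> c) (\<psi> p) u)
      = J (pull_chart X \<phi> d) (\<psi> p) (change_coords c d p u)"
    if c: "c \<in> A" and d: "d \<in> A" and p: "p \<in> fst c" "p \<in> fst d" for c d p u
    using law[OF diffeosD(5)[OF \<phi> c] diffeosD(5)[OF \<phi> d] mem(1)[OF c p(1)] mem(1)[OF d p(2)], of u]
      change_coords_pull[OF \<phi> c d mem(2)[OF c p(1)]] mem(3)[OF c p(1)] p by simp
  show ?thesis
    unfolding almost_complex_structure_def smooth_tensor11_def push_tensor11_def
  proof (intro conjI ballI allI)
    fix c p assume c: "c \<in> A" "p \<in> fst c"
    show "linear (J (pull_chart X \<phi> c) (\<psi> p))"
      by (rule lin[OF diffeosD(5)[OF \<phi> c(1)] mem(1)[OF c]])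
    show "J (pull_chart X \<phi> c) (\<psi> p) (J (pull_chart X \<phi> c) (\<psi> p) u) = - u" for u
      by (rule sq[OF diffeosD(5)[OF \<phi> c(1)] mem(1)[OF c]])
  next
    fix c d p u assume "c \<in> A" "d \<in> A" "p \<in> fst c \<inter> fst d"
    then show "change_coords c d p (J (pull_chart X \<phi> c) (\<psi> p) u)
      = J (pull_chart X \<phi> d) (\<psi> p) (change_coords c d p u)" using law' by blast
  qed (rule smooth')
qed

text \<open>The form \<open>\<omega>\<close> pulled back by \<open>\<phi>\<close> and evaluated on \<open>v, J v\<close> at \<open>q\<close> loses at most the proportion \<open>\<epsilon>\<close>
  of its value.\<close>

definition almost_preserves ::
  "('a, 'e) tensor02 \<Rightarrow> ('a, 'e) tensor11 \<Rightarrow> real \<Rightarrow> ('a \<Rightarrow> 'a) \<Rightarrow> 'a \<Rightarrow> bool" where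
  "almost_preserves \<omega> J \<epsilon> \<phi> q \<longleftrightarrow> (\<forall>c\<in>A. \<phi> q \<in> fst c \<longrightarrow>
     (\<forall>v. (1 - \<epsilon>) * \<omega> (pull_chart X \<phi> c) q v (J (pull_chart X \<phi> c) q v)
        \<le> \<omega> c (\<phi> q) v (J (pull_chart X \<phi> c) q v)))"

lemma push_tame:
  assumes \<phi>: "diffeos X A \<phi> \<psi>" and J: "J \<in> tame_structures A \<omega>" and \<epsilon>: "\<epsilon> < 1"
    and pres: "\<And>q. q \<in> topspace X \<Longrightarrow> almost_preserves \<omega> J \<epsilon> \<phi> q"
  shows "push_tensor11 \<phi> \<psi> J \<in> tame_structures A \<omega>"
proof -
  have "0 < \<omega> c p u (push_tensor11 \<phi> \<psi> J c p u)" if c: "c \<in> A" and p: "p \<in> fst c" and u: "u \<noteq> 0" for c p u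
  proof -
    let ?e = "pull_chart X \<phi> c" and ?q = "\<psi> p"
    have "p \<in> topspace X" using c p chart_subset by blast
    then have q: "?q \<in> topspace X" "\<phi> ?q = p" "?q \<in> fst ?e"
      using diffeosD[OF \<phi>] p by (simp_all add: pull_chart_mem)
    have "\<omega> ?e ?q u (J ?e ?q u) > 0"
      using J diffeosD(5)[OF \<phi> c] q(3) u unfolding tame_structures_def by blast
    then have "(1 - \<epsilon>) * \<omega> ?e ?q u (J ?e ?q u) > 0" using \<epsilon> by simp
    also have "\<dots> \<le> \<omega> c (\<phi> ?q) u (J ?e ?q u)"
      using pres[OF q(1)] c p q(2) unfolding almost_preserves_def by simp
    finally show ?thesis using q(2) by (simp add: push_tensor11_def)
  qed
  moreover have "almost_complex_structure A J" using J unfolding tame_structures_def by blast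
  ultimately show ?thesis
    using push_almost_complex[OF \<phi>] unfolding tame_structures_def by blast
qed

text \<open>The condition involves the pair of charts \<open>c \<circ> \<phi>\<close> at \<open>q\<close> and \<open>c\<close> at \<open>\<phi> q\<close>, in which the derivative of
  \<open>\<phi>\<close> is the identity. If one chart \<open>b\<close> contains both \<open>q\<close> and \<open>\<phi> q\<close>, the tensor laws and the chain rule
  turn it into an inequality in \<open>b\<close> that contains the derivative \<open>D\<close> of \<open>\<phi>\<close>.\<close>

lemma almost_preserves_in_chart:
  assumes \<phi>: "diffeos X A \<phi> \<psi>" and \<omega>: "smooth_tensor02 A \<omega>" and J: "smooth_tensor11 A J"
    and b: "b \<in> A" "q \<in> fst b" "\<phi> q \<in> fst b"
    and D: "((\<lambda>x. snd b (\<phi> (param b x))) has_derivative D) (at (snd b q))"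
    and ineq: "\<And>y. (1 - \<epsilon>) * \<omega> b q y (J b q y) \<le> \<omega> b (\<phi> q) (D y) (D (J b q y))"
  shows "almost_preserves \<omega> J \<epsilon> \<phi> q"
  unfolding almost_preserves_def
proof (intro ballI impI allI)
  fix c v assume c: "c \<in> A" "\<phi> q \<in> fst c"
  have \<omega>_law: "\<omega> c p u v = \<omega> d p (change_coords c d p u) (change_coords c d p v)"
    if "c \<in> A" "d \<in> A" "p \<in> fst c" "p \<in> fst d" for c d p u v
    using \<omega> that unfolding smooth_tensor02_def by blast
  have J_law: "change_coords c d p (J c p u) = J d p (change_coords c d p u)"
    if "c \<in> A" "d \<in> A" "p \<in> fst c" "p \<in> fst d" for c d p u
    using J that unfolding smooth_tensor11_def by blast
  let ?e = "pull_chart X \<phi> c"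
  have qX: "q \<in> topspace X" using b chart_subset by blast
  have e: "?e \<in> A" "q \<in> fst ?e" "snd ?e q = snd c (\<phi> q)"
    using diffeosD(5)[OF \<phi> c(1)] c(2) qX by (simp_all add: pull_chart_mem)
  let ?C = "change_coords c b (\<phi> q)" and ?C' = "change_coords ?e b q"
  have C': "((\<lambda>x. snd b (param ?e x)) has_derivative ?C') (at (snd ?e q))"
    by (rule change_coords_derivative[OF e(1) b(1) e(2) b(2)])
  have "((\<lambda>x. snd b (\<phi> (param b x))) has_derivative D) (at (snd b (param ?e (snd ?e q))))"
    using D by (simp add: param_chart[OF e(1,2)])
  from has_derivative_compose[OF C' this]
  have "((\<lambda>x. snd b (\<phi> (param b (snd b (param ?e x))))) has_derivative (\<lambda>v. D (?C' v))) (at (snd c (\<phi> q)))"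
    unfolding e(3) .
  then have "((\<lambda>x. snd b (param c x)) has_derivative (\<lambda>v. D (?C' v))) (at (snd c (\<phi> q)))"
  proof (rule has_derivative_transform_within_open)
    show "open (snd ?e ` (fst ?e \<inter> fst b))"
      by (rule chart_image_open[OF e(1) chart_openin[OF b(1)]])
    show "snd c (\<phi> q) \<in> snd ?e ` (fst ?e \<inter> fst b)"
      using e b by (intro image_eqI[of _ _ q]) simp_all
    fix x assume "x \<in> snd ?e ` (fst ?e \<inter> fst b)"
    then obtain r where r: "r \<in> fst ?e" "r \<in> fst b" "x = snd ?e r" by blast
    then have "r \<in> topspace X" "\<phi> r \<in> fst c" "snd ?e r = snd c (\<phi> r)" by (auto simp: pull_chart_def)
    moreover have "param ?e x = r" using param_chart[OF e(1) r(1)] r(3) by simp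
    moreover have "param b (snd b r) = r" by (rule param_chart[OF b(1) r(2)])
    ultimately show "snd b (\<phi> (param b (snd b (param ?e x)))) = snd b (param c x)"
      using param_chart[OF c(1), of "\<phi> r"] r(3) by metis
  qed
  moreover have "((\<lambda>x. snd b (param c x)) has_derivative ?C) (at (snd c (\<phi> q)))"
    by (rule change_coords_derivative[OF c(1) b(1) c(2) b(3)])
  ultimately have C: "?C u = D (?C' u)" for u using has_derivative_unique by metis
  have "\<omega> ?e q v (J ?e q v) = \<omega> b q (?C' v) (J b q (?C' v))"
    using \<omega>_law[OF e(1) b(1) e(2) b(2)] J_law[OF e(1) b(1) e(2) b(2)] by simp
  moreover have "\<omega> c (\<phi> q) v (J ?e q v) = \<omega> b (\<phi> q) (D (?C' v)) (D (J b q (?C' v)))"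
    using \<omega>_law[OF c(1) b(1) c(2) b(3)] J_law[OF e(1) b(1) e(2) b(2)] C by simp
  ultimately show "(1 - \<epsilon>) * \<omega> ?e q v (J ?e q v) \<le> \<omega> c (\<phi> q) v (J ?e q v)"
    using ineq by simp
qed

lemma bilinear_expansion:
  fixes f :: "'e \<Rightarrow> 'e \<Rightarrow> real"
  assumes "bilinear f"
  shows "f u v = (\<Sum>i\<in>Basis. \<Sum>j\<in>Basis. (u \<bullet> i) * ((v \<bullet> j) * f i j))"
proof -
  have l: "linear (\<lambda>u. f u v)" and r: "linear (f i)" for i
    using assms unfolding bilinear_def by blast+
  have "f u v = (\<Sum>i\<in>Basis. (u \<bullet> i) *\<^sub>R f i v)" by (rule linear_expansion[OF l])
  also have "\<dots> = (\<Sum>i\<in>Basis. (u \<bullet> i) *\<^sub>R (\<Sum>j\<in>Basis. (v \<bullet> j) *\<^sub>R f i j))"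
    by (simp only: linear_expansion[OF r, where v = v])
  finally show ?thesis by (simp add: sum_distrib_left)
qed

lemma tensor02_tendsto:
  assumes \<omega>: "smooth_tensor02 A \<omega>" and b: "b \<in> A" and x0: "x0 \<in> snd b ` fst b"
    and lim: "(f \<longlongrightarrow> x0) F" "(u \<longlongrightarrow> u0) F" "(v \<longlongrightarrow> v0) F"
  shows "((\<lambda>t. \<omega> b (param b (f t)) (u t) (v t)) \<longlongrightarrow> \<omega> b (param b x0) u0 v0) F"
proof -
  have bil: "\<omega> b (param b x) u v = (\<Sum>i\<in>Basis. \<Sum>j\<in>Basis. (u \<bullet> i) * ((v \<bullet> j) * \<omega> b (param b x) i j))"
    if "x \<in> snd b ` fst b" for x u v
  proof (rule bilinear_expansion)
    show "bilinear (\<omega> b (param b x))" using \<omega> b param_in[OF that] unfolding smooth_tensor02_def by blast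
  qed
  have U: "open (snd b ` fst b)" by (rule chart_open_image[OF b])
  have "isCont (\<lambda>x. \<omega> b (param b x) i j) x0" for i j
  proof -
    have "smooth_on (\<lambda>x. \<omega> b (param b x) i j) (snd b ` fst b)"
      using \<omega> b unfolding smooth_tensor02_def by blast
    from bspec[OF continuous_on_eq_continuous_at[OF U, THEN iffD1, OF smooth_on_continuous[OF this]] x0]
    show ?thesis .
  qed
  then have "((\<lambda>t. \<omega> b (param b (f t)) i j) \<longlongrightarrow> \<omega> b (param b x0) i j) F" for i j
    using lim(1) isCont_tendsto_compose by blast
  then have "((\<lambda>t. \<Sum>i\<in>Basis. \<Sum>j\<in>Basis. (u t \<bullet> i) * ((v t \<bullet> j) * \<omega> b (param b (f t)) i j))
      \<longlongrightarrow> (\<Sum>i\<in>Basis. \<Sum>j\<in>Basis. (u0 \<bullet> i) * ((v0 \<bullet> j) * \<omega> b (param b x0) i j))) F"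
    by (intro tendsto_sum tendsto_mult tendsto_inner tendsto_const lim)
  then have "((\<lambda>t. \<Sum>i\<in>Basis. \<Sum>j\<in>Basis. (u t \<bullet> i) * ((v t \<bullet> j) * \<omega> b (param b (f t)) i j))
      \<longlongrightarrow> \<omega> b (param b x0) u0 v0) F"
    using bil[OF x0, of u0 v0] by simp
  then show ?thesis
  proof (rule Lim_transform_eventually)
    show "\<forall>\<^sub>F t in F. (\<Sum>i\<in>Basis. \<Sum>j\<in>Basis. (u t \<bullet> i) * ((v t \<bullet> j) * \<omega> b (param b (f t)) i j))
        = \<omega> b (param b (f t)) (u t) (v t)"
      using topological_tendstoD[OF lim(1) U x0] by eventually_elim (rule bil[symmetric])
  qed
qed

lemma tensor11_tendsto:
  assumes J: "smooth_tensor11 A J" and b: "b \<in> A" and x0: "x0 \<in> snd b ` fst b"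
    and lim: "(f \<longlongrightarrow> x0) F" "(u \<longlongrightarrow> u0) F"
  shows "((\<lambda>t. J b (param b (f t)) (u t)) \<longlongrightarrow> J b (param b x0) u0) F"
proof -
  have ex: "J b (param b x) u = (\<Sum>i\<in>Basis. (u \<bullet> i) *\<^sub>R J b (param b x) i)" if "x \<in> snd b ` fst b" for x u
  proof (rule linear_expansion)
    show "linear (J b (param b x))" using J b param_in[OF that] unfolding smooth_tensor11_def by blast
  qed
  have U: "open (snd b ` fst b)" by (rule chart_open_image[OF b])
  have "isCont (\<lambda>x. J b (param b x) i) x0" for i
  proof -
    have "smooth_on (\<lambda>x. J b (param b x) i) (snd b ` fst b)"
      using J b unfolding smooth_tensor11_def by blast
    from bspec[OF continuous_on_eq_continuous_at[OF U, THEN iffD1, OF smooth_on_continuous[OF this]] x0]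
    show ?thesis .
  qed
  then have "((\<lambda>t. J b (param b (f t)) i) \<longlongrightarrow> J b (param b x0) i) F" for i
    using lim(1) isCont_tendsto_compose by blast
  then have "((\<lambda>t. \<Sum>i\<in>Basis. (u t \<bullet> i) *\<^sub>R J b (param b (f t)) i)
      \<longlongrightarrow> (\<Sum>i\<in>Basis. (u0 \<bullet> i) *\<^sub>R J b (param b x0) i)) F"
    by (intro tendsto_sum tendsto_scaleR tendsto_inner tendsto_const lim)
  then have "((\<lambda>t. \<Sum>i\<in>Basis. (u t \<bullet> i) *\<^sub>R J b (param b (f t)) i) \<longlongrightarrow> J b (param b x0) u0) F"
    using ex[OF x0, of u0] by simp
  then show ?thesis
  proof (rule Lim_transform_eventually)
    show "\<forall>\<^sub>F t in F. (\<Sum>i\<in>Basis. (u t \<bullet> i) *\<^sub>R J b (param b (f t)) i) = J b (param b (f t)) (u t)"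
      using topological_tendstoD[OF lim(1) U x0] by eventually_elim (rule ex[symmetric])
  qed
qed

text \<open>On the unit sphere of tangent vectors at \<open>p\<close> the difference of the two sides tends to
  \<open>\<epsilon> \<omega>(v, J v) > 0\<close>. Both sides are homogeneous of degree \<open>2\<close>, so the compactness of the sphere
  suffices.\<close>

lemma almost_preserves_near:
  assumes diffeo: "\<forall>\<^sub>F n in sequentially. diffeos X A (\<Phi> n) (\<Psi> n)" and \<Phi>: "C1_to_id \<Phi>"
    and \<omega>: "smooth_tensor02 A \<omega>" and J: "J \<in> tame_structures A \<omega>" and \<epsilon>: "\<epsilon> > 0"
    and b: "b \<in> A" "p \<in> fst b"
  shows "\<forall>\<^sub>F t in sequentially \<times>\<^sub>F nhds (snd b p).
    almost_preserves \<omega> J \<epsilon> (\<Phi> (fst t)) (param b (snd t))"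
proof -
  let ?F = "sequentially \<times>\<^sub>F nhds (snd b p)" and ?U = "snd b ` fst b"
  have J11: "smooth_tensor11 A J" using J unfolding tame_structures_def almost_complex_structure_def by blast
  have tame: "0 < \<omega> b p v (J b p v)" if "v \<noteq> 0" for v
    using J b that unfolding tame_structures_def by blast
  define f where "f = (\<lambda>n x. snd b (\<Phi> n (param b x)))"
  have \<Phi>_in: "\<forall>\<^sub>F t in ?F. \<Phi> (fst t) (param b (snd t)) \<in> fst b"
    and "C1_limit f (snd b p) (snd b p) id_blinfun"
    using \<Phi> b unfolding C1_to_id_def chart_limit_def f_def by blast+
  then obtain D where D: "\<forall>\<^sub>F t in ?F. (f (fst t) has_derivative blinfun_apply (D t)) (at (snd t))"
    and limf: "((\<lambda>t. f (fst t) (snd t)) \<longlongrightarrow> snd b p) ?F" and limD: "(D \<longlongrightarrow> id_blinfun) ?F"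
    unfolding C1_limit_def by blast
  have p: "snd b p \<in> ?U" using b by blast
  define Q where "Q = (\<lambda>t v. \<omega> b (param b (f (fst t) (snd t))) (D t v) (D t (J b (param b (snd t)) v))
    - (1 - \<epsilon>) * \<omega> b (param b (snd t)) v (J b (param b (snd t)) v))"
  have "\<forall>\<^sub>F t in ?F. \<forall>v\<in>sphere 0 1. 0 < Q (fst (t, v)) (snd (t, v))"
  proof (rule eventually_compact_uniform[OF compact_sphere])
    fix v :: 'e assume v: "v \<in> sphere 0 1"
    let ?G = "?F \<times>\<^sub>F nhds v"
    have fst: "LIM s ?G. fst s :> ?F" and snd: "((\<lambda>s. snd s) \<longlongrightarrow> v) ?G"
      by (rule filterlim_fst, rule filterlim_snd)
    have x: "((\<lambda>s. snd (fst s)) \<longlongrightarrow> snd b p) ?G"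
      by (rule filterlim_compose[OF filterlim_snd fst])
    have Ds: "((\<lambda>s. D (fst s)) \<longlongrightarrow> id_blinfun) ?G"
      by (rule filterlim_compose[OF limD fst])
    have fs: "((\<lambda>s. f (fst (fst s)) (snd (fst s))) \<longlongrightarrow> snd b p) ?G"
      by (rule filterlim_compose[OF limf fst])
    have Js: "((\<lambda>s. J b (param b (snd (fst s))) (snd s)) \<longlongrightarrow> J b (param b (snd b p)) v) ?G"
      by (rule tensor11_tendsto[OF J11 b(1) p x snd])
    have Dv: "((\<lambda>s. D (fst s) (snd s)) \<longlongrightarrow> id_blinfun v) ?G"
      by (rule blinfun.tendsto[OF Ds snd])
    have DJ: "((\<lambda>s. D (fst s) (J b (param b (snd (fst s))) (snd s))) \<longlongrightarrow> id_blinfun (J b (param b (snd b p)) v)) ?G"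
      by (rule blinfun.tendsto[OF Ds Js])
    have "((\<lambda>s. Q (fst s) (snd s)) \<longlongrightarrow>
        \<omega> b (param b (snd b p)) (id_blinfun v) (id_blinfun (J b (param b (snd b p)) v))
        - (1 - \<epsilon>) * \<omega> b (param b (snd b p)) v (J b (param b (snd b p)) v)) ?G"
      unfolding Q_def
      by (intro tendsto_diff tendsto_mult tendsto_const
          tensor02_tendsto[OF \<omega> b(1) p fs Dv DJ] tensor02_tendsto[OF \<omega> b(1) p x snd Js])
    then have lim: "((\<lambda>s. Q (fst s) (snd s)) \<longlongrightarrow> \<epsilon> * \<omega> b p v (J b p v)) ?G"
      using b by (simp add: algebra_simps)
    have "v \<noteq> 0" using v by auto
    then have "0 < \<epsilon> * \<omega> b p v (J b p v)" using tame \<epsilon> by simp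
    from order_tendstoD(1)[OF lim this]
    show "\<forall>\<^sub>F s in ?G. 0 < Q (fst s) (snd s)" .
  qed
  moreover have "\<forall>\<^sub>F z in nhds (snd b p). z \<in> ?U"
    using p chart_open_image[OF b(1)] by (intro eventually_nhds_in_open)
  then have "\<forall>\<^sub>F t in ?F. snd t \<in> ?U" by (rule eventually_prod_snd)
  moreover have "\<forall>\<^sub>F t in ?F. diffeos X A (\<Phi> (fst t)) (\<Psi> (fst t))"
    using diffeo by (rule eventually_prod_fst)
  ultimately show ?thesis
    using D \<Phi>_in
  proof eventually_elim
    case (elim t)
    let ?q = "param b (snd t)"
    have q: "?q \<in> fst b" "snd b ?q = snd t" using elim(2) by simp_all
    have f: "param b (f (fst t) (snd t)) = \<Phi> (fst t) ?q" using elim(5) b by (simp add: f_def)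
    have bil: "bilinear (\<omega> b r)" if "r \<in> fst b" for r
      using \<omega> b(1) that unfolding smooth_tensor02_def by blast
    have lin: "linear (J b ?q)" using J11 b(1) q(1) unfolding smooth_tensor11_def by blast
    have ineq: "(1 - \<epsilon>) * \<omega> b ?q y (J b ?q y) \<le> \<omega> b (\<Phi> (fst t) ?q) (D t y) (D t (J b ?q y))" for y
    proof (cases "y = 0")
      case True
      then show ?thesis using bil q(1) elim(5) by (simp add: bilinear_lzero blinfun.zero_right)
    next
      case False
      define s where "s = y /\<^sub>R norm y"
      have s: "s \<in> sphere 0 1" "y = norm y *\<^sub>R s" using False by (simp_all add: s_def)
      have "0 < Q t s" using elim(1) s(1) by simp
      then have "0 \<le> (norm y * norm y) * Q t s" by simp
      also have "\<dots> = \<omega> b (\<Phi> (fst t) ?q) (D t (norm y *\<^sub>R s)) (D t (J b ?q (norm y *\<^sub>R s)))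
          - (1 - \<epsilon>) * \<omega> b ?q (norm y *\<^sub>R s) (J b ?q (norm y *\<^sub>R s))"
        using bil[OF q(1)] bil[OF elim(5)]
        by (simp add: Q_def f linear_scale[OF lin] blinfun.scaleR_right bilinear_lmul bilinear_rmul algebra_simps)
      finally show ?thesis using s(2) by simp
    qed
    have "((\<lambda>x. snd b (\<Phi> (fst t) (param b x))) has_derivative blinfun_apply (D t)) (at (snd b ?q))"
      using elim(4) unfolding f_def q(2) .
    with elim(3) \<omega> J11 b(1) q(1) elim(5) show ?case
      by (rule almost_preserves_in_chart[where \<epsilon> = \<epsilon>]) (rule ineq)
  qed
qed

text \<open>The local statement is made uniform over the compact support; outside it \<open>\<Phi> n\<close> is the
  identity near each point, and the inequality reduces to \<open>\<omega>(v, J v) \<ge> 0\<close>.\<close>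

lemma almost_preserves_eventually:
  assumes diffeo: "\<forall>\<^sub>F n in sequentially. diffeos X A (\<Phi> n) (\<Psi> n)" and \<Phi>: "C1_to_id \<Phi>"
    and C: "compactin X C" and supp: "\<forall>\<^sub>F n in sequentially. \<forall>p. p \<notin> C \<longrightarrow> \<Phi> n p = p"
    and \<omega>: "smooth_tensor02 A \<omega>" and J: "J \<in> tame_structures A \<omega>" and \<epsilon>: "\<epsilon> > 0"
  shows "\<forall>\<^sub>F n in sequentially. \<forall>q\<in>topspace X. almost_preserves \<omega> J \<epsilon> (\<Phi> n) q"
proof -
  define \<U> where "\<U> = {U. openin X U \<and> (\<forall>\<^sub>F n in sequentially. \<forall>q\<in>U. almost_preserves \<omega> J \<epsilon> (\<Phi> n) q)}"
  have "C \<subseteq> \<Union>\<U>"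
  proof
    fix p assume "p \<in> C"
    then have "p \<in> topspace X" using compactin_subset_topspace[OF C] by blast
    then obtain b where b: "b \<in> A" "p \<in> fst b" using chart_cover by blast
    obtain Q V where Q: "eventually Q sequentially" and V: "open V" "snd b p \<in> V"
      and QV: "\<And>n x. Q n \<Longrightarrow> x \<in> V \<Longrightarrow> almost_preserves \<omega> J \<epsilon> (\<Phi> n) (param b x)"
      using almost_preserves_near[OF diffeo \<Phi> \<omega> J \<epsilon> b] unfolding eventually_prod_nhds_open by auto
    let ?U = "{q \<in> fst b. snd b q \<in> V}"
    have "almost_preserves \<omega> J \<epsilon> (\<Phi> n) q" if "Q n" "q \<in> ?U" for n q
      using QV[of n "snd b q"] that b(1) by simp
    with Q have "\<forall>\<^sub>F n in sequentially. \<forall>q\<in>?U. almost_preserves \<omega> J \<epsilon> (\<Phi> n) q"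
      by (auto elim!: eventually_mono)
    then have "?U \<in> \<U>" unfolding \<U>_def using chart_preimage_openin[OF b(1) V(1)] by blast
    moreover have "p \<in> ?U" using b V by simp
    ultimately show "p \<in> \<Union>\<U>" by blast
  qed
  then have "\<exists>\<F>. finite \<F> \<and> \<F> \<subseteq> \<U> \<and> C \<subseteq> \<Union>\<F>"
    by (intro compactinD[OF C]) (simp_all add: \<U>_def)
  then obtain \<F> where \<F>: "finite \<F>" "\<F> \<subseteq> \<U>" "C \<subseteq> \<Union>\<F>" by blast
  have "\<forall>\<^sub>F n in sequentially. \<forall>U\<in>\<F>. \<forall>q\<in>U. almost_preserves \<omega> J \<epsilon> (\<Phi> n) q"
    using \<F> by (intro eventually_ball_finite) (auto simp: \<U>_def)
  with diffeo supp show ?thesis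
  proof eventually_elim
    case (elim n)
    show ?case
    proof
      fix q assume q: "q \<in> topspace X"
      show "almost_preserves \<omega> J \<epsilon> (\<Phi> n) q"
      proof (cases "q \<in> C")
        case True
        then show ?thesis using elim(3) \<F>(3) by blast
      next
        case False
        obtain b where b: "b \<in> A" "q \<in> fst b" using q chart_cover by blast
        have fixq: "\<Phi> n q = q" using elim(2) False by blast
        have "closedin X C"
          using compactin_imp_closedin[OF _ C] manifold by (simp add: smooth_manifold_def)
        then have Cc: "openin X (topspace X - C)" by blast
        have D: "((\<lambda>x. snd b (\<Phi> n (param b x))) has_derivative (\<lambda>v. v)) (at (snd b q))"
        proof (rule has_derivative_transform_within_open[OF has_derivative_ident chart_image_open[OF b(1) Cc]])
          show "snd b q \<in> snd b ` (fst b \<inter> (topspace X - C))" using b q False by blast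
          fix x assume "x \<in> snd b ` (fst b \<inter> (topspace X - C))"
          then obtain r where "r \<in> fst b" "r \<notin> C" "x = snd b r" by blast
          then show "x = snd b (\<Phi> n (param b x))" using elim(2) b(1) by simp
        qed
        have J11: "smooth_tensor11 A J"
          using J unfolding tame_structures_def almost_complex_structure_def by blast
        have nonneg: "0 \<le> \<omega> b q y (J b q y)" for y
        proof (cases "y = 0")
          case True
          have "bilinear (\<omega> b q)" using \<omega> b unfolding smooth_tensor02_def by blast
          then show ?thesis using True by (simp add: bilinear_lzero)
        next
          case False
          then show ?thesis using J b unfolding tame_structures_def by (simp add: less_imp_le)
        qed
        have ineq: "(1 - \<epsilon>) * \<omega> b q y (J b q y) \<le> \<omega> b (\<Phi> n q) y (J b q y)" for y
          using nonneg[of y] \<epsilon> fixq by (simp add: algebra_simps)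
        have "\<Phi> n q \<in> fst b" using fixq b by simp
        with elim(1) \<omega> J11 b show ?thesis using D
          by (rule almost_preserves_in_chart[where \<epsilon> = \<epsilon>]) (rule ineq)
      qed
    qed
  qed
qed

end

section \<open>Area of holomorphic disks\<close>

text \<open>The difference \<open>T\<close> of two derivatives is linear and \<open>o(|v|)\<close> along the segments from \<open>z\<close> into \<open>K\<close>, so
  it vanishes on \<open>K - z\<close>, which contains an open set.\<close>

lemma has_derivative_within_convex_unique:
  fixes f :: "'b::euclidean_space \<Rightarrow> 'c::real_normed_vector"
  assumes K: "convex K" "interior K \<noteq> {}" and z: "z \<in> K"
    and D: "(f has_derivative D) (at z within K)" and E: "(f has_derivative E) (at z within K)"
  shows "D = E"
proof -
  define T where "T = (\<lambda>v. D v - E v)"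
  have "((\<lambda>x. f x - f x) has_derivative T) (at z within K)"
    unfolding T_def by (rule has_derivative_diff[OF D E])
  then have T: "((\<lambda>x. 0) has_derivative T) (at z within K)" by simp
  have lin: "linear T" using T by (rule has_derivative_linear)
  have seg: "T (w - z) = 0" if w: "w \<in> K" for w
  proof (rule ccontr)
    assume nz: "T (w - z) \<noteq> 0"
    define e where "e = norm (T (w - z)) / (2 * norm (w - z))"
    have wz: "w \<noteq> z" using nz linear_0[OF lin] by auto
    then have e: "e > 0" using nz by (simp add: e_def)
    obtain d where d: "d > 0" "\<And>y. y \<in> K \<Longrightarrow> norm (y - z) < d \<Longrightarrow> norm (T (y - z)) \<le> e * norm (y - z)"
      using T e unfolding has_derivative_within_alt by auto
    define t where "t = min 1 (d / (2 * norm (w - z)))"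
    have t: "0 < t" "t \<le> 1" using d(1) wz by (auto simp: t_def)
    have "t * norm (w - z) \<le> d / (2 * norm (w - z)) * norm (w - z)"
      by (intro mult_right_mono) (auto simp: t_def)
    also have "\<dots> < d" using d(1) wz by simp
    finally have "t * norm (w - z) < d" .
    moreover have "z + t *\<^sub>R (w - z) \<in> K"
      using convexD[OF K(1) z w, of "1 - t" t] t by (simp add: algebra_simps)
    ultimately have "norm (T (t *\<^sub>R (w - z))) \<le> e * norm (t *\<^sub>R (w - z))"
      using d(2)[of "z + t *\<^sub>R (w - z)"] t(1) by simp
    then have "norm (T (w - z)) \<le> e * norm (w - z)"
      using t(1) by (simp add: linear_scale[OF lin])
    also have "\<dots> = norm (T (w - z)) / 2" using wz by (simp add: e_def)
    finally show False using nz by simp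
  qed
  obtain a where "a \<in> interior K" using K(2) by blast
  then obtain r where r: "r > 0" "ball a r \<subseteq> K" by (meson mem_interior)
  have "T v = 0" for v
  proof (cases "v = 0")
    case True
    then show ?thesis using linear_0[OF lin] by simp
  next
    case False
    define s where "s = r / (2 * norm v)"
    have s: "s > 0" "norm (s *\<^sub>R v) < r" using r(1) False by (auto simp: s_def)
    have "a + s *\<^sub>R v \<in> K" "a \<in> K" using r s by (auto simp: dist_norm)
    then have "T (a + s *\<^sub>R v - z) - T (a - z) = 0" using seg by simp
    then have "T (s *\<^sub>R v) = 0" by (simp flip: linear_diff[OF lin])
    then show ?thesis using s(1) by (simp add: linear_scale[OF lin])
  qed
  then show ?thesis by (simp add: T_def fun_eq_iff)
qed

context smooth_mfd
begin

abbreviation disk :: "complex set" where "disk \<equiv> cball 0 1"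

lemma disk_derivative_unique:
  assumes "z \<in> disk" "(f has_derivative D) (at z within disk)" "(f has_derivative E) (at z within disk)"
  shows "D = E"
  by (rule has_derivative_within_convex_unique[OF convex_cball _ assms]) simp

lemma smooth_map_on_topspace:
  assumes "smooth_map_on A K u" "z \<in> K"
  shows "u z \<in> topspace X"
proof -
  obtain V u' c where "c \<in> A" "z \<in> V" "u' ` V \<subseteq> fst c" "\<And>w. w \<in> V \<inter> K \<Longrightarrow> u' w = u w"
    using assms unfolding smooth_map_on_def by meson
  moreover from this have "u z = u' z" using assms(2) by simp
  ultimately show ?thesis using chart_subset by blast
qed

text \<open>On the closed disk the coordinate expression of \<open>u\<close> only has a derivative within the disk; near each
  point it is the restriction of a smooth map \<open>w\<close> on an open set, whose ordinary derivative it shares.\<close>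

lemma smooth_disk_in_chart:
  assumes u: "smooth_map_on A disk u" and z: "z \<in> disk" and c: "c \<in> A" "u z \<in> fst c"
  obtains V w where "open V" "z \<in> V" "smooth_on w V"
    "\<forall>y\<in>V \<inter> disk. u y \<in> fst c \<and> snd c (u y) = w y"
    "\<forall>y\<in>V \<inter> disk. map_deriv c disk u y = frechet_derivative w (at y)"
    "\<forall>y\<in>V \<inter> disk. (snd c \<circ> u has_derivative map_deriv c disk u y) (at y within disk)"
proof -
  obtain V' u' d where V': "d \<in> A" "open V'" "z \<in> V'" "u' ` V' \<subseteq> fst d" "smooth_on (snd d \<circ> u') V'"
    and eq: "\<And>w. w \<in> V' \<inter> disk \<Longrightarrow> u' w = u w" using u z unfolding smooth_map_on_def by metis
  have u': "smooth_map_on A V' u'" unfolding smooth_map_on_def using V' by blast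
  let ?V = "{y \<in> V'. u' y \<in> fst c}" and ?w = "\<lambda>y. snd c (u' y)"
  note V = smooth_map_on_chart[OF c(1) V'(2) u']
  have same: "u y \<in> fst c \<and> snd c (u y) = ?w y" if "y \<in> ?V" "y \<in> disk" for y
    using that eq[of y] by simp
  have D: "(snd c \<circ> u has_derivative frechet_derivative ?w (at y)) (at y within disk)"
    if y: "y \<in> ?V" "y \<in> disk" for y
  proof -
    obtain d where d: "d > 0" "ball y d \<subseteq> ?V" using V(1) y(1) open_contains_ball by blast
    have "(?w has_derivative frechet_derivative ?w (at y)) (at y within disk)"
      using smooth_on_has_derivative[OF V(2) y(1)] by (rule has_derivative_at_withinI)
    then show ?thesis
    proof (rule has_derivative_transform_within[OF _ d(1) y(2)])
      fix x assume "x \<in> disk" "dist x y < d"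
      moreover from this have "x \<in> ball y d" by (simp add: dist_commute)
      then have "x \<in> ?V" using d(2) by blast
      ultimately show "?w x = (snd c \<circ> u) x" using same[of x] by simp
    qed
  qed
  have M: "map_deriv c disk u y = frechet_derivative ?w (at y)" if y: "y \<in> ?V" "y \<in> disk" for y
  proof -
    have "(snd c \<circ> u has_derivative map_deriv c disk u y) (at y within disk)"
      unfolding map_deriv_def using D[OF y] frechet_derivative_works differentiable_def by blast
    from disk_derivative_unique[OF y(2) this D[OF y]] show ?thesis .
  qed
  have "z \<in> ?V" using z V'(3) eq[of z] c(2) by simp
  moreover have "(snd c \<circ> u has_derivative map_deriv c disk u y) (at y within disk)"
    if y: "y \<in> ?V" "y \<in> disk" for y
    using D[OF y] unfolding M[OF y] .
  ultimately show ?thesis using V same M by (intro that[of ?V ?w]) blast+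
qed

lemma map_deriv_works:
  assumes "smooth_map_on A disk u" "z \<in> disk" "c \<in> A" "u z \<in> fst c"
  shows "(snd c \<circ> u has_derivative map_deriv c disk u z) (at z within disk)"
proof -
  obtain V w where V: "open V" "z \<in> V" and sm: "smooth_on w V"
    and w: "\<forall>y\<in>V \<inter> disk. u y \<in> fst c \<and> snd c (u y) = w y"
    and M: "\<forall>y\<in>V \<inter> disk. map_deriv c disk u y = frechet_derivative w (at y)"
    and D: "\<forall>y\<in>V \<inter> disk. (snd c \<circ> u has_derivative map_deriv c disk u y) (at y within disk)"
    using smooth_disk_in_chart[OF assms] .
  show ?thesis using D V(2) assms(2) by blast
qed

lemma map_deriv_change_chart:
  assumes u: "smooth_map_on A disk u" and z: "z \<in> disk"
    and c: "c \<in> A" "u z \<in> fst c" and d: "d \<in> A" "u z \<in> fst d"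
  shows "map_deriv d disk u z h = change_coords c d (u z) (map_deriv c disk u z h)"
proof -
  obtain V w where V: "open V" "z \<in> V" and sm: "smooth_on w V"
    and w: "\<forall>y\<in>V \<inter> disk. u y \<in> fst c \<and> snd c (u y) = w y"
    and M: "\<forall>y\<in>V \<inter> disk. map_deriv c disk u y = frechet_derivative w (at y)"
    and D: "\<forall>y\<in>V \<inter> disk. (snd c \<circ> u has_derivative map_deriv c disk u y) (at y within disk)"
    using smooth_disk_in_chart[OF u z c] .
  obtain r where r: "r > 0" "ball z r \<subseteq> V" using V open_contains_ball by blast
  have "((\<lambda>x. snd d (param c x)) has_derivative change_coords c d (u z)) (at ((snd c \<circ> u) z))"
    using change_coords_derivative[OF c(1) d(1) c(2) d(2)] by simp
  from has_derivative_compose[OF map_deriv_works[OF u z c] this]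
  have "((\<lambda>y. snd d (param c ((snd c \<circ> u) y))) has_derivative
      (\<lambda>h. change_coords c d (u z) (map_deriv c disk u z h))) (at z within disk)" .
  then have "(snd d \<circ> u has_derivative (\<lambda>h. change_coords c d (u z) (map_deriv c disk u z h))) (at z within disk)"
  proof (rule has_derivative_transform_within[OF _ r(1) z])
    fix x assume x: "x \<in> disk" "dist x z < r"
    then have "x \<in> ball z r" by (simp add: dist_commute)
    then have "x \<in> V" using r(2) by blast
    then have "u x \<in> fst c" using w x(1) by blast
    then show "snd d (param c ((snd c \<circ> u) x)) = (snd d \<circ> u) x" using c(1) by simp
  qed
  from fun_cong[OF disk_derivative_unique[OF z map_deriv_works[OF u z d] this], of h] show ?thesis .
qed

text \<open>The integrand in the definition of \<open>area\<close>. Its continuity makes it integrable, which is needed to compare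
  integrals by comparing integrands.\<close>

definition area_form :: "('a, 'e) tensor02 \<Rightarrow> (complex \<Rightarrow> 'a) \<Rightarrow> complex \<Rightarrow> real" where
  "area_form \<omega> u z = (let c = (SOME c. c \<in> A \<and> u z \<in> fst c)
      in \<omega> c (u z) (map_deriv c disk u z 1) (map_deriv c disk u z \<i>))"

lemma area_form_in_chart:
  assumes \<omega>: "smooth_tensor02 A \<omega>" and u: "smooth_map_on A disk u" and z: "z \<in> disk"
    and c: "c \<in> A" "u z \<in> fst c"
  shows "area_form \<omega> u z = \<omega> c (u z) (map_deriv c disk u z 1) (map_deriv c disk u z \<i>)"
proof -
  define d where "d = (SOME c. c \<in> A \<and> u z \<in> fst c)"
  have d: "d \<in> A \<and> u z \<in> fst d"
    unfolding d_def by (rule someI[of "\<lambda>c. c \<in> A \<and> u z \<in> fst c" c]) (simp add: c)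
  have "\<omega> c (u z) a b = \<omega> d (u z) (change_coords c d (u z) a) (change_coords c d (u z) b)" for a b
    using \<omega> c d unfolding smooth_tensor02_def by blast
  then have "\<omega> c (u z) (map_deriv c disk u z 1) (map_deriv c disk u z \<i>)
      = \<omega> d (u z) (map_deriv d disk u z 1) (map_deriv d disk u z \<i>)"
    using map_deriv_change_chart[OF u z c, of d] d by simp
  then show ?thesis unfolding area_form_def Let_def d_def[symmetric] by simp
qed

lemma area_form_continuous:
  assumes \<omega>: "smooth_tensor02 A \<omega>" and u: "smooth_map_on A disk u"
  shows "continuous_on disk (area_form \<omega> u)"
  unfolding continuous_on_def
proof
  fix z assume z: "z \<in> disk"
  have "u z \<in> topspace X"
    using u z by (rule smooth_map_on_topspace)
  then obtain c where c: "c \<in> A" "u z \<in> fst c" using chart_cover by blast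
  obtain V w where V: "open V" "z \<in> V" and sm: "smooth_on w V"
    and w: "\<forall>y\<in>V \<inter> disk. u y \<in> fst c \<and> snd c (u y) = w y"
    and M: "\<forall>y\<in>V \<inter> disk. map_deriv c disk u y = frechet_derivative w (at y)"
    and D: "\<forall>y\<in>V \<inter> disk. (snd c \<circ> u has_derivative map_deriv c disk u y) (at y within disk)"
    using smooth_disk_in_chart[OF u z c] .
  have lim: "(w \<longlongrightarrow> w z) (at z within disk)"
    "((\<lambda>y. frechet_derivative w (at y) h) \<longlongrightarrow> frechet_derivative w (at z) h) (at z within disk)" for h
  proof -
    have "isCont w z" "isCont (\<lambda>y. frechet_derivative w (at y) h) z"
      using smooth_on_continuous[OF sm] smooth_on_continuous[OF smooth_on_derivative[OF sm]] V
      by (auto simp: continuous_on_eq_continuous_at)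
    then show "(w \<longlongrightarrow> w z) (at z within disk)"
      "((\<lambda>y. frechet_derivative w (at y) h) \<longlongrightarrow> frechet_derivative w (at z) h) (at z within disk)"
      unfolding isCont_def by (auto intro: tendsto_within_subset)
  qed
  have wz: "w z \<in> snd c ` fst c" using w V(2) z by (metis IntI imageI)
  have form: "area_form \<omega> u y = \<omega> c (param c (w y)) (frechet_derivative w (at y) 1) (frechet_derivative w (at y) \<i>)"
    if y: "y \<in> V" "y \<in> disk" for y
  proof -
    have uy: "u y \<in> fst c" "snd c (u y) = w y" using w y by blast+
    have M: "map_deriv c disk u y = frechet_derivative w (at y)" using M y by blast
    have "param c (w y) = u y" using param_chart[OF c(1) uy(1)] uy(2) by simp
    then show ?thesis using area_form_in_chart[OF \<omega> u y(2) c(1) uy(1)] M by simp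
  qed
  have "((\<lambda>y. \<omega> c (param c (w y)) (frechet_derivative w (at y) 1) (frechet_derivative w (at y) \<i>))
      \<longlongrightarrow> area_form \<omega> u z) (at z within disk)"
    unfolding form[OF V(2) z] by (rule tensor02_tendsto[OF \<omega> c(1) wz lim(1) lim(2) lim(2)])
  then show "(area_form \<omega> u \<longlongrightarrow> area_form \<omega> u z) (at z within disk)"
  proof (rule Lim_transform_eventually)
    have "\<forall>\<^sub>F y in at z within disk. y \<in> V"
      using V by (auto simp: eventually_at_topological)
    moreover have "\<forall>\<^sub>F y in at z within disk. y \<in> disk"
      by (auto simp: eventually_at_topological)
    ultimately show "\<forall>\<^sub>F y in at z within disk.
        \<omega> c (param c (w y)) (frechet_derivative w (at y) 1) (frechet_derivative w (at y) \<i>) = area_form \<omega> u y"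
      by eventually_elim (rule form[symmetric])
  qed
qed

lemma area_form_integrable:
  assumes "smooth_tensor02 A \<omega>" "smooth_map_on A disk u"
  shows "set_integrable lborel disk (area_form \<omega> u)"
  unfolding set_integrable_def
  by (rule borel_integrable_compact[OF compact_cball area_form_continuous[OF assms]])

lemma area_eq: "area A \<omega> disk u = (LINT z:disk|lborel. area_form \<omega> u z)"
  by (simp add: area_def area_form_def)

text \<open>Holomorphicity is required in all charts around a point; by the tensor law for \<open>J\<close> one chart
  suffices.\<close>

lemma holomorphic_in_one_chart:
  assumes J: "smooth_tensor11 A J" and u: "smooth_map_on A disk u"
    and hol: "\<And>z. z \<in> disk \<Longrightarrow> \<exists>c\<in>A. u z \<in> fst c \<and>
      (\<forall>h. map_deriv c disk u z (\<i> * h) = J c (u z) (map_deriv c disk u z h))"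
  shows "holomorphic_map A J disk u"
  unfolding holomorphic_map_def
proof (intro conjI ballI impI allI u)
  fix z d h assume z: "z \<in> disk" and d: "d \<in> A" "u z \<in> fst d"
  obtain c where c: "c \<in> A" "u z \<in> fst c"
    and eq: "\<And>h. map_deriv c disk u z (\<i> * h) = J c (u z) (map_deriv c disk u z h)"
    using hol[OF z] by blast
  have "change_coords c d (u z) (J c (u z) v) = J d (u z) (change_coords c d (u z) v)" for v
    using J c d unfolding smooth_tensor11_def by blast
  then show "map_deriv d disk u z (\<i> * h) = J d (u z) (map_deriv d disk u z h)"
    using map_deriv_change_chart[OF u z c d] eq by simp
qed

lemma map_deriv_pull:
  assumes \<phi>: "diffeos X A \<phi> \<psi>" and u: "smooth_map_on A disk u" and uX: "\<And>y. y \<in> disk \<Longrightarrow> u y \<in> topspace X"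
    and z: "z \<in> disk" and c: "c \<in> A" "u z \<in> fst c"
  shows "map_deriv (pull_chart X \<phi> c) disk (\<lambda>y. \<psi> (u y)) z = map_deriv c disk u z"
proof -
  let ?e = "pull_chart X \<phi> c" and ?w = "\<lambda>y. \<psi> (u y)"
  have e: "?e \<in> A" "?w z \<in> fst ?e"
    using diffeosD[OF \<phi>] c uX[OF z] by (simp_all add: pull_chart_mem)
  have w: "smooth_map_on A disk ?w" by (rule smooth_map_on_diffeo[OF diffeos_sym[OF \<phi>] u])
  have "(snd ?e \<circ> ?w has_derivative map_deriv ?e disk ?w z) (at z within disk)"
    by (rule map_deriv_works[OF w z e])
  then have "(snd c \<circ> u has_derivative map_deriv ?e disk ?w z) (at z within disk)"
    by (rule has_derivative_transform[OF z, rotated])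
      (use diffeosD[OF \<phi>] uX in \<open>simp add: pull_chart_def\<close>)
  from disk_derivative_unique[OF z this map_deriv_works[OF u z c]] show ?thesis .
qed

text \<open>The comparison of the disks on \<open>L\<close> with those on \<open>\<phi>(L)\<close>. A disk for the pushed forward
  structure on \<open>\<phi>(L)\<close> is the image of a disk for \<open>J\<close> on \<open>L\<close>, and the area of the image is smaller by at most the
  proportion \<open>\<epsilon>\<close>, since the inequality holds pointwise for \<open>\<omega>(v, J v)\<close>.\<close>

lemma hbar_disk_J_push:
  assumes \<phi>: "diffeos X A \<phi> \<psi>" and \<omega>: "smooth_tensor02 A \<omega>" and J: "J \<in> tame_structures A \<omega>" and \<epsilon>: "\<epsilon> < 1"
    and pres: "\<And>q. q \<in> topspace X \<Longrightarrow> almost_preserves \<omega> J \<epsilon> \<phi> q" and L: "L \<subseteq> topspace X"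
  shows "ereal (1 - \<epsilon>) * hbar_disk_J A \<omega> L J \<le> hbar_disk_J A \<omega> (\<phi> ` L) (push_tensor11 \<phi> \<psi> J)"
  unfolding hbar_disk_J_def[of A \<omega> "\<phi> ` L"]
proof (rule Inf_greatest, safe)
  fix u assume u: "holomorphic_disk A (push_tensor11 \<phi> \<psi> J) (\<phi> ` L) u" and nc: "\<not> u constant_on disk"
  have J11: "smooth_tensor11 A J" using J unfolding tame_structures_def almost_complex_structure_def by blast
  let ?w = "\<lambda>y. \<psi> (u y)"
  have sm: "smooth_map_on A disk u"
    and hol: "\<And>z c h. z \<in> disk \<Longrightarrow> c \<in> A \<Longrightarrow> u z \<in> fst c \<Longrightarrow> map_deriv c disk u z (\<i> * h)
      = J (pull_chart X \<phi> c) (\<psi> (u z)) (map_deriv c disk u z h)"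
    and bd: "u ` sphere 0 1 \<subseteq> \<phi> ` L"
    using u unfolding holomorphic_disk_def holomorphic_map_def push_tensor11_def by blast+
  have uX: "u y \<in> topspace X" if "y \<in> disk" for y
    using sm that by (rule smooth_map_on_topspace)
  have swm: "smooth_map_on A disk ?w" by (rule smooth_map_on_diffeo[OF diffeos_sym[OF \<phi>] sm])
  have chart: "\<exists>c. c \<in> A \<and> u z \<in> fst c \<and> pull_chart X \<phi> c \<in> A \<and> ?w z \<in> fst (pull_chart X \<phi> c) \<and>
      \<phi> (?w z) = u z \<and> ?w z \<in> topspace X \<and>
      map_deriv (pull_chart X \<phi> c) disk ?w z = map_deriv c disk u z" if z: "z \<in> disk" for z
  proof -
    obtain c where c: "c \<in> A" "u z \<in> fst c" using chart_cover uX[OF z] by blast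
    then show ?thesis
      using diffeosD[OF \<phi>] uX[OF z] map_deriv_pull[OF \<phi> sm uX z c]
      by (intro exI[of _ c]) (simp add: pull_chart_mem)
  qed
  have "holomorphic_map A J disk ?w"
  proof (rule holomorphic_in_one_chart[OF J11 swm])
    fix z assume z: "z \<in> disk"
    from chart[OF z] obtain c where c: "c \<in> A" "u z \<in> fst c" "pull_chart X \<phi> c \<in> A"
      "?w z \<in> fst (pull_chart X \<phi> c)" "map_deriv (pull_chart X \<phi> c) disk ?w z = map_deriv c disk u z" by blast
    then show "\<exists>c\<in>A. ?w z \<in> fst c \<and>
        (\<forall>h. map_deriv c disk ?w z (\<i> * h) = J c (?w z) (map_deriv c disk ?w z h))"
      using hol[OF z c(1,2)] by (intro bexI[of _ "pull_chart X \<phi> c"]) simp_all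
  qed
  moreover have "?w ` sphere 0 1 \<subseteq> L"
  proof
    fix p assume "p \<in> ?w ` sphere 0 1"
    then obtain z where z: "z \<in> sphere 0 1" "p = \<psi> (u z)" by blast
    then obtain q where "q \<in> L" "u z = \<phi> q" using bd by blast
    then show "p \<in> L" using z(2) diffeosD(3)[OF \<phi>, of q] L by auto
  qed
  ultimately have hd: "holomorphic_disk A J L ?w" by (simp add: holomorphic_disk_def)
  have "\<not> ?w constant_on disk"
  proof
    assume "?w constant_on disk"
    then obtain p where "\<And>y. y \<in> disk \<Longrightarrow> \<psi> (u y) = p" unfolding constant_on_def by blast
    then have "u y = \<phi> p" if "y \<in> disk" for y using diffeosD(4)[OF \<phi> uX[OF that]] that by metis
    then show False using nc unfolding constant_on_def by blast
  qed
  with hd have "hbar_disk_J A \<omega> L J \<le> ereal (area A \<omega> disk ?w)"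
    unfolding hbar_disk_J_def by (intro Inf_lower) blast
  then have "ereal (1 - \<epsilon>) * hbar_disk_J A \<omega> L J \<le> ereal (1 - \<epsilon>) * ereal (area A \<omega> disk ?w)"
    using \<epsilon> by (intro ereal_mult_left_mono) simp_all
  also have "\<dots> \<le> ereal (area A \<omega> disk u)"
  proof -
    have pointwise: "(1 - \<epsilon>) * area_form \<omega> ?w z \<le> area_form \<omega> u z" if z: "z \<in> disk" for z
    proof -
      from chart[OF z] obtain c where c: "c \<in> A" "u z \<in> fst c" "pull_chart X \<phi> c \<in> A"
        "?w z \<in> fst (pull_chart X \<phi> c)" "\<phi> (?w z) = u z" "?w z \<in> topspace X"
        "map_deriv (pull_chart X \<phi> c) disk ?w z = map_deriv c disk u z" by blast
      have i: "map_deriv c disk u z \<i> = J (pull_chart X \<phi> c) (?w z) (map_deriv c disk u z 1)"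
        using hol[OF z c(1,2), of 1] by simp
      have "\<phi> (?w z) \<in> fst c" using c(2,5) by simp
      with pres[OF c(6)] c(1) have "(1 - \<epsilon>) * \<omega> (pull_chart X \<phi> c) (?w z) v (J (pull_chart X \<phi> c) (?w z) v)
          \<le> \<omega> c (\<phi> (?w z)) v (J (pull_chart X \<phi> c) (?w z) v)" for v
        unfolding almost_preserves_def by blast
      then have ineq: "(1 - \<epsilon>) * \<omega> (pull_chart X \<phi> c) (?w z) v (J (pull_chart X \<phi> c) (?w z) v)
          \<le> \<omega> c (u z) v (J (pull_chart X \<phi> c) (?w z) v)" for v by (simp only: c(5))
      show ?thesis
        using ineq[of "map_deriv c disk u z 1"] area_form_in_chart[OF \<omega> swm z c(3,4)]
          area_form_in_chart[OF \<omega> sm z c(1,2)] c(7) i by simp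
    qed
    have "(1 - \<epsilon>) * (LINT z:disk|lborel. area_form \<omega> ?w z) = (LINT z:disk|lborel. (1 - \<epsilon>) * area_form \<omega> ?w z)"
      by simp
    also have "\<dots> \<le> (LINT z:disk|lborel. area_form \<omega> u z)"
      by (rule set_integral_mono) (use area_form_integrable[OF \<omega> swm] area_form_integrable[OF \<omega> sm] pointwise in auto)
    finally show ?thesis by (simp add: area_eq)
  qed
  finally show "ereal (1 - \<epsilon>) * hbar_disk_J A \<omega> L J \<le> ereal (area A \<omega> disk u)" .
qed

end

text \<open>A structure \<open>J\<close> that witnesses \<open>H < \<hbar>\<^sub>D(L)\<close> is pushed forward along the extensions of the embeddings; \<open>\<epsilon>\<close> is
  so small that the proportion lost does not bring \<open>\<hbar>\<^sub>D(L, J)\<close> down to \<open>H\<close>.\<close>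

lemma hbar_disk_lower_semicontinuous:
  assumes M: "smooth_manifold X A" and \<omega>: "smooth_tensor02 A \<omega>"
    and L: "closed_lagrangian X A \<omega> L" and conv: "submanifolds_converge X A Ls L"
    and H: "H < hbar_disk A \<omega> L"
  obtains K where "H < K" "\<forall>\<^sub>F n in sequentially. K \<le> hbar_disk A \<omega> (Ls n)"
proof -
  interpret slice_mfd X A by unfold_locales (rule M)
  have LX: "compactin X L" and slice: "\<And>p. p \<in> L \<Longrightarrow> \<exists>c. slice_chart A L c \<and> p \<in> fst c"
    using L unfolding closed_lagrangian_def by blast+
  have sub: "L \<subseteq> topspace X" using LX by (rule compactin_subset_topspace)
  obtain F where F: "\<forall>\<^sub>F n in sequentially. smooth_embedding X A L (F n) \<and> F n ` L = Ls n"
    and cF: "smooth_convergence A L F (\<lambda>p. p)"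
    using conv unfolding submanifolds_converge_def by blast
  have "\<forall>\<^sub>F n in sequentially. smooth_embedding X A L (F n)" using F by eventually_elim simp
  from embeddings_C1_to_inclusion[OF sub this cF] have G: "C1_to_inclusion L F" .
  obtain \<Phi> \<Psi> C where diffeo: "\<forall>\<^sub>F n in sequentially. diffeos X A (\<Phi> n) (\<Psi> n)" and C: "compactin X C"
    and supp: "\<forall>\<^sub>F n in sequentially. \<forall>p. p \<notin> C \<longrightarrow> \<Phi> n p = p" and \<Phi>: "C1_to_id \<Phi>"
    and ext: "\<forall>\<^sub>F n in sequentially. \<forall>p\<in>L. \<Phi> n p = F n p"
    using extend_to_diffeos[OF LX slice G] by blast
  obtain J where J: "J \<in> tame_structures A \<omega>" and HJ: "H < hbar_disk_J A \<omega> L J"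
    using H unfolding hbar_disk_def less_SUP_iff by blast
  obtain \<epsilon> where \<epsilon>: "0 < \<epsilon>" "\<epsilon> < 1" "H < ereal (1 - \<epsilon>) * hbar_disk_J A \<omega> L J"
  proof (cases "hbar_disk_J A \<omega> L J")
    case PInf
    then show ?thesis using HJ by (intro that[of "1 / 2"]) auto
  next
    case MInf
    then show ?thesis using HJ by simp
  next
    case (real x)
    show ?thesis
    proof (cases H)
      case (real H')
      (* The loss is at most half of the gap between H and hbar_D(L, J). *)
      define \<epsilon> where "\<epsilon> = min (1 / 2) ((x - H') / (2 * (\<bar>x\<bar> + 1)))"
      have lt: "H' < x" using HJ real \<open>hbar_disk_J A \<omega> L J = ereal x\<close> by simp
      have pos: "0 < \<epsilon>" "\<epsilon> < 1" using lt by (auto simp: \<epsilon>_def)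
      have "\<epsilon> * x \<le> \<epsilon> * (\<bar>x\<bar> + 1)" using pos by (intro mult_left_mono) auto
      also have "\<dots> \<le> (x - H') / (2 * (\<bar>x\<bar> + 1)) * (\<bar>x\<bar> + 1)"
        by (intro mult_right_mono) (auto simp: \<epsilon>_def)
      also have "\<dots> = (x - H') / 2" by (simp add: field_simps)
      finally have "\<epsilon> * x < x - H'" using lt by simp
      then have "H < ereal (1 - \<epsilon>) * hbar_disk_J A \<omega> L J"
        using real \<open>hbar_disk_J A \<omega> L J = ereal x\<close> by (simp add: algebra_simps)
      with pos show ?thesis by (rule that)
    next
      case PInf
      then show ?thesis using HJ by simp
    next
      case MInf
      then show ?thesis using \<open>hbar_disk_J A \<omega> L J = ereal x\<close> by (intro that[of "1 / 2"]) simp_all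
    qed
  qed
  have "\<forall>\<^sub>F n in sequentially. \<forall>q\<in>topspace X. almost_preserves \<omega> J \<epsilon> (\<Phi> n) q"
    by (rule almost_preserves_eventually[OF diffeo \<Phi> C supp \<omega> J \<epsilon>(1)])
  with diffeo ext F have "\<forall>\<^sub>F n in sequentially. ereal (1 - \<epsilon>) * hbar_disk_J A \<omega> L J \<le> hbar_disk A \<omega> (Ls n)"
  proof eventually_elim
    case (elim n)
    have "\<Phi> n ` L = Ls n" using elim(2,3) by (metis image_cong)
    then have "ereal (1 - \<epsilon>) * hbar_disk_J A \<omega> L J \<le> hbar_disk_J A \<omega> (Ls n) (push_tensor11 (\<Phi> n) (\<Psi> n) J)"
      using hbar_disk_J_push[OF elim(1) \<omega> J \<epsilon>(2) _ sub] elim(4) by metis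
    also have "\<dots> \<le> hbar_disk A \<omega> (Ls n)"
      unfolding hbar_disk_def by (rule SUP_upper[OF push_tame[OF elim(1) J \<epsilon>(2)]]) (use elim(4) in blast)
    finally show ?case .
  qed
  with \<epsilon>(3) show ?thesis by (rule that)
qed

theorem proposition2p2:
  fixes X :: "'a topology"
    and A :: "('a, 'f::euclidean_space \<times> 'f) chart set"
    and \<omega> :: "('a, 'f \<times> 'f) tensor02"
    and L :: "'a set"
    and Ls :: "nat \<Rightarrow> 'a set"
    and H :: real
  assumes "symplectic_manifold X A \<omega>"
    and "geometrically_bounded X A \<omega>"
    and "rational_symplectic X A \<omega>"
    and "closed_lagrangian X A \<omega> L"
    and "\<And>n. closed_lagrangian X A \<omega> (Ls n)"
    and "submanifolds_converge X A Ls L"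
    and "(\<lambda>n. hbar A \<omega> (Ls n)) \<longlonglongrightarrow> ereal H"
    and "ereal H < period_generator X A \<omega>"
  shows "hbar A \<omega> L \<le> ereal H"
proof (rule ccontr)
  assume "\<not> hbar A \<omega> L \<le> ereal H"
  then have disk: "ereal H < hbar_disk A \<omega> L" and sphere: "ereal H < hbar_sphere A \<omega>"
    by (simp_all add: hbar_def not_le)
  have "smooth_manifold X A" "smooth_tensor02 A \<omega>"
    using assms(1) unfolding symplectic_manifold_def symplectic_form_def by blast+
  from hbar_disk_lower_semicontinuous[OF this assms(4,6) disk]
  obtain K where K: "ereal H < K" "\<forall>\<^sub>F n in sequentially. K \<le> hbar_disk A \<omega> (Ls n)" .
  have "\<forall>\<^sub>F n in sequentially. min K (hbar_sphere A \<omega>) \<le> hbar A \<omega> (Ls n)"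
    using K(2) unfolding hbar_def by eventually_elim (simp add: min.coboundedI1)
  from tendsto_lowerbound[OF assms(7) this] have "min K (hbar_sphere A \<omega>) \<le> ereal H" by simp
  moreover have "ereal H < min K (hbar_sphere A \<omega>)" using K(1) sphere by simp
  ultimately show False using leD by blast
qed

end
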